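(* Let $h>1$ and $U>0$, and define the constants $$ \mathcal{B}_1=\frac{8}{35}\left[\frac{36}{5}\,\frac{2h^2+3h+2}{(h-1)^2}+\frac65\,\frac{(13h+22)(3h^2-h+3)}{(h-1)^3}+\frac{19h^3+51h^2+75h+65}{3(h-1)^3}\right], $$ $$ \begin{aligned} \mathcal{B}_2&=4Rh+\frac{4(82563626+139273674h+131633079h^2+47395086h^3)}{75150075(h-1)}\\ &\quad+\frac{4(6562533+20038773h+29176308h^2+22648263h^3+5977793h^4)}{25050025(h-1)^2}\\ &\quad+\frac{288(1561958+3280874h+4160951h^2+3491837h^3+1768313h^4+336653h^5)}{425850425(h-1)^3}. \end{aligned} $$ For every $R>h$ there exists a vector field $\Psi_R\in H^1(\Omega_R)$ satisfying $$ \nabla\cdot\Psi_R=0\ \text{ in }\Omega_R,\qquad \Psi_R=(U,0)\ \text{ on }\partial Q_R,\qquad \Psi_R=(0,0)\ \text{ on }\partial B_1 $$ and $$ \|\nabla\Psi_R\|_{L^2(\Omega_R)}=\sqrt{\mathcal{B}_1}\,U,\qquad \|\Psi_R\|_{L^4(\Omega_R)}=\sqrt[4]{\mathcal{B}_2}\,U . $$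
   Context: For $R>h>1$: $Q_R=(-R,R)\times(-h,h)\subset\mathbb{R}^2$, $B_1$ is the open unit disk centered at the origin, and $\Omega_R=Q_R\setminus\overline{B_1}$. Boundary values are in the trace sense. For vector fields $\Psi=(\Psi_1,\Psi_2)$, $\|\Psi\|_{L^4}$ is the $L^4$ norm of the Euclidean length $|\Psi|$ and $\|\nabla\Psi\|_{L^2}^2=\|\nabla\Psi_1\|_{L^2}^2+\|\nabla\Psi_2\|_{L^2}^2$. *)

theory Defs
  imports "HOL-Analysis.Analysis"
begin

section \<open>Smooth functions and Lebesgue spaces\<close>

primrec Ck :: "nat \<Rightarrow> ('a::euclidean_space \<Rightarrow> real) \<Rightarrow> bool" where
  "Ck 0 f \<longleftrightarrow> continuous_on UNIV f"
| "Ck (Suc k) f \<longleftrightarrow> (\<forall>x. f differentiable (at x)) \<and>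
     (\<forall>b\<in>Basis. Ck k (\<lambda>x. frechet_derivative f (at x) b))"

definition smooth :: "('a::euclidean_space \<Rightarrow> real) \<Rightarrow> bool" where
  "smooth f \<longleftrightarrow> (\<forall>k. Ck k f)"

definition test_function :: "'a::euclidean_space set \<Rightarrow> ('a \<Rightarrow> real) \<Rightarrow> bool" where
  "test_function \<Omega> \<phi> \<longleftrightarrow>
     smooth \<phi> \<and> compact (closure {x. \<phi> x \<noteq> 0}) \<and> closure {x. \<phi> x \<noteq> 0} \<subseteq> \<Omega>"

definition grad :: "('a::euclidean_space \<Rightarrow> real) \<Rightarrow> 'a \<Rightarrow> 'a" where
  "grad f x = (\<Sum>b\<in>Basis. frechet_derivative f (at x) b *\<^sub>R b)"

definition Lp :: "nat \<Rightarrow> 'a measure \<Rightarrow> ('a \<Rightarrow> 'b::euclidean_space) set" where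
  "Lp p M = {f \<in> borel_measurable M. integrable M (\<lambda>x. norm (f x) ^ p)}"

definition Lp_norm :: "nat \<Rightarrow> 'a measure \<Rightarrow> ('a \<Rightarrow> 'b::euclidean_space) \<Rightarrow> real" where
  "Lp_norm p M f = root p (LINT x|M. norm (f x) ^ p)"

text \<open>The differences are required to lie in the space, since the Bochner integral of a
  non-integrable function is 0.\<close>

definition Lp_tendsto ::
  "nat \<Rightarrow> 'a measure \<Rightarrow> (nat \<Rightarrow> 'a \<Rightarrow> 'b::euclidean_space) \<Rightarrow> ('a \<Rightarrow> 'b) \<Rightarrow> bool" where
  "Lp_tendsto p M f u \<longleftrightarrow>
     (\<forall>n. (\<lambda>x. f n x - u x) \<in> Lp p M) \<and>
     (\<lambda>n. Lp_norm p M (\<lambda>x. f n x - u x)) \<longlonglongrightarrow> 0"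

section \<open>The Sobolev space of order one and traces\<close>

text \<open>\<open>has_H1_gradient \<Omega> u G\<close>: the function \<open>u\<close> belongs to \<open>H\<^sup>1(\<Omega>)\<close> and \<open>G\<close> is its
  weak gradient, which is determined up to a null set.\<close>

definition has_H1_gradient ::
  "'a::euclidean_space set \<Rightarrow> ('a \<Rightarrow> real) \<Rightarrow> ('a \<Rightarrow> 'a) \<Rightarrow> bool" where
  "has_H1_gradient \<Omega> u G \<longleftrightarrow>
     u \<in> Lp 2 (lebesgue_on \<Omega>) \<and> G \<in> Lp 2 (lebesgue_on \<Omega>) \<and>
     (\<forall>\<phi>. test_function \<Omega> \<phi> \<longrightarrow> (\<forall>b\<in>Basis.
        (LINT x|lebesgue_on \<Omega>. u x * frechet_derivative \<phi> (at x) b) =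
        - (LINT x|lebesgue_on \<Omega>. (G x \<bullet> b) * \<phi> x)))"

text \<open>The arc length measure carried by a piecewise continuously differentiable simple path
  (the finitely many corners are negligible).\<close>

definition arclength_measure :: "(real \<Rightarrow> 'a::euclidean_space) \<Rightarrow> 'a measure" where
  "arclength_measure \<gamma> =
     distr (density (lebesgue_on {0..1}) (\<lambda>t. ennreal (norm (vector_derivative \<gamma> (at t)))))
       borel \<gamma>"

text \<open>For a Lipschitz domain \<open>\<Omega>\<close> and a boundary component with surface measure \<open>\<mu>\<close>, the trace
  operator is the continuous extension to \<open>H\<^sup>1(\<Omega>)\<close>, with values in \<open>L\<^sup>2(\<mu>)\<close>, of the restriction
  map on the functions that are smooth up to the boundary, which are dense in \<open>H\<^sup>1(\<Omega>)\<close>.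
  The predicate below is the graph of this extension.\<close>

definition has_trace ::
  "'a::euclidean_space set \<Rightarrow> 'a measure \<Rightarrow> ('a \<Rightarrow> real) \<Rightarrow> ('a \<Rightarrow> real) \<Rightarrow> bool" where
  "has_trace \<Omega> \<mu> u g \<longleftrightarrow> g \<in> Lp 2 \<mu> \<and>
     (\<exists>G \<phi>. has_H1_gradient \<Omega> u G \<and> (\<forall>n. smooth (\<phi> n)) \<and>
        Lp_tendsto 2 (lebesgue_on \<Omega>) \<phi> u \<and>
        Lp_tendsto 2 (lebesgue_on \<Omega>) (\<lambda>n. grad (\<phi> n)) G \<and>
        Lp_tendsto 2 \<mu> \<phi> g)"

section \<open>Vector fields in the plane\<close>

text \<open>The norm of \<open>real \<times> real\<close> is the Euclidean one. Vector fields belong to a space, and have a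
  trace, if both components do.\<close>

definition has_H1_gradients ::
  "(real \<times> real) set \<Rightarrow> (real \<times> real \<Rightarrow> real \<times> real) \<Rightarrow>
     (real \<times> real \<Rightarrow> real \<times> real) \<Rightarrow> (real \<times> real \<Rightarrow> real \<times> real) \<Rightarrow> bool" where
  "has_H1_gradients \<Omega> \<Psi> G1 G2 \<longleftrightarrow>
     has_H1_gradient \<Omega> (\<lambda>x. fst (\<Psi> x)) G1 \<and> has_H1_gradient \<Omega> (\<lambda>x. snd (\<Psi> x)) G2"

definition has_trace_field ::
  "(real \<times> real) set \<Rightarrow> (real \<times> real) measure \<Rightarrow> (real \<times> real \<Rightarrow> real \<times> real) \<Rightarrow>
     (real \<times> real \<Rightarrow> real \<times> real) \<Rightarrow> bool" where
  "has_trace_field \<Omega> \<mu> \<Psi> g \<longleftrightarrow>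
     has_trace \<Omega> \<mu> (\<lambda>x. fst (\<Psi> x)) (\<lambda>x. fst (g x)) \<and>
     has_trace \<Omega> \<mu> (\<lambda>x. snd (\<Psi> x)) (\<lambda>x. snd (g x))"

section \<open>The domain and its boundary\<close>

definition QR :: "real \<Rightarrow> real \<Rightarrow> (real \<times> real) set" where
  "QR h R = {-R<..<R} \<times> {-h<..<h}"

definition Omega :: "real \<Rightarrow> real \<Rightarrow> (real \<times> real) set" where
  "Omega h R = QR h R - closure (ball 0 1)"

definition rect_path :: "real \<Rightarrow> real \<Rightarrow> real \<Rightarrow> real \<times> real" where
  "rect_path h R = linepath (-R, -h) (R, -h) +++ linepath (R, -h) (R, h) +++
     linepath (R, h) (-R, h) +++ linepath (-R, h) (-R, -h)"

definition circle_path :: "real \<Rightarrow> real \<times> real" where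
  "circle_path t = (cos (2 * pi * t), sin (2 * pi * t))"

lemma closed_segment_horizontal:
  fixes a b c :: real
  assumes "a \<le> b"
  shows "closed_segment (a, c) (b, c) = {a..b} \<times> {c}"
proof -
  have "closed_segment (a, c) (b, c) = (\<lambda>t. (t, c)) ` closed_segment a b"
    unfolding closed_segment_image_interval image_image
    by (rule image_cong) (auto simp: algebra_simps)
  then show ?thesis
    using assms by (auto simp: closed_segment_eq_real_ivl)
qed

lemma closed_segment_vertical:
  fixes a b c :: real
  assumes "a \<le> b"
  shows "closed_segment (c, a) (c, b) = {c} \<times> {a..b}"
proof -
  have "closed_segment (c, a) (c, b) = (\<lambda>t. (c, t)) ` closed_segment a b"
    unfolding closed_segment_image_interval image_image
    by (rule image_cong) (auto simp: algebra_simps)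
  then show ?thesis
    using assms by (auto simp: closed_segment_eq_real_ivl)
qed

lemma path_image_rect_path:
  assumes "0 < h" "0 < R"
  shows "path_image (rect_path h R) = frontier (QR h R)"
proof -
  have Q: "QR h R = box (-R, -h) (R, h)"
    unfolding QR_def by (auto simp: box_def Basis_prod_def)
  have "box (-R, -h) (R, h) \<noteq> {}"
    using assms by (auto simp: box_ne_empty Basis_prod_def)
  then have "frontier (QR h R) = {-R..R} \<times> {-h..h} - {-R<..<R} \<times> {-h<..<h}"
    unfolding Q frontier_box by (auto simp: box_def cbox_def Basis_prod_def)
  moreover have "path_image (rect_path h R) =
      {-R..R} \<times> {-h} \<union> {R} \<times> {-h..h} \<union> {-R..R} \<times> {h} \<union> {-R} \<times> {-h..h}"
    using assms closed_segment_horizontal[of "-R" R "-h"] closed_segment_vertical[of "-h" h R]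
      closed_segment_horizontal[of "-R" R h] closed_segment_vertical[of "-h" h "-R"]
      closed_segment_commute[of "(R, h)" "(-R, h)"] closed_segment_commute[of "(-R, h)" "(-R, -h)"]
    unfolding rect_path_def by (simp add: path_image_join Un_assoc)
  ultimately show ?thesis
    using assms by auto
qed

lemma path_image_circle_path: "path_image circle_path = frontier (ball 0 1)"
proof -
  have "z \<in> path_image circle_path \<longleftrightarrow> norm z = 1" for z
  proof (cases z)
    case (Pair x y)
    show ?thesis
    proof
      assume "z \<in> path_image circle_path"
      then show "norm z = 1"
        by (auto simp: path_image_def circle_path_def norm_Pair)
    next
      assume "norm z = 1"
      then have "x\<^sup>2 + y\<^sup>2 = 1"
        by (simp add: Pair norm_Pair)
      then obtain t where t: "0 \<le> t" "t < 2 * pi" "x = cos t" "y = sin t"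
        using sincos_total_2pi by metis
      then have "z = circle_path (t / (2 * pi))" "t / (2 * pi) \<in> {0..1}"
        by (auto simp: Pair circle_path_def divide_simps)
      then show "z \<in> path_image circle_path"
        unfolding path_image_def by blast
    qed
  qed
  then show ?thesis
    by (auto simp: frontier_ball sphere_def)
qed

section \<open>The constants\<close>

definition B1 :: "real \<Rightarrow> real" where
  "B1 h = 8 / 35 *
     (36 / 5 * ((2 * h^2 + 3 * h + 2) / (h - 1)^2)
      + 6 / 5 * ((13 * h + 22) * (3 * h^2 - h + 3) / (h - 1)^3)
      + (19 * h^3 + 51 * h^2 + 75 * h + 65) / (3 * (h - 1)^3))"

definition B2 :: "real \<Rightarrow> real \<Rightarrow> real" where
  "B2 h R = 4 * R * h
     + 4 * (82563626 + 139273674 * h + 131633079 * h^2 + 47395086 * h^3)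
         / (75150075 * (h - 1))
     + 4 * (6562533 + 20038773 * h + 29176308 * h^2 + 22648263 * h^3 + 5977793 * h^4)
         / (25050025 * (h - 1)^2)
     + 288 * (1561958 + 3280874 * h + 4160951 * h^2 + 3491837 * h^3 + 1768313 * h^4
              + 336653 * h^5)
         / (425850425 * (h - 1)^3)"

end

theory Submission
  imports Defs
begin

text \<open>Put \<open>m = h - 1\<close>. The field is the rotated gradient of the stream function
  \<open>U (y - \<chi>(x) k(y))\<close>, where \<open>\<chi>\<close> is the cubic cut-off that is 1 on \<open>[-1, 1]\<close> and 0 outside
  \<open>(-h, h)\<close>, and \<open>k(y) = y + s\<close> on \<open>[-1, 1]\<close> and \<open>k = 0\<close> outside \<open>(-h, h)\<close>; it is therefore
  divergence free, vanishes on the square \<open>[-1, 1]\<^sup>2\<close> that contains the disk and equals \<open>(U, 0)\<close>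
  on the boundary of the rectangle. For \<open>1 < \<bar>y\<bar> < h\<close> and \<open>t = (\<bar>y\<bar> - 1) / m\<close> the profile is
  \<open>k(y) = (1 - 3t\<^sup>2 + 2t\<^sup>3) (sgn y (1 + m t + c t\<^sup>2) + s)\<close>.

  For \<open>c = s = 0\<close> the gradient norm is the required one, but the \<open>L\<^sup>4\<close> norm is too small. A negative
  \<open>c = -\<theta> m\<close> lowers the gradient norm, and a suitable \<open>s\<close>, which lets more fluid pass on one side of
  the disk, restores it. At \<open>\<theta> = 1\<close> the \<open>L\<^sup>4\<close> norm exceeds the required one, so that the
  intermediate value theorem yields the field. All integrals are sums of products of
  one-dimensional moments, because the field is a sum of products of functions of \<open>x\<close> and of \<open>y\<close>.

  Such products of piecewise continuously differentiable functions have the expected weak gradient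
  by Fubini's theorem and integration by parts. For the traces, the derivatives of the factors are
  almost everywhere limits of bounded difference quotients, which are approximated by polynomials;
  dominated convergence gives convergence on the domain and on its boundary.\<close>

section \<open>Polynomials are smooth\<close>

text \<open>Two norms are prescribed exactly, so the family needs two free parameters that leave the
  divergence, the boundary values and the regularity alone. The cubic factor has value 1 and slope 0
  at t = 0 and a double zero at t = 1, so adding c t^2 changes neither values nor slopes at the
  junctions. The shift s only adds a constant to the stream function on the square. Reflection in y
  exchanges s and -s, so both energies are even in s. The gradient energy is moreover affine in s^2,
  with a slope that does not depend on \<theta>; the gradient constraint therefore gives s^2
  explicitly, and one equation in \<theta> remains. The length R enters only through the area term
  4Rh of the uniform flow, because the correction is supported where \<bar>x\<bar> \<le> h < R. The
  same term stands in \<open>B2\<close>, so the choice of parameters does not see R. The domain is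
  not a product because of the hole, but the field and its gradient vanish on the disk, so all
  integrals may be taken over the full rectangle, where Fubini's theorem applies.\<close>

lemma real_polynomial_function_has_derivative:
  fixes f :: "'a::euclidean_space \<Rightarrow> real"
  assumes "real_polynomial_function f"
  shows "\<exists>D. (\<forall>x. (f has_derivative D x) (at x)) \<and> (\<forall>b. real_polynomial_function (\<lambda>x. D x b))"
  using assms
proof induct
  case (linear f)
  then show ?case
    by (intro exI[of _ "\<lambda>x. f"])
      (auto intro: bounded_linear.has_derivative[OF _ has_derivative_ident])
next
  case (const c)
  show ?case
    by (intro exI[of _ "\<lambda>x y. 0"]) auto
next
  case (add f g)
  then obtain D E where "\<forall>x. (f has_derivative D x) (at x)" "\<forall>x. (g has_derivative E x) (at x)"
    "\<forall>b. real_polynomial_function (\<lambda>x. D x b)" "\<forall>b. real_polynomial_function (\<lambda>x. E x b)"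
    by blast
  then show ?case
    by (intro exI[of _ "\<lambda>x y. D x y + E x y"]) (auto intro: has_derivative_add)
next
  case (mult f g)
  then obtain D E where "\<forall>x. (f has_derivative D x) (at x)" "\<forall>x. (g has_derivative E x) (at x)"
    "\<forall>b. real_polynomial_function (\<lambda>x. D x b)" "\<forall>b. real_polynomial_function (\<lambda>x. E x b)"
    by blast
  with mult(1,3) show ?case
    by (intro exI[of _ "\<lambda>x y. f x * E x y + D x y * g x"]) (auto intro: has_derivative_mult
          intro!: real_polynomial_function.intros(3,4))
qed

text \<open>The induction on the order closes, for all f at once, because the partial derivatives of
  a polynomial are polynomials again.\<close>

lemma Ck_real_polynomial_function:
  fixes f :: "'a::euclidean_space \<Rightarrow> real"
  shows "real_polynomial_function f \<Longrightarrow> Ck k f"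
proof (induction k arbitrary: f)
  case 0
  then show ?case
    using continuous_on_polymonial_function real_polynomial_function_eq by auto
next
  case (Suc k)
  obtain D where D: "\<forall>x. (f has_derivative D x) (at x)"
    "\<forall>b. real_polynomial_function (\<lambda>x. D x b)"
    using real_polynomial_function_has_derivative[OF Suc.prems] by blast
  have "frechet_derivative f (at x) = D x" for x
    using D(1) frechet_derivative_at[of f "D x" x] by simp
  then show ?case
    using D Suc.IH by (auto simp: differentiable_def)
qed

text \<open>The trace predicate asks for approximants that are smooth on the whole space;
  polynomials supply them without mollification.\<close>

lemma smooth_real_polynomial_function:
  fixes f :: "'a::euclidean_space \<Rightarrow> real"
  shows "real_polynomial_function f \<Longrightarrow> smooth f"
  by (simp add: smooth_def Ck_real_polynomial_function)

section \<open>Dominated convergence in \<open>L\<^sup>p\<close>\<close>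

lemma Lp_boundedI:
  fixes f :: "'a \<Rightarrow> 'b::euclidean_space"
  assumes "finite_measure M" and [measurable]: "f \<in> borel_measurable M"
    and "AE x in M. norm (f x) \<le> B"
  shows "f \<in> Lp p M"
proof -
  interpret finite_measure M by fact
  have "integrable M (\<lambda>x. norm (f x) ^ p)"
  proof (rule integrable_const_bound[of _ "B ^ p"])
    show "AE x in M. norm (norm (f x) ^ p) \<le> B ^ p"
      using assms(3) by eventually_elim (simp add: power_mono)
  qed measurable
  then show ?thesis
    by (simp add: Lp_def)
qed

text \<open>On a finite measure space a uniform bound on the differences is an integrable majorant.
  It also gives the membership in the space that \<open>Lp_tendsto\<close> demands of each
  difference.\<close>

lemma Lp_tendsto_dominated:
  fixes u :: "'a \<Rightarrow> 'b::euclidean_space"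
  assumes "finite_measure M" "p > 0"
    and [measurable]: "\<And>n. f n \<in> borel_measurable M" "u \<in> borel_measurable M"
    and bound: "\<And>n. AE x in M. norm (f n x - u x) \<le> B"
    and lim: "AE x in M. (\<lambda>n. f n x) \<longlonglongrightarrow> u x"
  shows "Lp_tendsto p M f u"
proof -
  interpret finite_measure M by fact
  have "(\<lambda>n. LINT x|M. norm (f n x - u x) ^ p) \<longlonglongrightarrow> (LINT x|M. 0)"
  proof (rule integral_dominated_convergence)
    show "AE x in M. norm (norm (f n x - u x) ^ p) \<le> B ^ p" for n
      using bound[of n] by eventually_elim (simp add: power_mono)
    show "AE x in M. (\<lambda>n. norm (f n x - u x) ^ p) \<longlonglongrightarrow> 0"
      using lim
    proof eventually_elim
      case (elim x)
      then have "(\<lambda>n. norm (f n x - u x)) \<longlonglongrightarrow> 0"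
        using LIM_zero tendsto_norm_zero by blast
      from tendsto_power[OF this, of p] show ?case
        using \<open>p > 0\<close> by (simp add: zero_power)
    qed
  qed (auto intro: integrable_const)
  then have "(\<lambda>n. root p (LINT x|M. norm (f n x - u x) ^ p)) \<longlonglongrightarrow> root p 0"
    by (intro tendsto_real_root) simp
  moreover have "(\<lambda>x. f n x - u x) \<in> Lp p M" for n
    using \<open>finite_measure M\<close> bound[of n] by (intro Lp_boundedI) auto
  ultimately show ?thesis
    by (simp add: Lp_tendsto_def Lp_norm_def)
qed

section \<open>Piecewise continuously differentiable functions on the line\<close>

text \<open>The regularity shared by all one-variable factors: f is Lipschitz, and f' may jump at
  finitely many junctions, where its value is arbitrary but bounded. The first derivatives of the
  cut-off and of the stream profile are again of this kind, with second derivatives that jump, so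
  continuous differentiability would be too much to ask.\<close>

definition piecewise_derivative :: "(real \<Rightarrow> real) \<Rightarrow> (real \<Rightarrow> real) \<Rightarrow> bool" where
  "piecewise_derivative f f' \<longleftrightarrow>
     continuous_on UNIV f \<and> f' \<in> borel_measurable borel \<and>
     (\<exists>M. \<forall>x. \<bar>f x\<bar> \<le> M \<and> \<bar>f' x\<bar> \<le> M) \<and>
     (\<exists>S. finite S \<and> (\<forall>x. x \<notin> S \<longrightarrow> (f has_real_derivative f' x) (at x)))"

lemma piecewise_derivative_measurable:
  assumes "piecewise_derivative f f'"
  shows "f \<in> borel_measurable borel" "f' \<in> borel_measurable borel"
  using assms by (auto simp: piecewise_derivative_def borel_measurable_continuous_onI)

lemma piecewise_derivative_bounded:
  assumes "piecewise_derivative f f'"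
  shows "\<exists>M\<ge>0. \<forall>x. \<bar>f x\<bar> \<le> M \<and> \<bar>f' x\<bar> \<le> M"
  using assms abs_ge_zero order_trans unfolding piecewise_derivative_def by metis

lemma piecewise_derivative_has_integral:
  assumes "piecewise_derivative f f'" "a \<le> b"
  shows "(f' has_integral (f b - f a)) {a..b}"
proof -
  from assms(1) obtain S where S: "finite S"
    "\<And>x. x \<notin> S \<Longrightarrow> (f has_real_derivative f' x) (at x)" and c: "continuous_on UNIV f"
    unfolding piecewise_derivative_def by blast
  show ?thesis
  proof (rule fundamental_theorem_of_calculus_interior_strong[OF S(1) assms(2)])
    show "(f has_vector_derivative f' x) (at x)" if "x \<in> {a<..<b} - S" for x
      using S(2)[of x] that by (simp add: has_real_derivative_iff_has_vector_derivative)
    show "continuous_on {a..b} f"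
      using c continuous_on_subset by blast
  qed
qed

lemma bounded_borel_absolutely_integrable:
  fixes f :: "real \<Rightarrow> real"
  assumes "f \<in> borel_measurable borel" "\<And>x. x \<in> {a..b} \<Longrightarrow> \<bar>f x\<bar> \<le> M"
  shows "f absolutely_integrable_on {a..b}"
proof (rule measurable_bounded_by_integrable_imp_absolutely_integrable)
  show "f \<in> borel_measurable (lebesgue_on {a..b})"
    using assms(1) by (simp add: borel_measurable_if_lebesgue_on measurable_completion measurable_restrict_space1)
  show "(\<lambda>_. M) integrable_on {a..b}"
    by (rule integrable_const_ivl)
qed (use assms(2) in auto)

text \<open>Exactly what dominated convergence needs on [-L, L]. Uniform convergence of p' to f' is
  out of reach when f' jumps. The values of p converge without exception, which matters on boundary
  curves that lie in the exceptional set.\<close>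

definition polynomial_approximation ::
  "real \<Rightarrow> (real \<Rightarrow> real) \<Rightarrow> (real \<Rightarrow> real) \<Rightarrow> (nat \<Rightarrow> real \<Rightarrow> real) \<Rightarrow> (nat \<Rightarrow> real \<Rightarrow> real) \<Rightarrow>
     real \<Rightarrow> real set \<Rightarrow> bool" where
  "polynomial_approximation L f f' p p' M S \<longleftrightarrow>
    (\<forall>n. real_polynomial_function (p n)) \<and> (\<forall>n. real_polynomial_function (p' n)) \<and>
    (\<forall>n x. (p n has_real_derivative p' n x) (at x)) \<and>
    (\<forall>n x. \<bar>x\<bar> \<le> L \<longrightarrow> \<bar>p n x\<bar> \<le> M) \<and> (\<forall>n x. \<bar>x\<bar> \<le> L \<longrightarrow> \<bar>p' n x\<bar> \<le> M) \<and>
    (\<forall>x. \<bar>x\<bar> \<le> L \<longrightarrow> (\<lambda>n. p n x) \<longlonglongrightarrow> f x) \<and>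
    finite S \<and> (\<forall>x. \<bar>x\<bar> \<le> L \<longrightarrow> x \<notin> S \<longrightarrow> (\<lambda>n. p' n x) \<longlonglongrightarrow> f' x)"

lemma polynomial_approximationD:
  assumes "polynomial_approximation L f f' p p' M S"
  shows "real_polynomial_function (p n)" "real_polynomial_function (p' n)"
    "(p n has_real_derivative p' n x) (at x)"
    "\<bar>x\<bar> \<le> L \<Longrightarrow> \<bar>p n x\<bar> \<le> M" "\<bar>x\<bar> \<le> L \<Longrightarrow> \<bar>p' n x\<bar> \<le> M"
    "\<bar>x\<bar> \<le> L \<Longrightarrow> (\<lambda>n. p n x) \<longlonglongrightarrow> f x"
    "finite S" "\<bar>x\<bar> \<le> L \<Longrightarrow> x \<notin> S \<Longrightarrow> (\<lambda>n. p' n x) \<longlonglongrightarrow> f' x"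
  using assms unfolding polynomial_approximation_def by simp_all

text \<open>Approximating f itself would not control the derivatives, so polynomials approximating
  f' are integrated. As f' may jump, Weierstrass' theorem is applied to the difference quotients of
  f, which are continuous, bounded by the bound of f', and convergent to f' off the exceptional
  set.\<close>

lemma piecewise_derivative_approximation:
  assumes f: "piecewise_derivative f f'" and "L > 0"
  shows "\<exists>p p' M S. polynomial_approximation L f f' p p' M S"
proof -
  obtain M where M: "M \<ge> 0" "\<And>x. \<bar>f x\<bar> \<le> M" "\<And>x. \<bar>f' x\<bar> \<le> M"
    using piecewise_derivative_bounded[OF f] by blast
  from f obtain S where S: "finite S"
    "\<And>x. x \<notin> S \<Longrightarrow> (f has_real_derivative f' x) (at x)" and c: "continuous_on UNIV f"
    unfolding piecewise_derivative_def by blast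
  define g where "g n x = (f (x + inverse (real (Suc n))) - f x) / inverse (real (Suc n))"
    for n x
  have g_cont: "continuous_on A (g n)" for A n
    unfolding g_def
    by (intro continuous_intros continuous_on_compose2[OF c]) auto
  have g_bound: "\<bar>g n x\<bar> \<le> M" for n x
  proof -
    let ?d = "inverse (real (Suc n))"
    \<comment> \<open>The mean value inequality, obtained by writing the increment as an integral of
      f'; this tolerates the exceptional points.\<close>
    have "norm (f (x + ?d) - f x) \<le> M * measure lborel (cbox x (x + ?d))"
      by (rule has_integral_bound[of _ f'])
        (use M piecewise_derivative_has_integral[OF f, of x "x + ?d"] in \<open>auto simp: cbox_interval\<close>)
    then have "\<bar>f (x + ?d) - f x\<bar> \<le> M * ?d"
      by simp
    then show ?thesis
      unfolding g_def abs_divide by (simp add: divide_simps)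
  qed
  have g_lim: "(\<lambda>n. g n x) \<longlonglongrightarrow> f' x" if "x \<notin> S" for x
  proof -
    have "((\<lambda>h. (f (x + h) - f x) / h) \<longlongrightarrow> f' x) (at 0)"
      using S(2)[OF that] by (simp add: DERIV_def)
    moreover have "filterlim (\<lambda>n. inverse (real (Suc n))) (at 0) sequentially"
      unfolding filterlim_at using LIMSEQ_inverse_real_of_nat by simp
    ultimately show ?thesis
      unfolding g_def by (rule filterlim_compose)
  qed
  have "\<exists>q. real_polynomial_function q \<and> (\<forall>x\<in>{-L..L}. \<bar>g n x - q x\<bar> < inverse (real (Suc n)))" for n
    by (rule Stone_Weierstrass_real_polynomial_function[of "{-L..L}" "g n" "inverse (real (Suc n))"])
      (use g_cont in auto)
  then obtain q where q: "\<And>n. real_polynomial_function (q n)"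
    and qg: "\<And>n x. x \<in> {-L..L} \<Longrightarrow> \<bar>g n x - q n x\<bar> < inverse (real (Suc n))"
    by metis
  have inv1: "inverse (real (Suc n)) \<le> 1" for n
    by (simp add: divide_simps)
  have q_bound: "\<bar>q n x\<bar> \<le> M + 1" if "x \<in> {-L..L}" for n x
    using g_bound[of n x] qg[OF that, of n] inv1[of n] by linarith
  have q_lim: "(\<lambda>n. q n x) \<longlonglongrightarrow> f' x" if "x \<in> {-L..L}" "x \<notin> S" for x
  proof -
    have "(\<lambda>n. g n x - q n x) \<longlonglongrightarrow> 0"
    proof (rule Lim_null_comparison[OF _ LIMSEQ_inverse_real_of_nat])
      show "\<forall>\<^sub>F n in sequentially. norm (g n x - q n x) \<le> inverse (real (Suc n))"
        using qg[OF that(1)] by (intro always_eventually allI less_imp_le) simp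
    qed
    from tendsto_diff[OF g_lim[OF that(2)] this] show ?thesis
      by simp
  qed
  have "\<exists>P. real_polynomial_function P \<and> (\<forall>x. (P has_real_derivative q n x) (at x))
      \<and> P (-L) = f (-L)" for n
  proof -
    obtain a k where a: "q n = (\<lambda>x. \<Sum>i\<le>k. a i * x ^ i)"
      using q[of n] unfolding real_polynomial_function_iff_sum by blast
    \<comment> \<open>The termwise antiderivative of \<open>q n\<close>; the constant added to it
      below makes the value at -L equal to \<open>f (-L)\<close>.\<close>
    define P0 where "P0 x = (\<Sum>i\<le>k. a i / real (Suc i) * x ^ Suc i)" for x :: real
    have id: "real_polynomial_function (\<lambda>x::real. x)"
      by (intro real_polynomial_function.intros(1) bounded_linear_ident)
    have P0: "real_polynomial_function P0"
      unfolding P0_def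
      by (intro real_polynomial_function_sum real_polynomial_function.intros(4)
          real_polynomial_function.intros(2) real_polynomial_function_power id) simp
    have d: "(P0 has_real_derivative q n x) (at x)" for x
      unfolding P0_def a
    proof (rule DERIV_sum)
      show "((\<lambda>x. a i / real (Suc i) * x ^ Suc i) has_real_derivative a i * x ^ i) (at x)" for i
        using DERIV_cmult[OF DERIV_pow[of "Suc i" x], of "a i / real (Suc i)"]
        by (simp del: power_Suc of_nat_Suc)
    qed
    show ?thesis
    proof (intro exI conjI allI)
      show "real_polynomial_function (\<lambda>x. P0 x + (f (-L) - P0 (-L)))"
        by (intro real_polynomial_function.intros(3) P0 real_polynomial_function.intros(2))
      show "((\<lambda>x. P0 x + (f (-L) - P0 (-L))) has_real_derivative q n x) (at x)" for x
        using d[of x] by (auto intro!: derivative_eq_intros)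
    qed simp
  qed
  then obtain P where P: "\<And>n. real_polynomial_function (P n)"
    and Pd: "\<And>n x. (P n has_real_derivative q n x) (at x)"
    and P0: "\<And>n. P n (-L) = f (-L)"
    by metis
  have P_int: "(q n has_integral (P n x - f (-L))) {-L..x}" if "-L \<le> x" for n x
  proof -
    have "(q n has_integral (P n x - P n (-L))) {-L..x}"
    proof (rule fundamental_theorem_of_calculus[OF that])
      show "(P n has_vector_derivative q n y) (at y within {-L..x})" for y
        using has_field_derivative_at_within[OF Pd]
        by (simp add: has_real_derivative_iff_has_vector_derivative)
    qed
    then show ?thesis
      by (simp add: P0)
  qed
  have P_lim: "(\<lambda>n. P n x) \<longlonglongrightarrow> f x" if "\<bar>x\<bar> \<le> L" for x
  proof -
    \<comment> \<open>The dominated convergence theorem used here wants convergence at every point.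
      Overwriting \<open>q n\<close> on the finite set S enforces it without changing the
      integrals.\<close>
    define r where "r n y = (if y \<in> S then f' y else q n y)" for n y
    have le: "-L \<le> x"
      using that by simp
    have r_int: "(r n has_integral (P n x - f (-L))) {-L..x}" for n
      by (rule has_integral_spike_finite[OF S(1) _ P_int[OF le]]) (simp add: r_def)
    have "(\<lambda>n. integral {-L..x} (r n)) \<longlonglongrightarrow> integral {-L..x} f'"
    proof (rule dominated_convergence(2)[where h = "\<lambda>_. M + 1"])
      show "r n integrable_on {-L..x}" for n
        using r_int by blast
      show "norm (r n y) \<le> M + 1" if "y \<in> {-L..x}" for n y
        using q_bound[of y n] M(3)[of y] that \<open>\<bar>x\<bar> \<le> L\<close> by (auto simp: r_def)
      show "(\<lambda>n. r n y) \<longlonglongrightarrow> f' y" if "y \<in> {-L..x}" for y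
        using q_lim[of y] that \<open>\<bar>x\<bar> \<le> L\<close> by (cases "y \<in> S") (auto simp: r_def)
    qed (rule integrable_const_ivl)
    moreover have "integral {-L..x} (r n) = P n x - f (-L)" for n
      using r_int by (rule integral_unique)
    moreover have "integral {-L..x} f' = f x - f (-L)"
      using piecewise_derivative_has_integral[OF f le] by (rule integral_unique)
    ultimately have "(\<lambda>n. P n x - f (-L)) \<longlonglongrightarrow> f x - f (-L)"
      by simp
    from tendsto_add[OF this tendsto_const[of "f (-L)"]] show ?thesis
      by simp
  qed
  \<comment> \<open>The bound M of the value at -L plus the integral of a function bounded by M + 1
    over a length of at most 2L; the last 1 makes K dominate M + 1 as well, so that K bounds both
    sequences.\<close>
  define K where "K = M + (M + 1) * (2 * L) + 1"
  have P_bound: "\<bar>P n x\<bar> \<le> K" if "\<bar>x\<bar> \<le> L" for n x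
  proof -
    have "norm (P n x - f (-L)) \<le> (M + 1) * measure lborel (cbox (-L) x)"
      by (rule has_integral_bound[of _ "q n"])
        (use M q_bound that P_int[of x n] in \<open>auto simp: cbox_interval\<close>)
    also have "\<dots> \<le> (M + 1) * (2 * L)"
      using that M by (intro mult_left_mono) auto
    finally show ?thesis
      using M(2)[of "-L"] unfolding K_def real_norm_def by linarith
  qed
  have "M + 1 \<le> K"
    using M(1) \<open>L > 0\<close> unfolding K_def by simp
  show ?thesis
  proof (rule exI[of _ P], rule exI[of _ q], rule exI[of _ K], rule exI[of _ S], unfold polynomial_approximation_def, intro conjI allI impI)
    show "\<bar>q n x\<bar> \<le> K" if "\<bar>x\<bar> \<le> L" for n x
    proof -
      have "x \<in> {-L..L}"
        using that by auto
      from q_bound[OF this, of n] \<open>M + 1 \<le> K\<close> show ?thesis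
        by linarith
    qed
    show "(\<lambda>n. q n x) \<longlonglongrightarrow> f' x" if "\<bar>x\<bar> \<le> L" "x \<notin> S" for x
    proof -
      have "x \<in> {-L..L}"
        using that by auto
      from q_lim[OF this that(2)] show ?thesis .
    qed
    show "\<bar>P n x\<bar> \<le> K" if "\<bar>x\<bar> \<le> L" for n x
      by (rule P_bound[OF that])
    show "(\<lambda>n. P n x) \<longlonglongrightarrow> f x" if "\<bar>x\<bar> \<le> L" for x
      by (rule P_lim[OF that])
  qed (rule P q Pd S(1))+
qed

section \<open>Weak gradients of separated functions\<close>

lemma finite_measure_lebesgue_on_bounded:
  fixes S :: "'a::euclidean_space set"
  assumes "bounded S" "S \<in> sets lebesgue"
  shows "finite_measure (lebesgue_on S)"
proof
  have "S \<in> lmeasurable"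
    using assms by (intro bounded_set_imp_lmeasurable)
  then show "emeasure (lebesgue_on S) (space (lebesgue_on S)) \<noteq> \<infinity>"
    using assms by (simp add: emeasure_restrict_space fmeasurable_def less_top[symmetric])
qed

lemma borel_measurable_lebesgue_on:
  "f \<in> borel_measurable borel \<Longrightarrow> f \<in> borel_measurable (lebesgue_on S)"
  for f :: "'a::euclidean_space \<Rightarrow> 'b::topological_space"
  by (intro measurable_restrict_space1 measurable_completion) simp

text \<open>Weak derivatives are stated with Lebesgue measure on the domain, whereas Fubini's
  theorem is applied to \<open>lborel\<close>. Extension by zero and completion connect the
  two.\<close>

lemma integral_lebesgue_on_eq_lborel:
  fixes f :: "'a::euclidean_space \<Rightarrow> real"
  assumes "f \<in> borel_measurable borel" "S \<in> sets lebesgue" "\<And>x. x \<notin> S \<Longrightarrow> f x = 0"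
  shows "(LINT x|lebesgue_on S. f x) = (LINT x|lborel. f x)"
proof -
  have "(LINT x|lebesgue_on S. f x) = (LINT x|lebesgue. indicat_real S x *\<^sub>R f x)"
    using assms(2) by (intro integral_restrict_space) simp
  also have "\<dots> = (LINT x|lebesgue. f x)"
    using assms(3) by (intro Bochner_Integration.integral_cong) (auto simp: indicator_def)
  also have "\<dots> = (LINT x|lborel. f x)"
    using assms(1) by (intro integral_completion) simp
  finally show ?thesis .
qed

lemma measurable_fst_borel:
  fixes f :: "'a::second_countable_topology \<Rightarrow> 'c::topological_space"
  assumes "f \<in> borel_measurable borel"
  shows "(\<lambda>z :: 'a \<times> 'b::second_countable_topology. f (fst z)) \<in> borel_measurable borel"
  using assms by (rule measurable_compose[rotated])
    (intro borel_measurable_continuous_onI continuous_intros)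

lemma measurable_snd_borel:
  fixes f :: "'b::second_countable_topology \<Rightarrow> 'c::topological_space"
  assumes "f \<in> borel_measurable borel"
  shows "(\<lambda>z :: 'a::second_countable_topology \<times> 'b. f (snd z)) \<in> borel_measurable borel"
  using assms by (rule measurable_compose[rotated])
    (intro borel_measurable_continuous_onI continuous_intros)

text \<open>Off a finite set the integrand is the derivative of the continuous product w g, which
  vanishes at B and -B. In the application g is a slice of a test function, so w itself needs no
  decay.\<close>

lemma piecewise_derivative_integral_by_parts:
  assumes w: "piecewise_derivative w w'"
    and g: "\<And>x. (g has_real_derivative g' x) (at x)" "continuous_on UNIV g'"
    and supp: "\<And>x. \<bar>x\<bar> \<ge> B \<Longrightarrow> g x = 0" "\<And>x. \<bar>x\<bar> \<ge> B \<Longrightarrow> g' x = 0" and "B > 0"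
  shows "(LINT x|lborel. w x * g' x + w' x * g x) = 0"
proof -
  obtain M where M: "M \<ge> 0" "\<And>x. \<bar>w x\<bar> \<le> M" "\<And>x. \<bar>w' x\<bar> \<le> M"
    using piecewise_derivative_bounded[OF w] by blast
  from w obtain S where S: "finite S"
    "\<And>x. x \<notin> S \<Longrightarrow> (w has_real_derivative w' x) (at x)" and c: "continuous_on UNIV w"
    unfolding piecewise_derivative_def by blast
  have cg: "continuous_on UNIV g"
    using g(1) by (intro DERIV_continuous_on) auto
  let ?F = "\<lambda>x. w x * g' x + w' x * g x"
  have meas: "?F \<in> borel_measurable borel"
    using piecewise_derivative_measurable[OF w] borel_measurable_continuous_onI[OF cg]
      borel_measurable_continuous_onI[OF g(2)] by measurable
  have bdd: "\<exists>N. \<forall>x\<in>{-B..B}. \<bar>f x\<bar> \<le> N" if "continuous_on UNIV f" for f :: "real \<Rightarrow> real"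
  proof -
    have "compact (f ` {-B..B})"
      using that continuous_on_subset by (intro compact_continuous_image) auto
    from compact_imp_bounded[OF this] show ?thesis
      unfolding bounded_iff by auto
  qed
  obtain N N' where N: "\<And>x. x \<in> {-B..B} \<Longrightarrow> \<bar>g x\<bar> \<le> N" "\<And>x. x \<in> {-B..B} \<Longrightarrow> \<bar>g' x\<bar> \<le> N'"
    using bdd[OF cg] bdd[OF g(2)] by blast
  have F_bound: "\<bar>?F x\<bar> \<le> M * N' + M * N" if "x \<in> {-B..B}" for x
  proof -
    have "\<bar>w x * g' x\<bar> \<le> M * N'" "\<bar>w' x * g x\<bar> \<le> M * N"
      unfolding abs_mult using M N[OF that] by (intro mult_mono; force)+
    then show ?thesis
      by linarith
  qed
  have ai: "?F absolutely_integrable_on {-B..B}"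
    by (rule bounded_borel_absolutely_integrable[OF meas F_bound])
  have "(?F has_integral (w B * g B - w (-B) * g (-B))) {-B..B}"
  proof (rule fundamental_theorem_of_calculus_interior_strong[OF S(1)])
    show "((\<lambda>x. w x * g x) has_vector_derivative ?F x) (at x)" if "x \<in> {-B<..<B} - S" for x
      using DERIV_mult[OF S(2)[of x] g(1)[of x]] that
      by (simp add: has_real_derivative_iff_has_vector_derivative algebra_simps)
    show "continuous_on {-B..B} (\<lambda>x. w x * g x)"
      using c cg by (intro continuous_intros) (auto intro: continuous_on_subset)
  qed (use \<open>B > 0\<close> in auto)
  then have "integral {-B..B} ?F = 0"
    using supp(1)[of B] supp(1)[of "-B"] \<open>B > 0\<close> by (simp add: integral_unique)
  moreover have "integral {-B..B} ?F = (LINT x|lebesgue_on {-B..B}. ?F x)"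
    using ai by (intro lebesgue_integral_eq_integral[symmetric])
      (auto simp: integrable_restrict_space set_integrable_def)
  moreover have "(LINT x|lebesgue_on {-B..B}. ?F x) = (LINT x|lborel. ?F x)"
  proof (rule integral_lebesgue_on_eq_lborel[OF meas])
    show "?F x = 0" if "x \<notin> {-B..B}" for x
    proof -
      have "\<bar>x\<bar> \<ge> B"
        using that by auto
      then show ?thesis
        using supp by simp
    qed
  qed simp
  ultimately show ?thesis
    by simp
qed

lemma test_function_derivative:
  fixes \<phi> :: "'a::euclidean_space \<Rightarrow> real"
  assumes "test_function \<Omega> \<phi>" "b \<in> Basis"
  shows "(\<phi> has_derivative frechet_derivative \<phi> (at x)) (at x)"
    and "continuous_on UNIV \<phi>"
    and "continuous_on UNIV (\<lambda>x. frechet_derivative \<phi> (at x) b)"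
    and "x \<notin> closure {x. \<phi> x \<noteq> 0} \<Longrightarrow> frechet_derivative \<phi> (at x) b = 0"
proof -
  have "Ck (Suc 0) \<phi>"
    using assms(1) unfolding test_function_def smooth_def by blast
  then have *: "\<phi> differentiable (at x)"
    "continuous_on UNIV (\<lambda>x. frechet_derivative \<phi> (at x) b)" for x
    using assms(2) by auto
  show "(\<phi> has_derivative frechet_derivative \<phi> (at x)) (at x)"
    using *(1) frechet_derivative_works by blast
  show "continuous_on UNIV \<phi>"
    using *(1) by (intro differentiable_imp_continuous_on)
      (auto simp: differentiable_on_def intro: differentiable_at_withinI)
  show "continuous_on UNIV (\<lambda>x. frechet_derivative \<phi> (at x) b)"
    by fact
  show "frechet_derivative \<phi> (at x) b = 0" if "x \<notin> closure {x. \<phi> x \<noteq> 0}"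
  proof -
    have "(\<phi> has_derivative (\<lambda>_. 0)) (at x)"
    proof (rule has_derivative_transform_within_open[OF has_derivative_const[of 0]])
      show "open (- closure {x. \<phi> x \<noteq> 0})" "x \<in> - closure {x. \<phi> x \<noteq> 0}"
        using that by auto
      show "0 = \<phi> y" if "y \<in> - closure {x. \<phi> x \<noteq> 0}" for y
        using that closure_subset[of "{x. \<phi> x \<noteq> 0}"] by auto
    qed
    from frechet_derivative_at[OF this, symmetric] show ?thesis
      by simp
  qed
qed

text \<open>Fubini's theorem in the order whose inner integral vanishes; the two alternatives serve
  the two coordinate directions of a weak gradient.\<close>

lemma lborel_integral_prod_eq_0:
  fixes F :: "real \<times> real \<Rightarrow> real"
  assumes "integrable lborel F"
    and "(\<forall>y. (LINT x|lborel. F (x, y)) = 0) \<or> (\<forall>x. (LINT y|lborel. F (x, y)) = 0)"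
  shows "(LINT z|lborel. F z) = 0"
  using assms(2)
proof
  have F: "integrable (lborel \<Otimes>\<^sub>M lborel) (case_prod (\<lambda>x y. F (x, y)))"
    using assms(1) by (simp add: lborel_prod)
  {
    assume "\<forall>y. (LINT x|lborel. F (x, y)) = 0"
    then show ?thesis
      using lborel_pair.integral_snd[OF F] by (simp add: lborel_prod)
  next
    assume "\<forall>x. (LINT y|lborel. F (x, y)) = 0"
    then show ?thesis
      using lborel_pair.integral_fst[OF F] by (simp add: lborel_prod)
  }
qed

text \<open>With the other variable frozen, c + a(x) b(y) is of this form. The constant c carries
  the uniform flow.\<close>

lemma piecewise_derivative_affine:
  assumes "piecewise_derivative a a'"
  shows "piecewise_derivative (\<lambda>x. c + a x * d) (\<lambda>x. a' x * d)"
proof -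
  obtain M where M: "M \<ge> 0" "\<And>x. \<bar>a x\<bar> \<le> M" "\<And>x. \<bar>a' x\<bar> \<le> M"
    using piecewise_derivative_bounded[OF assms] by blast
  obtain S where S: "finite S"
    "\<And>x. x \<notin> S \<Longrightarrow> (a has_real_derivative a' x) (at x)" and c: "continuous_on UNIV a"
    using assms unfolding piecewise_derivative_def by blast
  have [measurable]: "a' \<in> borel_measurable borel"
    using piecewise_derivative_measurable[OF assms] by blast
  have "\<bar>a x * d\<bar> \<le> M * \<bar>d\<bar>" "\<bar>a' x * d\<bar> \<le> M * \<bar>d\<bar>" for x
    unfolding abs_mult using M by (intro mult_right_mono; simp)+
  then have "\<bar>c + a x * d\<bar> \<le> \<bar>c\<bar> + M * \<bar>d\<bar> \<and> \<bar>a' x * d\<bar> \<le> \<bar>c\<bar> + M * \<bar>d\<bar>" for x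
    by (smt (verit))
  moreover have "((\<lambda>x. c + a x * d) has_real_derivative a' x * d) (at x)" if "x \<notin> S" for x
    using S(2)[OF that] by (auto intro!: derivative_eq_intros)
  ultimately show ?thesis
    unfolding piecewise_derivative_def using S(1) c
    by (intro conjI exI[of _ "\<bar>c\<bar> + M * \<bar>d\<bar>"] exI[of _ S] continuous_intros) auto
qed

text \<open>The support of a test function lies inside the domain, so both integrals extend to the
  plane and can be treated line by line. The shape of the boundary does not enter.\<close>

lemma has_H1_gradient_product:
  assumes \<Omega>: "open \<Omega>" "bounded \<Omega>"
    and a: "piecewise_derivative a a'" and b: "piecewise_derivative b b'"
  shows "has_H1_gradient \<Omega> (\<lambda>z. c + a (fst z) * b (snd z))
    (\<lambda>z. (a' (fst z) * b (snd z), a (fst z) * b' (snd z)))" (is "has_H1_gradient \<Omega> ?u ?G")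
proof -
  obtain A where A: "A \<ge> 0" "\<And>x. \<bar>a x\<bar> \<le> A" "\<And>x. \<bar>a' x\<bar> \<le> A"
    using piecewise_derivative_bounded[OF a] by blast
  obtain B where B: "B \<ge> 0" "\<And>x. \<bar>b x\<bar> \<le> B" "\<And>x. \<bar>b' x\<bar> \<le> B"
    using piecewise_derivative_bounded[OF b] by blast
  note m = piecewise_derivative_measurable[OF a] piecewise_derivative_measurable[OF b]
  note [measurable] = m[THEN measurable_fst_borel[where 'b=real]]
    m[THEN measurable_snd_borel[where 'a=real]]
  have prod: "\<bar>p * q\<bar> \<le> A * B" if "\<bar>p\<bar> \<le> A" "\<bar>q\<bar> \<le> B" for p q
    unfolding abs_mult using that A(1) by (intro mult_mono) auto
  have u_bound: "\<bar>?u z\<bar> \<le> \<bar>c\<bar> + A * B" for z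
    using prod[OF A(2)[of "fst z"] B(2)[of "snd z"]] by linarith
  have G_bound: "\<bar>fst (?G z)\<bar> \<le> A * B" "\<bar>snd (?G z)\<bar> \<le> A * B" for z
    using prod A B by auto
  have u_meas[measurable]: "?u \<in> borel_measurable borel"
    by measurable
  have G_meas: "?G \<in> borel_measurable borel"
    by (intro borel_measurable_Pair) measurable
  have sets: "\<Omega> \<in> sets lebesgue"
    using \<Omega>(1) by simp
  have fin: "finite_measure (lebesgue_on \<Omega>)"
    by (rule finite_measure_lebesgue_on_bounded[OF \<Omega>(2) sets])
  show ?thesis
    unfolding has_H1_gradient_def
  proof (intro conjI allI impI ballI)
    show "?u \<in> Lp 2 (lebesgue_on \<Omega>)"
    proof (intro Lp_boundedI[OF fin] borel_measurable_lebesgue_on u_meas AE_I2)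
      show "norm (?u z) \<le> \<bar>c\<bar> + A * B" for z
        using u_bound[of z] by simp
    qed
    show "?G \<in> Lp 2 (lebesgue_on \<Omega>)"
    proof (intro Lp_boundedI[OF fin] borel_measurable_lebesgue_on G_meas AE_I2)
      show "norm (?G z) \<le> A * B + A * B" for z
        using norm_Pair_le[of "fst (?G z)" "snd (?G z)"] G_bound[of z] by simp
    qed
    fix \<phi> :: "real \<times> real \<Rightarrow> real" and e :: "real \<times> real"
    assume \<phi>: "test_function \<Omega> \<phi>" and e: "e \<in> Basis"
    let ?D = "\<lambda>z. frechet_derivative \<phi> (at z) e"
    let ?K = "closure {x. \<phi> x \<noteq> 0}"
    note t = test_function_derivative[OF \<phi> e]
    have K: "compact ?K" "?K \<subseteq> \<Omega>"
      using \<phi> by (auto simp: test_function_def)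
    obtain L where L: "L > 0" "\<And>z. z \<in> ?K \<Longrightarrow> norm z < L"
      using compact_imp_bounded[OF K(1)] bounded_pos_less by metis
    have out: "\<phi> z = 0" "?D z = 0" if "z \<notin> ?K" for z
      using that t(4) closure_subset[of "{x. \<phi> x \<noteq> 0}"] by auto
    have \<phi>_meas[measurable]: "\<phi> \<in> borel_measurable borel"
      and D_meas[measurable]: "?D \<in> borel_measurable borel"
      using t(2,3) by (auto intro: borel_measurable_continuous_onI)
    have bdd: "\<exists>N. \<forall>z. \<bar>f z\<bar> \<le> N"
      if "continuous_on UNIV f" "\<And>z. z \<notin> ?K \<Longrightarrow> f z = 0" for f :: "real \<times> real \<Rightarrow> real"
    proof -
      have "compact (f ` ?K)"
        using that(1) K(1) continuous_on_subset by (intro compact_continuous_image) auto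
      from compact_imp_bounded[OF this] obtain N where "\<forall>z\<in>?K. \<bar>f z\<bar> \<le> N"
        unfolding bounded_iff by auto
      then have "\<bar>f z\<bar> \<le> \<bar>N\<bar>" for z
        using that(2)[of z] by (cases "z \<in> ?K") force+
      then show ?thesis
        by blast
    qed
    obtain N N' where N: "\<And>z. \<bar>\<phi> z\<bar> \<le> N" "\<And>z. \<bar>?D z\<bar> \<le> N'"
      using bdd[OF t(2) out(1)] bdd[OF t(3) out(2)] by blast
    have int: "integrable lborel (\<lambda>z. v z * f z)"
      if "v \<in> borel_measurable borel" "f \<in> borel_measurable borel" "\<And>z. \<bar>v z\<bar> \<le> C" "\<And>z. \<bar>f z\<bar> \<le> C'"
        "\<And>z. z \<notin> ?K \<Longrightarrow> f z = 0" for v f :: "real \<times> real \<Rightarrow> real" and C C'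
    proof (rule integrableI_bounded_set[where A = ?K and B = "C * C'"])
      show "emeasure lborel ?K < \<infinity>"
        using emeasure_bounded_finite[OF compact_imp_bounded[OF K(1)]] .
      have "C \<ge> 0"
        using that(3)[of 0] by linarith
      then show "AE z in lborel. z \<in> ?K \<longrightarrow> norm (v z * f z) \<le> C * C'"
        using that(3,4) by (intro AE_I2 impI) (simp add: abs_mult mult_mono)
      show "(\<lambda>z. v z * f z) \<in> borel_measurable lborel"
        using that(1,2) by measurable
    qed (use that(5) K(1) in auto)
    have Ge_meas[measurable]: "(\<lambda>z. ?G z \<bullet> e) \<in> borel_measurable borel"
      using G_meas by measurable
    have Ge_bound: "\<bar>?G z \<bullet> e\<bar> \<le> A * B" for z
      using e G_bound[of z] by (auto simp: Basis_prod_def)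
    have int1: "integrable lborel (\<lambda>z. ?u z * ?D z)"
      by (rule int[OF u_meas D_meas u_bound N(2) out(2)])
    have int2: "integrable lborel (\<lambda>z. (?G z \<bullet> e) * \<phi> z)"
      by (rule int[OF Ge_meas \<phi>_meas Ge_bound N(1) out(1)])
    have far: "\<phi> z = 0" "?D z = 0" if "norm z \<ge> L" for z
      using out[of z] L(2)[of z] that by auto
    \<comment> \<open>Both sides of the weak derivative identity are merged into one integrand,
      since it is their sum that integrates to 0 along each line.\<close>
    have "(LINT z|lborel. ?u z * ?D z + (?G z \<bullet> e) * \<phi> z) = 0"
    proof (rule lborel_integral_prod_eq_0)
      show "integrable lborel (\<lambda>z. ?u z * ?D z + (?G z \<bullet> e) * \<phi> z)"
        using int1 int2 by simp
      consider "e = (1, 0)" | "e = (0, 1)"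
        using e by (auto simp: Basis_prod_def)
      then show "(\<forall>y. (LINT x|lborel. ?u (x, y) * ?D (x, y) + (?G (x, y) \<bullet> e) * \<phi> (x, y)) = 0) \<or>
        (\<forall>x. (LINT y|lborel. ?u (x, y) * ?D (x, y) + (?G (x, y) \<bullet> e) * \<phi> (x, y)) = 0)"
      proof cases
        case 1
        have "(LINT x|lborel. (c + a x * b y) * ?D (x, y) + (a' x * b y) * \<phi> (x, y)) = 0" for y
        proof (rule piecewise_derivative_integral_by_parts[OF piecewise_derivative_affine[OF a]])
          show "((\<lambda>x. \<phi> (x, y)) has_real_derivative ?D (x, y)) (at x)" for x
          proof -
            have "((\<lambda>x. \<phi> (x, y)) has_derivative (\<lambda>h. frechet_derivative \<phi> (at (x, y)) (h, 0))) (at x)"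
              by (rule has_derivative_compose[OF _ t(1), of "\<lambda>x. (x, y)"])
                (auto intro!: derivative_eq_intros)
            moreover have "(\<lambda>h. frechet_derivative \<phi> (at (x, y)) (h, 0)) = (*) (?D (x, y))"
            proof
              show "frechet_derivative \<phi> (at (x, y)) (h, 0) = ?D (x, y) * h" for h
                using linear_scale[OF has_derivative_linear[OF t(1)[of "(x, y)"]], of h "(1, 0)"] 1
                by (simp add: mult.commute)
            qed
            ultimately show ?thesis
              by (simp add: has_field_derivative_def)
          qed
          show "continuous_on UNIV (\<lambda>x. ?D (x, y))"
            by (rule continuous_on_compose2[OF t(3)]) (auto intro!: continuous_intros)
          show "\<phi> (x, y) = 0" "?D (x, y) = 0" if "\<bar>x\<bar> \<ge> L" for x
            using far[of "(x, y)"] that norm_fst_le[of x y] by auto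
        qed (rule L(1))
        then show ?thesis
          using 1 by simp
      next
        case 2
        have "(LINT y|lborel. (c + b y * a x) * ?D (x, y) + (b' y * a x) * \<phi> (x, y)) = 0" for x
        proof (rule piecewise_derivative_integral_by_parts[OF piecewise_derivative_affine[OF b]])
          show "((\<lambda>y. \<phi> (x, y)) has_real_derivative ?D (x, y)) (at y)" for y
          proof -
            have "((\<lambda>y. \<phi> (x, y)) has_derivative (\<lambda>h. frechet_derivative \<phi> (at (x, y)) (0, h))) (at y)"
              by (rule has_derivative_compose[OF _ t(1), of "\<lambda>y. (x, y)"])
                (auto intro!: derivative_eq_intros)
            moreover have "(\<lambda>h. frechet_derivative \<phi> (at (x, y)) (0, h)) = (*) (?D (x, y))"
            proof
              show "frechet_derivative \<phi> (at (x, y)) (0, h) = ?D (x, y) * h" for h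
                using linear_scale[OF has_derivative_linear[OF t(1)[of "(x, y)"]], of h "(0, 1)"] 2
                by (simp add: mult.commute)
            qed
            ultimately show ?thesis
              by (simp add: has_field_derivative_def)
          qed
          show "continuous_on UNIV (\<lambda>y. ?D (x, y))"
            by (rule continuous_on_compose2[OF t(3)]) (auto intro!: continuous_intros)
          show "\<phi> (x, y) = 0" "?D (x, y) = 0" if "\<bar>y\<bar> \<ge> L" for y
            using far[of "(x, y)"] that norm_snd_le[of y x] by auto
        qed (rule L(1))
        then show ?thesis
          using 2 by (simp add: mult.commute)
      qed
    qed
    then have "(LINT z|lborel. ?u z * ?D z) = - (LINT z|lborel. (?G z \<bullet> e) * \<phi> z)"
      using int1 int2 by (simp add: add_eq_0_iff)
    moreover have "(LINT z|lebesgue_on \<Omega>. ?u z * ?D z) = (LINT z|lborel. ?u z * ?D z)"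
    proof (rule integral_lebesgue_on_eq_lborel[OF _ sets])
      show "?u z * ?D z = 0" if "z \<notin> \<Omega>" for z
        using out(2)[of z] K(2) that by auto
    qed measurable
    moreover have "(LINT z|lebesgue_on \<Omega>. (?G z \<bullet> e) * \<phi> z) = (LINT z|lborel. (?G z \<bullet> e) * \<phi> z)"
    proof (rule integral_lebesgue_on_eq_lborel[OF _ sets])
      show "(?G z \<bullet> e) * \<phi> z = 0" if "z \<notin> \<Omega>" for z
        using out(1)[of z] K(2) that by auto
    qed measurable
    ultimately show "(LINT z|lebesgue_on \<Omega>. ?u z * ?D z) = - (LINT z|lebesgue_on \<Omega>. (?G z \<bullet> e) * \<phi> z)"
      by simp
  qed
qed

section \<open>Traces of separated functions\<close>

text \<open>The derivative of a product of approximants can fail to converge only where one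
  coordinate is exceptional, that is, on finitely many lines parallel to the axes.\<close>

lemma AE_lebesgue_on_off_finite_lines:
  assumes "finite S" "finite T" "\<Omega> \<in> sets lebesgue"
  shows "AE z :: real \<times> real in lebesgue_on \<Omega>. fst z \<notin> S \<and> snd z \<notin> T"
proof -
  have n: "negligible {z :: real \<times> real. z \<bullet> k = s}" if "k \<in> Basis" for k s
    using that by (rule negligible_standard_hyperplane)
  have "negligible ((\<Union>s\<in>S. {z :: real \<times> real. z \<bullet> (1, 0) = s}) \<union>
      (\<Union>t\<in>T. {z :: real \<times> real. z \<bullet> (0, 1) = t}))"
    using assms(1,2) by (intro negligible_Un negligible_Union) (auto intro!: n simp: Basis_prod_def)
  then have "AE z :: real \<times> real in lebesgue. z \<notin> (\<Union>s\<in>S. {z. z \<bullet> (1, 0) = s}) \<union>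
      (\<Union>t\<in>T. {z. z \<bullet> (0, 1) = t})"
    unfolding negligible_iff_null_sets by (rule AE_not_in)
  then have "AE z :: real \<times> real in lebesgue. z \<in> \<Omega> \<longrightarrow> fst z \<notin> S \<and> snd z \<notin> T"
    by eventually_elim (auto simp: inner_prod_def)
  then show ?thesis
    using assms(3) by (subst AE_restrict_space_iff) auto
qed

lemma grad_product:
  assumes p: "\<And>x. (p has_real_derivative p' x) (at x)"
    and q: "\<And>x. (q has_real_derivative q' x) (at x)"
  shows "grad (\<lambda>z. c + p (fst z) * q (snd z)) z = (p' (fst z) * q (snd z), p (fst z) * q' (snd z))"
proof -
  let ?f = "\<lambda>z. c + p (fst z) * q (snd z)"
  have P: "((\<lambda>z. p (fst z)) has_derivative (\<lambda>h. p' (fst z) * fst h)) (at z)"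
    by (rule has_derivative_compose[OF _ p[unfolded has_field_derivative_def]])
      (auto intro!: derivative_eq_intros)
  have Q: "((\<lambda>z. q (snd z)) has_derivative (\<lambda>h. q' (snd z) * snd h)) (at z)"
    by (rule has_derivative_compose[OF _ q[unfolded has_field_derivative_def]])
      (auto intro!: derivative_eq_intros)
  have "(?f has_derivative (\<lambda>h. p (fst z) * (q' (snd z) * snd h) + p' (fst z) * fst h * q (snd z)))
      (at z)"
    using has_derivative_add[OF has_derivative_const has_derivative_mult[OF P Q]] by simp
  from frechet_derivative_at[OF this, symmetric]
  show ?thesis
    by (simp add: grad_def Basis_prod_def)
qed

text \<open>Products of the one-variable polynomial approximants are smooth, and one sequence of
  them serves the domain and the boundary, because values converge pointwise and boundedly on a
  square containing both. The boundary enters only through a finite measure carried by a bounded set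
  on which the function is constant.\<close>

lemma has_trace_product:
  assumes \<Omega>: "open \<Omega>" "bounded \<Omega>"
    and a: "piecewise_derivative a a'" and b: "piecewise_derivative b b'"
    and \<mu>: "finite_measure \<mu>" "sets \<mu> = sets borel"
    and AE: "AE z in \<mu>. norm z \<le> L \<and> c + a (fst z) * b (snd z) = d"
  shows "has_trace \<Omega> \<mu> (\<lambda>z. c + a (fst z) * b (snd z)) (\<lambda>_. d)"
proof -
  \<comment> \<open>K bounds the domain and L the carrier of \<mu>; the approximation is made on the
    larger of the two ranges.\<close>
  obtain K where K: "K > 0" "\<And>z. z \<in> \<Omega> \<Longrightarrow> norm z < K"
    using \<Omega>(2) bounded_pos_less by metis
  define B where "B = max K L"
  have "B > 0"
    using K(1) by (simp add: B_def)
  obtain p p' M S where "polynomial_approximation B a a' p p' M S"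
    using piecewise_derivative_approximation[OF a \<open>B > 0\<close>] by blast
  note p = polynomial_approximationD[OF this]
  obtain q q' N T where "polynomial_approximation B b b' q q' N T"
    using piecewise_derivative_approximation[OF b \<open>B > 0\<close>] by blast
  note q = polynomial_approximationD[OF this]
  obtain A where A: "A \<ge> 0" "\<And>x. \<bar>a x\<bar> \<le> A" "\<And>x. \<bar>a' x\<bar> \<le> A"
    using piecewise_derivative_bounded[OF a] by blast
  obtain A' where A': "A' \<ge> 0" "\<And>x. \<bar>b x\<bar> \<le> A'" "\<And>x. \<bar>b' x\<bar> \<le> A'"
    using piecewise_derivative_bounded[OF b] by blast
  let ?u = "\<lambda>z. c + a (fst z) * b (snd z)"
  let ?G = "\<lambda>z. (a' (fst z) * b (snd z), a (fst z) * b' (snd z))"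
  let ?\<phi> = "\<lambda>n z. c + p n (fst z) * q n (snd z)"
  have "M \<ge> 0"
    using p(4)[of 0 0] \<open>B > 0\<close> by simp
  have bd1: "\<bar>r * s\<bar> \<le> M * N" if "\<bar>r\<bar> \<le> M" "\<bar>s\<bar> \<le> N" for r s
    unfolding abs_mult using that \<open>M \<ge> 0\<close> by (intro mult_mono) auto
  have bd2: "\<bar>r * s\<bar> \<le> A * A'" if "\<bar>r\<bar> \<le> A" "\<bar>s\<bar> \<le> A'" for r s
    unfolding abs_mult using that A(1) by (intro mult_mono) auto
  define C where "C = M * N + A * A'"
  have bd: "\<bar>r * s - t * v\<bar> \<le> C" if "\<bar>r\<bar> \<le> M" "\<bar>s\<bar> \<le> N" "\<bar>t\<bar> \<le> A" "\<bar>v\<bar> \<le> A'" for r s t v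
    using bd1[OF that(1,2)] bd2[OF that(3,4)] unfolding C_def by linarith
  have m: "f \<in> borel_measurable borel" if "real_polynomial_function f" for f :: "real \<Rightarrow> real"
    using that by (intro borel_measurable_continuous_onI)
      (simp add: continuous_on_polymonial_function real_polynomial_function_eq)
  note ms = piecewise_derivative_measurable[OF a] piecewise_derivative_measurable[OF b]
    m[OF p(1)] m[OF p(2)] m[OF q(1)] m[OF q(2)]
  note [measurable] = ms[THEN measurable_fst_borel[where 'b=real]]
    ms[THEN measurable_snd_borel[where 'a=real]]
  have u_meas: "?u \<in> borel_measurable borel"
    by measurable
  have \<phi>_meas: "?\<phi> n \<in> borel_measurable borel" for n
    by measurable
  have G_meas: "?G \<in> borel_measurable borel"
    by (intro borel_measurable_Pair) measurable
  have grad_eq: "grad (?\<phi> n) = (\<lambda>z. (p' n (fst z) * q n (snd z), p n (fst z) * q' n (snd z)))" for n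
    by (rule ext) (rule grad_product[OF p(3) q(3)])
  have grad_meas: "grad (?\<phi> n) \<in> borel_measurable borel" for n
    unfolding grad_eq by (intro borel_measurable_Pair) measurable
  have sets: "\<Omega> \<in> sets lebesgue"
    using \<Omega>(1) by simp
  have fin: "finite_measure (lebesgue_on \<Omega>)"
    by (rule finite_measure_lebesgue_on_bounded[OF \<Omega>(2) sets])
  have le: "\<bar>fst z\<bar> \<le> B" "\<bar>snd z\<bar> \<le> B" if "norm z \<le> B" for z :: "real \<times> real"
    using that norm_fst_le[of "fst z" "snd z"] norm_snd_le[of "snd z" "fst z"] by auto
  have le\<Omega>: "\<bar>fst z\<bar> \<le> B \<and> \<bar>snd z\<bar> \<le> B" if "z \<in> \<Omega>" for z :: "real \<times> real"
    using K(2)[OF that] le[of z] by (simp add: B_def)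
  have diff: "\<bar>?\<phi> n z - ?u z\<bar> \<le> C" if "\<bar>fst z\<bar> \<le> B" "\<bar>snd z\<bar> \<le> B" for n z
    using bd[OF p(4)[OF that(1)] q(4)[OF that(2)] A(2) A'(2)] by simp
  have lim: "(\<lambda>n. ?\<phi> n z) \<longlonglongrightarrow> ?u z" if "\<bar>fst z\<bar> \<le> B" "\<bar>snd z\<bar> \<le> B" for z
    by (intro tendsto_intros p(6) q(6) that)
  show ?thesis
    unfolding has_trace_def
  proof (intro conjI exI[of _ ?G] exI[of _ ?\<phi>] allI)
    show "has_H1_gradient \<Omega> ?u ?G"
      by (rule has_H1_gradient_product[OF \<Omega> a b])
    show "(\<lambda>_. d) \<in> Lp 2 \<mu>"
      by (rule Lp_boundedI[OF \<mu>(1), of _ "\<bar>d\<bar>"]) auto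
    show "smooth (?\<phi> n)" for n
    proof (rule smooth_real_polynomial_function)
      have "real_polynomial_function (p n \<circ> (fst :: real \<times> real \<Rightarrow> real))"
        "real_polynomial_function (q n \<circ> (snd :: real \<times> real \<Rightarrow> real))"
        using p(1) q(1) by (auto intro!: real_polynomial_function_compose
            polynomial_function_bounded_linear bounded_linear_fst bounded_linear_snd)
      then show "real_polynomial_function (?\<phi> n)"
        unfolding o_def by (intro real_polynomial_function.intros(2-4))
    qed
    show "Lp_tendsto 2 (lebesgue_on \<Omega>) ?\<phi> ?u"
    proof (rule Lp_tendsto_dominated[OF fin])
      show "AE z in lebesgue_on \<Omega>. norm (?\<phi> n z - ?u z) \<le> C" for n
        using diff le\<Omega> by (intro AE_I2) simp
      show "AE z in lebesgue_on \<Omega>. (\<lambda>n. ?\<phi> n z) \<longlonglongrightarrow> ?u z"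
        using lim le\<Omega> by (intro AE_I2) simp
    qed (use \<phi>_meas u_meas in \<open>simp_all add: borel_measurable_lebesgue_on\<close>)
    show "Lp_tendsto 2 (lebesgue_on \<Omega>) (\<lambda>n. grad (?\<phi> n)) ?G"
    proof (rule Lp_tendsto_dominated[OF fin])
      show "AE z in lebesgue_on \<Omega>. norm (grad (?\<phi> n) z - ?G z) \<le> C + C" for n
      proof (rule AE_I2)
        fix z assume "z \<in> space (lebesgue_on \<Omega>)"
        then have z: "\<bar>fst z\<bar> \<le> B" "\<bar>snd z\<bar> \<le> B"
          using le\<Omega> by auto
        have "\<bar>p' n (fst z) * q n (snd z) - a' (fst z) * b (snd z)\<bar> \<le> C"
          by (rule bd[OF p(5)[OF z(1)] q(4)[OF z(2)] A(3) A'(2)])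
        moreover have "\<bar>p n (fst z) * q' n (snd z) - a (fst z) * b' (snd z)\<bar> \<le> C"
          by (rule bd[OF p(4)[OF z(1)] q(5)[OF z(2)] A(2) A'(3)])
        ultimately show "norm (grad (?\<phi> n) z - ?G z) \<le> C + C"
          using norm_Pair_le[of "p' n (fst z) * q n (snd z) - a' (fst z) * b (snd z)"
              "p n (fst z) * q' n (snd z) - a (fst z) * b' (snd z)"]
          unfolding grad_eq by simp
      qed
      show "AE z in lebesgue_on \<Omega>. (\<lambda>n. grad (?\<phi> n) z) \<longlonglongrightarrow> ?G z"
        using AE_lebesgue_on_off_finite_lines[OF p(7) q(7) sets] AE_space
      proof eventually_elim
        case (elim z)
        then have z: "\<bar>fst z\<bar> \<le> B" "\<bar>snd z\<bar> \<le> B" "fst z \<notin> S" "snd z \<notin> T"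
          using le\<Omega> by auto
        show ?case
          unfolding grad_eq by (intro tendsto_intros p(6,8) q(6,8) z)
      qed
    qed (use grad_meas G_meas in \<open>simp_all add: borel_measurable_lebesgue_on\<close>)
    \<comment> \<open>Only values are needed here, and they converge everywhere. This is essential:
      the sides y = h and y = -h of the rectangle lie on exceptional lines, which are null in the
      plane but not for arc length.\<close>
    show "Lp_tendsto 2 \<mu> ?\<phi> (\<lambda>_. d)"
    proof (rule Lp_tendsto_dominated[OF \<mu>(1)])
      show "AE z in \<mu>. norm (?\<phi> n z - d) \<le> C" for n
        using AE
      proof eventually_elim
        case (elim z)
        then have "norm z \<le> B"
          by (simp add: B_def le_max_iff_disj)
        then show ?case
          using diff[OF le[of z]] elim by auto
      qed
      show "AE z in \<mu>. (\<lambda>n. ?\<phi> n z) \<longlonglongrightarrow> d"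
        using AE
      proof eventually_elim
        case (elim z)
        then have "norm z \<le> B"
          by (simp add: B_def le_max_iff_disj)
        then show ?case
          using lim[OF le[of z]] elim by simp
      qed
      show "?\<phi> n \<in> borel_measurable \<mu>" for n
        using \<phi>_meas[of n] measurable_cong_sets[OF \<mu>(2) refl] by blast
    qed simp_all
  qed
qed

section \<open>Arc length measures\<close>

text \<open>These are the three facts about a boundary curve that the trace argument uses; only
  continuity of the curve and an almost everywhere bound on its speed are required.\<close>

lemma arclength_measure_of_bounded_speed:
  fixes \<gamma> :: "real \<Rightarrow> 'a::euclidean_space"
  assumes \<gamma>: "continuous_on {0..1} \<gamma>"
    and speed: "AE t in lebesgue_on {0..1}. norm (vector_derivative \<gamma> (at t)) \<le> C"
  shows "finite_measure (arclength_measure \<gamma>)"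
    and "sets (arclength_measure \<gamma>) = sets borel"
    and "AE z in arclength_measure \<gamma>. z \<in> \<gamma> ` {0..1}"
proof -
  let ?M = "lebesgue_on {0..1::real}"
  let ?f = "\<lambda>t. ennreal (norm (vector_derivative \<gamma> (at t)))"
  let ?N = "density ?M ?f"
  have sp: "space ?N = {0..1}"
    by simp
  have "\<gamma> \<in> borel_measurable ?M"
    using \<gamma> by (intro continuous_imp_measurable_on_sets_lebesgue) auto
  then have meas: "\<gamma> \<in> borel_measurable ?N"
    by simp
  show "sets (arclength_measure \<gamma>) = sets borel"
    by (simp add: arclength_measure_def)
  have "emeasure ?N {0..1} \<le> (\<integral>\<^sup>+ t. ?f t * indicator {0..1} t \<partial>?M)"
    \<comment> \<open>Only an inequality is claimed, because measurability of the speed is not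
      assumed: should the density fail to define a measure, the left side is 0 by
      convention.\<close>
    unfolding density_def by (subst emeasure_measure_of_conv) auto
  also have "\<dots> \<le> (\<integral>\<^sup>+ t. ennreal C \<partial>?M)"
  proof (rule nn_integral_mono_AE)
    show "AE t in ?M. ?f t * indicator {0..1} t \<le> ennreal C"
      using speed by eventually_elim (auto simp: indicator_def intro: ennreal_leI)
  qed
  also have "\<dots> < \<infinity>"
    by (simp add: emeasure_restrict_space ennreal_mult_less_top)
  finally have "emeasure (arclength_measure \<gamma>) UNIV < \<infinity>"
    unfolding arclength_measure_def using meas by (subst emeasure_distr) auto
  then show "finite_measure (arclength_measure \<gamma>)"
    by (intro finite_measureI) (simp add: arclength_measure_def)
  have "compact (\<gamma> ` {0..1})"
    using \<gamma> by (intro compact_continuous_image) auto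
  then have "{z \<in> space borel. z \<in> \<gamma> ` {0..1}} \<in> sets borel"
    by (simp add: borel_compact)
  then show "AE z in arclength_measure \<gamma>. z \<in> \<gamma> ` {0..1}"
    unfolding arclength_measure_def
    by (subst AE_distr_iff[OF meas]) (auto intro!: AE_I2)
qed

text \<open>Joining paths reparametrises each segment by an affine map, which is why the argument of
  \<open>linepath\<close> is k s - j; k is the resulting speed factor.\<close>

lemma vector_derivative_affine_piece:
  fixes \<gamma> :: "real \<Rightarrow> 'a::real_normed_vector"
  assumes "\<And>s. l < s \<Longrightarrow> s < r \<Longrightarrow> \<gamma> s = linepath a b (k * s - j)" "l < t" "t < r"
  shows "vector_derivative \<gamma> (at t) = k *\<^sub>R (b - a)"
proof (rule vector_derivative_at)
  have "((\<lambda>s. linepath a b (k * s - j)) has_vector_derivative k *\<^sub>R (b - a)) (at t)"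
    unfolding linepath_def
    by (auto intro!: derivative_eq_intros simp: algebra_simps)
  then show "(\<gamma> has_vector_derivative k *\<^sub>R (b - a)) (at t)"
    by (rule has_vector_derivative_transform_within_open[where S = "{l<..<r}"])
      (use assms in auto)
qed

lemma AE_lebesgue_on_finite:
  fixes S :: "'a::euclidean_space set"
  assumes "finite S" "T \<in> sets lebesgue"
  shows "AE t in lebesgue_on T. t \<notin> S"
proof -
  have "AE t in lebesgue. t \<notin> S"
    using negligible_finite[OF assms(1)] unfolding negligible_iff_null_sets by (rule AE_not_in)
  then have "AE t in lebesgue. t \<in> T \<longrightarrow> t \<notin> S"
    by eventually_elim simp
  then show ?thesis
    using assms(2) by (subst AE_restrict_space_iff) auto
qed

lemma rect_path_speed:
  "\<exists>C. AE t in lebesgue_on {0..1}. norm (vector_derivative (rect_path h R) (at t)) \<le> C"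
proof -
  let ?n = "\<lambda>k (a :: real \<times> real) b. \<bar>k\<bar> * norm (b - a)"
  define C where "C = ?n 2 (-R, -h) (R, -h) + ?n 4 (R, -h) (R, h) + ?n 8 (R, h) (-R, h)
    + ?n 8 (-R, h) (-R, -h)"
  have "norm (vector_derivative (rect_path h R) (at t)) \<le> C"
    if t: "t \<in> {0..1}" "t \<notin> {0, 1 / 2, 3 / 4, 7 / 8, 1}" for t :: real
  proof -
    consider "0 < t" "t < 1 / 2" | "1 / 2 < t" "t < 3 / 4" | "3 / 4 < t" "t < 7 / 8"
      | "7 / 8 < t" "t < 1"
      using t by fastforce
    then have "vector_derivative (rect_path h R) (at t) \<in>
      {2 *\<^sub>R ((R, -h) - (-R, -h)), 4 *\<^sub>R ((R, h) - (R, -h)), 8 *\<^sub>R ((-R, h) - (R, h)),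
       8 *\<^sub>R ((-R, -h) - (-R, h))}"
    proof cases
      case 1
      have "vector_derivative (rect_path h R) (at t) = 2 *\<^sub>R ((R, -h) - (-R, -h))"
        by (rule vector_derivative_affine_piece[OF _ 1, where j = 0])
          (simp add: rect_path_def joinpaths_def)
      then show ?thesis by simp
    next
      case 2
      have "vector_derivative (rect_path h R) (at t) = 4 *\<^sub>R ((R, h) - (R, -h))"
        by (rule vector_derivative_affine_piece[OF _ 2, where j = 2])
          (simp add: rect_path_def joinpaths_def)
      then show ?thesis by simp
    next
      case 3
      have "vector_derivative (rect_path h R) (at t) = 8 *\<^sub>R ((-R, h) - (R, h))"
        by (rule vector_derivative_affine_piece[OF _ 3, where j = 6])
          (simp add: rect_path_def joinpaths_def)
      then show ?thesis by simp
    next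
      case 4
      have "vector_derivative (rect_path h R) (at t) = 8 *\<^sub>R ((-R, -h) - (-R, h))"
        by (rule vector_derivative_affine_piece[OF _ 4, where j = 7])
          (simp add: rect_path_def joinpaths_def)
      then show ?thesis by simp
    qed
    then show ?thesis
      unfolding C_def by (auto simp only: insert_iff empty_iff norm_scaleR)
        (simp_all add: add_nonneg_nonneg)
  qed
  moreover have "AE t in lebesgue_on {0..1::real}. t \<notin> {0, 1 / 2, 3 / 4, 7 / 8, 1}"
    by (rule AE_lebesgue_on_finite) auto
  ultimately have "AE t in lebesgue_on {0..1}. norm (vector_derivative (rect_path h R) (at t)) \<le> C"
    using AE_space by (auto elim!: eventually_elim2)
  then show ?thesis ..
qed

lemma circle_path_speed:
  "\<exists>C. AE t in lebesgue_on {0..1}. norm (vector_derivative circle_path (at t)) \<le> C"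
proof -
  have "norm (vector_derivative circle_path (at t)) \<le> 2 * pi + 2 * pi" for t
  proof -
    let ?v = "(- sin (2 * pi * t) * (2 * pi), cos (2 * pi * t) * (2 * pi))"
    have "(circle_path has_vector_derivative ?v) (at t)"
      unfolding circle_path_def[abs_def]
      by (intro has_vector_derivative_Pair;
          unfold has_real_derivative_iff_has_vector_derivative[symmetric];
          auto intro!: derivative_eq_intros)
    then have "vector_derivative circle_path (at t) = ?v"
      by (rule vector_derivative_at)
    moreover have "\<bar>- sin (2 * pi * t) * (2 * pi)\<bar> \<le> 2 * pi"
      "\<bar>cos (2 * pi * t) * (2 * pi)\<bar> \<le> 2 * pi"
      using abs_sin_le_one[of "2 * pi * t"] abs_cos_le_one[of "2 * pi * t"]
      by (simp_all add: abs_mult mult_left_le_one_le mult_le_cancel_right2)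
    ultimately show ?thesis
      using norm_Pair_le[of "- sin (2 * pi * t) * (2 * pi)" "cos (2 * pi * t) * (2 * pi)"] by simp
  qed
  then show ?thesis
    by (auto intro!: exI AE_I2)
qed

lemma continuous_on_rect_path: "continuous_on {0..1} (rect_path h R)"
proof -
  have "path (rect_path h R)"
    unfolding rect_path_def by (intro path_join_imp path_linepath) simp_all
  then show ?thesis
    by (simp add: path_def)
qed

lemma continuous_on_circle_path: "continuous_on {0..1} circle_path"
  unfolding circle_path_def[abs_def] by (intro continuous_intros)

section \<open>Profile functions\<close>

text \<open>\<open>p\<close> and \<open>q\<close> describe the function on \<open>1 < y < 1 + m\<close> and \<open>-1 - m < y < -1\<close> in terms of the
  normalised distance to the central interval, \<open>r\<close> describes it on the central interval.\<close>

definition profile ::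
  "real \<Rightarrow> (real \<Rightarrow> real) \<Rightarrow> (real \<Rightarrow> real) \<Rightarrow> (real \<Rightarrow> real) \<Rightarrow> real \<Rightarrow> real" where
  "profile m p q r y =
     (if \<bar>y\<bar> \<le> 1 then r y
      else if 1 < y \<and> y < 1 + m then p ((y - 1) / m)
      else if y < -1 \<and> -1 - m < y then q ((-y - 1) / m) else 0)"

lemma profile_mult:
  "profile m p q r y * profile m p' q' r' y =
     profile m (\<lambda>t. p t * p' t) (\<lambda>t. q t * q' t) (\<lambda>t. r t * r' t) y"
  by (simp add: profile_def)

lemma profile_power:
  "n > 0 \<Longrightarrow> profile m p q r y ^ n = profile m (\<lambda>t. p t ^ n) (\<lambda>t. q t ^ n) (\<lambda>t. r t ^ n) y"
  by (simp add: profile_def)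

lemma profile_bounded:
  assumes "m > 0" "continuous_on UNIV p" "continuous_on UNIV q" "continuous_on UNIV r"
  shows "\<exists>M. \<forall>y. \<bar>profile m p q r y\<bar> \<le> M"
proof -
  have bdd: "\<exists>N. \<forall>x\<in>{-1..1}. \<bar>f x\<bar> \<le> N" if "continuous_on UNIV f" for f :: "real \<Rightarrow> real"
  proof -
    have "compact (f ` {-1..1})"
      using that continuous_on_subset by (intro compact_continuous_image) auto
    from compact_imp_bounded[OF this] show ?thesis
      unfolding bounded_iff by auto
  qed
  obtain P where P: "\<forall>x\<in>{-1..1}. \<bar>p x\<bar> \<le> P"
    using bdd[OF assms(2)] by blast
  obtain Q where Q: "\<forall>x\<in>{-1..1}. \<bar>q x\<bar> \<le> Q"
    using bdd[OF assms(3)] by blast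
  obtain R where R: "\<forall>x\<in>{-1..1}. \<bar>r x\<bar> \<le> R"
    using bdd[OF assms(4)] by blast
  have "\<bar>profile m p q r y\<bar> \<le> \<bar>P\<bar> + \<bar>Q\<bar> + \<bar>R\<bar>" for y
  proof -
    consider "\<bar>y\<bar> \<le> 1" | "1 < y" "y < 1 + m" | "y < -1" "-1 - m < y"
      | "\<not> \<bar>y\<bar> \<le> 1" "\<not> (1 < y \<and> y < 1 + m)" "\<not> (y < -1 \<and> -1 - m < y)"
      by blast
    then show ?thesis
    proof cases
      case 1
      then have "\<bar>r y\<bar> \<le> R"
        using bspec[OF R, of y] by (auto simp: abs_le_iff)
      then show ?thesis
        using 1 by (simp add: profile_def)
    next
      case 2
      then have "(y - 1) / m \<in> {-1..1}"
        using \<open>m > 0\<close> by (simp add: field_simps)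
      then have "\<bar>p ((y - 1) / m)\<bar> \<le> P"
        using P by blast
      then show ?thesis
        using 2 by (simp add: profile_def)
    next
      case 3
      then have "(-y - 1) / m \<in> {-1..1}"
        using \<open>m > 0\<close> by (simp add: field_simps)
      then have "\<bar>q ((-y - 1) / m)\<bar> \<le> Q"
        using Q by blast
      then show ?thesis
        using 3 by (simp add: profile_def)
    next
      case 4
      then have "profile m p q r y = 0"
        by (auto simp: profile_def)
      then show ?thesis
        by simp
    qed
  qed
  then show ?thesis
    by blast
qed

lemma profile_measurable:
  assumes "continuous_on UNIV p" "continuous_on UNIV q" "continuous_on UNIV r"
  shows "profile m p q r \<in> borel_measurable borel"
proof -
  note [measurable] = assms[THEN borel_measurable_continuous_onI]
  show ?thesis
    unfolding profile_def[abs_def] by measurable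
qed

text \<open>The case distinction is replaced by a sum of three clamped compositions. Outside its own
  interval each summand is frozen at a junction value, and the subtracted constants cancel these
  values by the matching conditions.\<close>

lemma profile_continuous:
  assumes "m > 0"
    and "continuous_on UNIV p" "continuous_on UNIV q" "continuous_on UNIV r"
    and match: "p 0 = r 1" "q 0 = r (-1)" "p 1 = 0" "q 1 = 0"
  shows "continuous_on UNIV (profile m p q r)"
proof -
  define cl where "cl t = max 0 (min 1 t)" for t :: real
  define f where "f y = p (cl ((y - 1) / m)) + q (cl ((-y - 1) / m)) + r (max (-1) (min 1 y)) - r 1 - r (-1)"
    for y
  have "profile m p q r y = f y" for y
  proof -
    consider "\<bar>y\<bar> \<le> 1" | "1 < y" "y < 1 + m" | "1 + m \<le> y" | "y < -1" "-1 - m < y" | "y \<le> -1 - m"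
      using \<open>m > 0\<close> by linarith
    then show ?thesis
    proof cases
      case 1
      then have "(y - 1) / m \<le> 0" "(-y - 1) / m \<le> 0" "max (-1) (min 1 y) = y"
        using \<open>m > 0\<close> by (auto simp: divide_le_0_iff)
      then show ?thesis
        using 1 match by (simp add: profile_def f_def cl_def)
    next
      case 2
      then have "0 \<le> (y - 1) / m" "(y - 1) / m \<le> 1" "(-y - 1) / m \<le> 0"
        using \<open>m > 0\<close> by (auto simp: field_simps)
      then show ?thesis
        using 2 match by (simp add: profile_def f_def cl_def)
    next
      case 3
      then have "1 \<le> (y - 1) / m" "(-y - 1) / m \<le> 0" "1 < y"
        using \<open>m > 0\<close> by (auto simp: field_simps)
      then show ?thesis
        using 3 match by (simp add: profile_def f_def cl_def)
    next
      case 4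
      then have "0 \<le> (-y - 1) / m" "(-y - 1) / m \<le> 1" "(y - 1) / m \<le> 0"
        using \<open>m > 0\<close> by (auto simp: field_simps)
      then show ?thesis
        using 4 match by (simp add: profile_def f_def cl_def)
    next
      case 5
      then have "1 \<le> (-y - 1) / m" "(y - 1) / m \<le> 0" "y < -1"
        using \<open>m > 0\<close> by (auto simp: field_simps)
      then show ?thesis
        using 5 match by (simp add: profile_def f_def cl_def)
    qed
  qed
  moreover have "continuous_on UNIV f"
    unfolding f_def cl_def
    by (intro continuous_intros continuous_on_compose2[OF assms(2)] continuous_on_compose2[OF assms(3)]
        continuous_on_compose2[OF assms(4)]) (use \<open>m > 0\<close> in auto)
  ultimately show ?thesis
    by (simp add: fun_eq_iff[symmetric] cong: continuous_on_cong)
qed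

lemma profile_has_derivative:
  assumes "m > 0"
    and p: "\<And>t. (p has_real_derivative p' t) (at t)"
    and q: "\<And>t. (q has_real_derivative q' t) (at t)"
    and r: "\<And>t. (r has_real_derivative r' t) (at t)"
    and y: "y \<notin> {-1 - m, -1, 1, 1 + m}"
  shows "(profile m p q r has_real_derivative profile m (\<lambda>t. p' t / m) (\<lambda>t. - q' t / m) r' y) (at y)"
proof -
  consider "-1 < y" "y < 1" | "1 < y" "y < 1 + m" | "1 + m < y" | "y < -1" "-1 - m < y" | "y < -1 - m"
    using \<open>m > 0\<close> y by fastforce
  then show ?thesis
  proof cases
    case 1
    have "(profile m p q r has_real_derivative r' y) (at y)"
      by (rule has_field_derivative_transform_within_open[OF r, where S = "{-1<..<1}"]) (use 1 in \<open>auto simp: profile_def\<close>)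
    then show ?thesis
      using 1 by (simp add: profile_def abs_le_iff)
  next
    case 2
    have "((\<lambda>y. p ((y - 1) / m)) has_real_derivative p' ((y - 1) / m) * (1 / m)) (at y)"
      by (rule DERIV_chain2[OF p]) (use \<open>m > 0\<close> in \<open>auto intro!: derivative_eq_intros\<close>)
    then have "(profile m p q r has_real_derivative p' ((y - 1) / m) * (1 / m)) (at y)"
      by (rule has_field_derivative_transform_within_open[where S = "{1<..<1 + m}"]) (use 2 in \<open>auto simp: profile_def\<close>)
    then show ?thesis
      using 2 by (simp add: profile_def)
  next
    case 3
    have "(profile m p q r has_real_derivative 0) (at y)"
      by (rule has_field_derivative_transform_within_open[OF DERIV_const, where S = "{1 + m<..}"])
        (use 3 \<open>m > 0\<close> in \<open>auto simp: profile_def\<close>)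
    then show ?thesis
      using 3 \<open>m > 0\<close> by (simp add: profile_def)
  next
    case 4
    have "((\<lambda>y. q ((-y - 1) / m)) has_real_derivative q' ((-y - 1) / m) * (-1 / m)) (at y)"
      by (rule DERIV_chain2[OF q]) (use \<open>m > 0\<close> in \<open>auto intro!: derivative_eq_intros\<close>)
    then have "(profile m p q r has_real_derivative q' ((-y - 1) / m) * (-1 / m)) (at y)"
      by (rule has_field_derivative_transform_within_open[where S = "{-1 - m<..<-1}"]) (use 4 in \<open>auto simp: profile_def\<close>)
    then show ?thesis
      using 4 by (simp add: profile_def)
  next
    case 5
    have "(profile m p q r has_real_derivative 0) (at y)"
      by (rule has_field_derivative_transform_within_open[OF DERIV_const, where S = "{..<-1 - m}"])
        (use 5 \<open>m > 0\<close> in \<open>auto simp: profile_def\<close>)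
    then show ?thesis
      using 5 \<open>m > 0\<close> by (simp add: profile_def)
  qed
qed

lemma profile_piecewise_derivative:
  assumes "m > 0"
    and p: "\<And>t. (p has_real_derivative p' t) (at t)" "continuous_on UNIV p'"
    and q: "\<And>t. (q has_real_derivative q' t) (at t)" "continuous_on UNIV q'"
    and r: "\<And>t. (r has_real_derivative r' t) (at t)" "continuous_on UNIV r'"
    and match: "p 0 = r 1" "q 0 = r (-1)" "p 1 = 0" "q 1 = 0"
  shows "piecewise_derivative (profile m p q r) (profile m (\<lambda>t. p' t / m) (\<lambda>t. - q' t / m) r')"
    (is "piecewise_derivative ?f ?f'")
proof -
  have c: "continuous_on UNIV p" "continuous_on UNIV q" "continuous_on UNIV r"
    using p(1) q(1) r(1) by (auto intro: DERIV_continuous_on)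
  have c': "continuous_on UNIV (\<lambda>t. p' t / m)" "continuous_on UNIV (\<lambda>t. - q' t / m)"
    using p(2) q(2) \<open>m > 0\<close> by (auto intro!: continuous_intros)
  obtain M where M: "\<forall>y. \<bar>?f y\<bar> \<le> M"
    using profile_bounded[OF \<open>m > 0\<close> c] by blast
  obtain M' where M': "\<forall>y. \<bar>?f' y\<bar> \<le> M'"
    using profile_bounded[OF \<open>m > 0\<close> c' r(2)] by blast
  show ?thesis
    unfolding piecewise_derivative_def
  proof (intro conjI)
    show "continuous_on UNIV ?f"
      by (rule profile_continuous[OF \<open>m > 0\<close> c match])
    show "?f' \<in> borel_measurable borel"
      by (rule profile_measurable[OF c' r(2)])
    show "\<exists>M. \<forall>x. \<bar>?f x\<bar> \<le> M \<and> \<bar>?f' x\<bar> \<le> M"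
      using M M' by (intro exI[of _ "max M M'"]) (simp add: le_max_iff_disj)
    show "\<exists>S. finite S \<and> (\<forall>x. x \<notin> S \<longrightarrow> (?f has_real_derivative ?f' x) (at x))"
      using profile_has_derivative[OF \<open>m > 0\<close> p(1) q(1) r(1)]
      by (intro exI[of _ "{-1 - m, -1, 1, 1 + m}"]) simp
  qed
qed

text \<open>The substitutions y = 1 + m t and y = -1 - m t each contribute a factor m; the values at
  the junctions are immaterial, so every piece is compared with its formula on the open interval
  only.\<close>

lemma profile_has_integral:
  assumes "m > 0" "1 + m \<le> L"
    and p: "(p has_integral P) {0..1}" and q: "(q has_integral Q) {0..1}"
    and r: "(r has_integral R) {-1..1}"
  shows "(profile m p q r has_integral (m * P + m * Q + R)) {-L..L}"
proof -
  let ?f = "profile m p q r"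
  have 1: "(?f has_integral 0) {-L..-1 - m}"
  proof -
    have "((\<lambda>_. 0 :: real) has_integral 0) (cbox (-L) (-1 - m))"
      by simp
    from has_integral_spike_interior[OF this, of ?f] show ?thesis
      using \<open>m > 0\<close> by (simp add: cbox_interval box_real profile_def)
  qed
  have 2: "(?f has_integral m * Q) {-1 - m..-1}"
  proof -
    have "((\<lambda>y. q ((-1 / m) *\<^sub>R y + (-1 / m))) has_integral (1 / \<bar>-1 / m\<bar> ^ DIM(real)) *\<^sub>R Q)
      ((\<lambda>x. (1 / (-1 / m)) *\<^sub>R x + - ((1 / (-1 / m)) *\<^sub>R (-1 / m))) ` cbox 0 1)"
      using q \<open>m > 0\<close> by (intro has_integral_affinity) (auto simp: cbox_interval)
    then have "((\<lambda>y. q ((-1 / m) * y + (-1 / m))) has_integral m * Q) (cbox (-1 - m) (-1))"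
      using \<open>m > 0\<close> image_affinity_atLeastAtMost[of "-m" "-1" 0 1]
      by (simp add: cbox_interval algebra_simps)
    from has_integral_spike_interior[OF this, of ?f] show ?thesis
      using \<open>m > 0\<close> by (simp add: cbox_interval box_real profile_def diff_divide_distrib)
  qed
  have 3: "(?f has_integral R) {-1..1}"
    using r has_integral_spike_interior[of r R "-1" 1 ?f]
    by (simp add: cbox_interval box_real profile_def abs_le_iff)
  have 4: "(?f has_integral m * P) {1..1 + m}"
  proof -
    have "((\<lambda>y. p ((1 / m) *\<^sub>R y + (-1 / m))) has_integral (1 / \<bar>1 / m\<bar> ^ DIM(real)) *\<^sub>R P)
      ((\<lambda>x. (1 / (1 / m)) *\<^sub>R x + - ((1 / (1 / m)) *\<^sub>R (-1 / m))) ` cbox 0 1)"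
      using p \<open>m > 0\<close> by (intro has_integral_affinity) (auto simp: cbox_interval)
    then have "((\<lambda>y. p ((1 / m) * y + (-1 / m))) has_integral m * P) (cbox 1 (1 + m))"
      using \<open>m > 0\<close> image_affinity_atLeastAtMost[of m 1 0 1]
      by (simp add: cbox_interval algebra_simps)
    from has_integral_spike_interior[OF this, of ?f] show ?thesis
      using \<open>m > 0\<close> by (simp add: cbox_interval box_real profile_def diff_divide_distrib)
  qed
  have 5: "(?f has_integral 0) {1 + m..L}"
  proof -
    have "((\<lambda>_. 0 :: real) has_integral 0) (cbox (1 + m) L)"
      by simp
    from has_integral_spike_interior[OF this, of ?f] show ?thesis
      using \<open>m > 0\<close> by (simp add: cbox_interval box_real profile_def)
  qed
  have "(?f has_integral (0 + m * Q)) {-L..-1}"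
    using \<open>m > 0\<close> \<open>1 + m \<le> L\<close> by (intro has_integral_combine[OF _ _ 1 2]) auto
  from has_integral_combine[OF _ _ this 3]
  have "(?f has_integral (0 + m * Q + R)) {-L..1}"
    using \<open>m > 0\<close> \<open>1 + m \<le> L\<close> by simp
  from has_integral_combine[OF _ _ this 4]
  have "(?f has_integral (0 + m * Q + R + m * P)) {-L..1 + m}"
    using \<open>m > 0\<close> \<open>1 + m \<le> L\<close> by simp
  from has_integral_combine[OF _ _ this 5]
  have "(?f has_integral (0 + m * Q + R + m * P + 0)) {-L..L}"
    using \<open>m > 0\<close> \<open>1 + m \<le> L\<close> by simp
  then show ?thesis
    by (simp add: algebra_simps)
qed

section \<open>Moments of the transition functions\<close>

primrec horner :: "real list \<Rightarrow> real \<Rightarrow> real" where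
  "horner [] t = 0"
| "horner (c # cs) t = c + t * horner cs t"

text \<open>This is the integral over [0, 1] of t^n times the polynomial with these ascending
  coefficients. The offset n makes the recursion structural: dropping the leading coefficient raises
  the power of t by one.\<close>

primrec moment :: "nat \<Rightarrow> real list \<Rightarrow> real" where
  "moment n [] = 0"
| "moment n (c # cs) = c / real (Suc n) + moment (Suc n) cs"

lemma has_integral_horner:
  "((\<lambda>t. t ^ n * horner cs t) has_integral moment n cs) {0..1}"
proof (induction cs arbitrary: n)
  case Nil
  then show ?case
    by simp
next
  case (Cons c cs)
  have "((\<lambda>t::real. t ^ n) has_integral 1 / real (Suc n)) {0..1}"
  proof -
    have "((\<lambda>t::real. t ^ n) has_integral 1 ^ Suc n / real (Suc n) - 0 ^ Suc n / real (Suc n)) {0..1}"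
    proof (rule fundamental_theorem_of_calculus)
      show "((\<lambda>t. t ^ Suc n / real (Suc n)) has_vector_derivative t ^ n) (at t within {0..1})" for t :: real
        using DERIV_cdivide[OF DERIV_pow[of "Suc n" t "{0..1}"], of "real (Suc n)"]
        by (simp add: has_real_derivative_iff_has_vector_derivative del: power_Suc of_nat_Suc)
    qed simp
    then show ?thesis
      by simp
  qed
  from has_integral_add[OF has_integral_mult_right[OF this, of c] Cons.IH[of "Suc n"]]
  show ?case
    by (simp add: algebra_simps)
qed

text \<open>Reduces every integral below to a polynomial identity in t and a rational computation
  with the coefficients.\<close>

lemma has_integral_eq_horner:
  assumes "\<And>t. f t = horner cs t" "moment 0 cs = I"
  shows "(f has_integral I) {0..1}"
proof -
  have "f = horner cs"
    using assms(1) by (rule ext)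
  then show ?thesis
    using has_integral_horner[of 0 cs] assms(2) by simp
qed

text \<open>The cubic factor falls from 1 to 0 with vanishing slope at both ends; the quadratic factor
  carries the free parameters. The coefficient lists in the proofs below are the integrands
  expanded in powers of \<open>t\<close>.\<close>

definition tr :: "real \<Rightarrow> real \<Rightarrow> real \<Rightarrow> real \<Rightarrow> real" where
  "tr a b c t = (1 - 3 * t^2 + 2 * t^3) * (a + b * t + c * t^2)"

definition tr1 :: "real \<Rightarrow> real \<Rightarrow> real \<Rightarrow> real \<Rightarrow> real" where
  "tr1 a b c t =
    b + (- 6 * a + 2 * c) * t + (6 * a - 9 * b) * t^2 + (8 * b - 12 * c) * t^3 + (10 * c) * t^4"

definition tr2 :: "real \<Rightarrow> real \<Rightarrow> real \<Rightarrow> real \<Rightarrow> real" where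
  "tr2 a b c t =
    - 6 * a + 2 * c + (12 * a - 18 * b) * t + (24 * b - 36 * c) * t^2 + (40 * c) * t^3"

lemma tr_derivative: "(tr a b c has_real_derivative tr1 a b c t) (at t)"
  unfolding tr_def[abs_def] tr1_def
  by (rule derivative_eq_intros refl | simp)+ (simp add: algebra_simps power2_eq_square power3_eq_cube eval_nat_numeral)

lemma tr1_derivative: "(tr1 a b c has_real_derivative tr2 a b c t) (at t)"
  unfolding tr1_def[abs_def] tr2_def
  by (rule derivative_eq_intros refl | simp)+ (simp add: algebra_simps power2_eq_square power3_eq_cube eval_nat_numeral)

definition tr1_power2_mom :: "real \<Rightarrow> real \<Rightarrow> real \<Rightarrow> real" where
  "tr1_power2_mom a b c =
    6/5 * a^2 + 1/5 * a * b - 2/35 * a * c + 12/35 * b^2 + 9/35 * b * c + 26/315 * c^2"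

lemma tr1_power2_has_integral:
  "((\<lambda>t. tr1 a b c t ^ 2) has_integral tr1_power2_mom a b c) {0..1}"
proof (rule has_integral_eq_horner[where cs =
      "[b^2, - 12 * a * b + 4 * b * c, 36 * a^2 + 12 * a * b - 24 * a * c - 18 * b^2 + 4 * c^2,
        - 72 * a^2 + 108 * a * b + 24 * a * c + 16 * b^2 - 60 * b * c, 36 * a^2 - 204 * a * b +
        144 * a * c + 81 * b^2 + 52 * b * c - 48 * c^2, 96 * a * b - 264 * a * c - 144 * b^2 +
        216 * b * c + 40 * c^2, 120 * a * c + 64 * b^2 - 372 * b * c + 144 * c^2, 160 * b * c -
        240 * c^2, 100 * c^2]"], goal_cases)
  case 1
  show ?case unfolding tr_def tr1_def tr2_def horner.simps by algebra
next
  case 2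
  show ?case by (simp add: tr1_power2_mom_def field_simps)
qed

definition tr1_power3_mom :: "real \<Rightarrow> real \<Rightarrow> real \<Rightarrow> real" where
  "tr1_power3_mom a b c =
    - 54/35 * a^3 - 18/35 * a^2 * b + 6/35 * a^2 * c - 29/35 * a * b^2 - 5/7 * a * b * c -
      96/385 * a * c^2 + 3/35 * b^3 - 9/770 * b^2 * c - 13/385 * b * c^2 - 34/5005 * c^3"

lemma tr1_power3_has_integral:
  "((\<lambda>t. tr1 a b c t ^ 3) has_integral tr1_power3_mom a b c) {0..1}"
proof (rule has_integral_eq_horner[where cs =
      "[b^3, - 18 * a * b^2 + 6 * b^2 * c, 108 * a^2 * b + 18 * a * b^2 - 72 * a * b * c - 27 *
        b^3 + 12 * b * c^2, - 216 * a^3 - 216 * a^2 * b + 216 * a^2 * c + 324 * a * b^2 + 72 *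
        a * b * c - 72 * a * c^2 + 24 * b^3 - 144 * b^2 * c + 8 * c^3, 648 * a^3 - 864 * a^2 *
        b - 432 * a^2 * c - 612 * a * b^2 + 1080 * a * b * c + 72 * a * c^2 + 243 * b^3 + 126 *
        b^2 * c - 252 * b * c^2, - 648 * a^3 + 2808 * a^2 * b - 1080 * a^2 * c - 1170 * a * b^2
        - 2016 * a * b * c + 864 * a * c^2 - 432 * b^3 + 1134 * b^2 * c + 216 * b * c^2 - 144 *
        c^3, 216 * a^3 - 2700 * a^2 * b + 3672 * a^2 * c + 4050 * a * b^2 - 2952 * a * b * c -
        1584 * a * c^2 - 537 * b^3 - 1980 * b^2 * c + 1728 * b * c^2 + 120 * c^3, 864 * a^2 * b
        - 3456 * a^2 * c - 3744 * a * b^2 + 10584 * a * b * c - 1872 * a * c^2 + 1944 * b^3 -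
        2052 * b^2 * c - 2952 * b * c^2 + 864 * c^3, 1080 * a^2 * c + 1152 * a * b^2 - 9576 * a
        * b * c + 6912 * a * c^2 - 1728 * b^3 + 7614 * b^2 * c - 2628 * b * c^2 - 1440 * c^3,
        2880 * a * b * c - 6120 * a * c^2 + 512 * b^3 - 6624 * b^2 * c + 9936 * b * c^2 - 1128
        * c^3, 1800 * a * c^2 + 1920 * b^2 * c - 8460 * b * c^2 + 4320 * c^3, 2400 * b * c^2 -
        3600 * c^3, 1000 * c^3]"], goal_cases)
  case 1
  show ?case unfolding tr_def tr1_def tr2_def horner.simps by algebra
next
  case 2
  show ?case by (simp add: tr1_power3_mom_def field_simps)
qed

definition tr1_power4_mom :: "real \<Rightarrow> real \<Rightarrow> real \<Rightarrow> real" where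
  "tr1_power4_mom a b c =
    72/35 * a^4 + 36/35 * a^3 * b - 144/385 * a^3 * c + 654/385 * a^2 * b^2 + 564/385 * a^2 * b
      * c + 552/1001 * a^2 * c^2 + 1/77 * a * b^3 + 102/715 * a * b^2 * c + 120/1001 * a * b *
      c^2 + 8/715 * a * c^3 + 996/5005 * b^4 + 1143/5005 * b^3 * c + 808/5005 * b^2 * c^2 +
      24/385 * b * c^3 + 912/85085 * c^4"

lemma tr1_power4_has_integral:
  "((\<lambda>t. tr1 a b c t ^ 4) has_integral tr1_power4_mom a b c) {0..1}"
proof (rule has_integral_eq_horner[where cs =
      "[b^4, - 24 * a * b^3 + 8 * b^3 * c, 216 * a^2 * b^2 + 24 * a * b^3 - 144 * a * b^2 * c -
        36 * b^4 + 24 * b^2 * c^2, - 864 * a^3 * b - 432 * a^2 * b^2 + 864 * a^2 * b * c + 648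
        * a * b^3 + 144 * a * b^2 * c - 288 * a * b * c^2 + 32 * b^4 - 264 * b^3 * c + 32 * b *
        c^3, 1296 * a^4 + 2592 * a^3 * b - 1728 * a^3 * c - 3672 * a^2 * b^2 - 1728 * a^2 * b *
        c + 864 * a^2 * c^2 - 1224 * a * b^3 + 3456 * a * b^2 * c + 288 * a * b * c^2 - 192 * a
        * c^3 + 486 * b^4 + 232 * b^3 * c - 720 * b^2 * c^2 + 16 * c^4, - 5184 * a^4 + 5184 *
        a^3 * b + 5184 * a^3 * c + 11232 * a^2 * b^2 - 12096 * a^2 * b * c - 1728 * a^2 * c^2 -
        5256 * a * b^3 - 6480 * a * b^2 * c + 6048 * a * b * c^2 + 192 * a * c^3 - 864 * b^4 +
        3240 * b^3 * c + 624 * b^2 * c^2 - 864 * b * c^3, 7776 * a^4 - 29376 * a^3 * b + 5184 *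
        a^3 * c + 6696 * a^2 * b^2 + 37152 * a^2 * b * c - 9504 * a^2 * c^2 + 16200 * a * b^3 -
        24192 * a * b^2 * c - 11232 * a * b * c^2 + 3456 * a * c^3 - 2532 * b^4 - 5688 * b^3 *
        c + 7992 * b^2 * c^2 + 736 * b * c^3 - 384 * c^4, - 5184 * a^4 + 44064 * a^3 * b -
        38016 * a^3 * c - 62640 * a^2 * b^2 + 11232 * a^2 * b * c + 29376 * a^2 * c^2 + 2520 *
        a * b^3 + 74736 * a * b^2 * c - 36288 * a * b * c^2 - 6336 * a * c^3 + 7776 * b^4 -
        15000 * b^3 * c - 13824 * b^2 * c^2 + 8640 * b * c^3 + 320 * c^4, 1296 * a^4 - 28512 *
        a^3 * b + 57024 * a^3 * c + 93528 * a^2 * b^2 - 162432 * a^2 * b * c + 3456 * a^2 * c^2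
        - 59544 * a * b^3 + 1728 * a * b^2 * c + 112320 * a * b * c^2 - 17856 * a * c^3 - 351 *
        b^4 + 46008 * b^3 * c - 32904 * b^2 * c^2 - 14688 * b * c^3 + 3456 * c^4, 6912 * a^3 *
        b - 36288 * a^3 * c - 58752 * a^2 * b^2 + 241920 * a^2 * b * c - 105408 * a^2 * c^2 +
        88128 * a * b^3 - 231984 * a * b^2 * c - 7776 * a * b * c^2 + 55296 * a * c^3 - 21280 *
        b^4 - 5328 * b^3 * c + 100656 * b^2 * c^2 - 31776 * b * c^3 - 5760 * c^4, 8640 * a^3 *
        c + 13824 * a^2 * b^2 - 149472 * a^2 * b * c + 156384 * a^2 * c^2 - 53760 * a * b^3 +
        341712 * a * b^2 * c - 301536 * a * b * c^2 - 7488 * a * c^3 + 31104 * b^4 - 110696 *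
        b^3 * c - 16848 * b^2 * c^2 + 96768 * b * c^3 - 11424 * c^4, 34560 * a^2 * b * c -
        95040 * a^2 * c^2 + 12288 * a * b^3 - 205056 * a * b^2 * c + 441504 * a * b * c^2 -
        130752 * a * c^3 - 18432 * b^4 + 160704 * b^3 * c - 216096 * b^2 * c^2 - 19872 * b *
        c^3 + 34560 * c^4, 21600 * a^2 * c^2 + 46080 * a * b^2 * c - 260640 * a * b * c^2 +
        190080 * a * c^3 + 4096 * b^4 - 93696 * b^3 * c + 311256 * b^2 * c^2 - 187616 * b * c^3
        - 8064 * c^4, 57600 * a * b * c^2 - 110400 * a * c^3 + 20480 * b^3 * c - 178560 * b^2 *
        c^2 + 267840 * b * c^3 - 61120 * c^4, 24000 * a * c^3 + 38400 * b^2 * c^2 - 151200 * b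
        * c^3 + 86400 * c^4, 32000 * b * c^3 - 48000 * c^4, 10000 * c^4]"], goal_cases)
  case 1
  show ?case unfolding tr_def tr1_def tr2_def horner.simps by algebra
next
  case 2
  show ?case by (simp add: tr1_power4_mom_def field_simps)
qed

definition tr2_power2_mom :: "real \<Rightarrow> real \<Rightarrow> real \<Rightarrow> real" where
  "tr2_power2_mom a b c =
    12 * a^2 + 12 * a * b + 36/5 * b^2 + 32/5 * b * c + 132/35 * c^2"

lemma tr2_power2_has_integral:
  "((\<lambda>t. tr2 a b c t ^ 2) has_integral tr2_power2_mom a b c) {0..1}"
proof (rule has_integral_eq_horner[where cs =
      "[36 * a^2 - 24 * a * c + 4 * c^2, - 144 * a^2 + 216 * a * b + 48 * a * c - 72 * b * c,
        144 * a^2 - 720 * a * b + 432 * a * c + 324 * b^2 + 96 * b * c - 144 * c^2, 576 * a * b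
        - 1344 * a * c - 864 * b^2 + 1296 * b * c + 160 * c^2, 960 * a * c + 576 * b^2 - 3168 *
        b * c + 1296 * c^2, 1920 * b * c - 2880 * c^2, 1600 * c^2]"], goal_cases)
  case 1
  show ?case unfolding tr_def tr1_def tr2_def horner.simps by algebra
next
  case 2
  show ?case by (simp add: tr2_power2_mom_def field_simps)
qed

definition tr_power2_mom :: "real \<Rightarrow> real \<Rightarrow> real \<Rightarrow> real" where
  "tr_power2_mom a b c =
    13/35 * a^2 + 6/35 * a * b + 19/315 * a * c + 19/630 * b^2 + 11/420 * b * c + 1/154 * c^2"

lemma tr_power2_has_integral:
  "((\<lambda>t. tr a b c t ^ 2) has_integral tr_power2_mom a b c) {0..1}"
proof (rule has_integral_eq_horner[where cs =
      "[a^2, 2 * a * b, - 6 * a^2 + 2 * a * c + b^2, 4 * a^2 - 12 * a * b + 2 * b * c, 9 * a^2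
        + 8 * a * b - 12 * a * c - 6 * b^2 + c^2, - 12 * a^2 + 18 * a * b + 8 * a * c + 4 * b^2
        - 12 * b * c, 4 * a^2 - 24 * a * b + 18 * a * c + 9 * b^2 + 8 * b * c - 6 * c^2, 8 * a
        * b - 24 * a * c - 12 * b^2 + 18 * b * c + 4 * c^2, 8 * a * c + 4 * b^2 - 24 * b * c +
        9 * c^2, 8 * b * c - 12 * c^2, 4 * c^2]"], goal_cases)
  case 1
  show ?case unfolding tr_def tr1_def tr2_def horner.simps by algebra
next
  case 2
  show ?case by (simp add: tr_power2_mom_def field_simps)
qed

definition tr_power4_mom :: "real \<Rightarrow> real \<Rightarrow> real \<Rightarrow> real" where
  "tr_power4_mom a b c =
    191/715 * a^4 + 906/5005 * a^3 * b + 716/15015 * a^3 * c + 358/5005 * a^2 * b^2 + 237/5005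
      * a^2 * b * c + 774/85085 * a^2 * c^2 + 79/5005 * a * b^3 + 1548/85085 * a * b^2 * c +
      284/36465 * a * b * c^2 + 5858/4849845 * a * c^3 + 129/85085 * b^4 + 284/109395 * b^3 * c
      + 2929/1616615 * b^2 * c^2 + 111/184756 * b * c^3 + 2297/29099070 * c^4"

lemma tr_power4_has_integral:
  "((\<lambda>t. tr a b c t ^ 4) has_integral tr_power4_mom a b c) {0..1}"
proof (rule has_integral_eq_horner[where cs =
      "[a^4, 4 * a^3 * b, - 12 * a^4 + 4 * a^3 * c + 6 * a^2 * b^2, 8 * a^4 - 48 * a^3 * b + 12
        * a^2 * b * c + 4 * a * b^3, 54 * a^4 + 32 * a^3 * b - 48 * a^3 * c - 72 * a^2 * b^2 +
        6 * a^2 * c^2 + 12 * a * b^2 * c + b^4, - 72 * a^4 + 216 * a^3 * b + 32 * a^3 * c + 48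
        * a^2 * b^2 - 144 * a^2 * b * c - 48 * a * b^3 + 12 * a * b * c^2 + 4 * b^3 * c, - 84 *
        a^4 - 288 * a^3 * b + 216 * a^3 * c + 324 * a^2 * b^2 + 96 * a^2 * b * c - 72 * a^2 *
        c^2 + 32 * a * b^3 - 144 * a * b^2 * c + 4 * a * c^3 - 12 * b^4 + 6 * b^2 * c^2, 216 *
        a^4 - 336 * a^3 * b - 288 * a^3 * c - 432 * a^2 * b^2 + 648 * a^2 * b * c + 48 * a^2 *
        c^2 + 216 * a * b^3 + 96 * a * b^2 * c - 144 * a * b * c^2 + 8 * b^4 - 48 * b^3 * c + 4
        * b * c^3, - 63 * a^4 + 864 * a^3 * b - 336 * a^3 * c - 504 * a^2 * b^2 - 864 * a^2 * b
        * c + 324 * a^2 * c^2 - 288 * a * b^3 + 648 * a * b^2 * c + 96 * a * b * c^2 - 48 * a *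
        c^3 + 54 * b^4 + 32 * b^3 * c - 72 * b^2 * c^2 + c^4, - 184 * a^4 - 252 * a^3 * b + 864
        * a^3 * c + 1296 * a^2 * b^2 - 1008 * a^2 * b * c - 432 * a^2 * c^2 - 336 * a * b^3 -
        864 * a * b^2 * c + 648 * a * b * c^2 + 32 * a * c^3 - 72 * b^4 + 216 * b^3 * c + 48 *
        b^2 * c^2 - 48 * b * c^3, 216 * a^4 - 736 * a^3 * b - 252 * a^3 * c - 378 * a^2 * b^2 +
        2592 * a^2 * b * c - 504 * a^2 * c^2 + 864 * a * b^3 - 1008 * a * b^2 * c - 864 * a * b
        * c^2 + 216 * a * c^3 - 84 * b^4 - 288 * b^3 * c + 324 * b^2 * c^2 + 32 * b * c^3 - 12
        * c^4, - 96 * a^4 + 864 * a^3 * b - 736 * a^3 * c - 1104 * a^2 * b^2 - 756 * a^2 * b *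
        c + 1296 * a^2 * c^2 - 252 * a * b^3 + 2592 * a * b^2 * c - 1008 * a * b * c^2 - 288 *
        a * c^3 + 216 * b^4 - 336 * b^3 * c - 432 * b^2 * c^2 + 216 * b * c^3 + 8 * c^4, 16 *
        a^4 - 384 * a^3 * b + 864 * a^3 * c + 1296 * a^2 * b^2 - 2208 * a^2 * b * c - 378 * a^2
        * c^2 - 736 * a * b^3 - 756 * a * b^2 * c + 2592 * a * b * c^2 - 336 * a * c^3 - 63 *
        b^4 + 864 * b^3 * c - 504 * b^2 * c^2 - 288 * b * c^3 + 54 * c^4, 64 * a^3 * b - 384 *
        a^3 * c - 576 * a^2 * b^2 + 2592 * a^2 * b * c - 1104 * a^2 * c^2 + 864 * a * b^3 -
        2208 * a * b^2 * c - 756 * a * b * c^2 + 864 * a * c^3 - 184 * b^4 - 252 * b^3 * c +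
        1296 * b^2 * c^2 - 336 * b * c^3 - 72 * c^4, 64 * a^3 * c + 96 * a^2 * b^2 - 1152 * a^2
        * b * c + 1296 * a^2 * c^2 - 384 * a * b^3 + 2592 * a * b^2 * c - 2208 * a * b * c^2 -
        252 * a * c^3 + 216 * b^4 - 736 * b^3 * c - 378 * b^2 * c^2 + 864 * b * c^3 - 84 * c^4,
        192 * a^2 * b * c - 576 * a^2 * c^2 + 64 * a * b^3 - 1152 * a * b^2 * c + 2592 * a * b
        * c^2 - 736 * a * c^3 - 96 * b^4 + 864 * b^3 * c - 1104 * b^2 * c^2 - 252 * b * c^3 +
        216 * c^4, 96 * a^2 * c^2 + 192 * a * b^2 * c - 1152 * a * b * c^2 + 864 * a * c^3 + 16
        * b^4 - 384 * b^3 * c + 1296 * b^2 * c^2 - 736 * b * c^3 - 63 * c^4, 192 * a * b * c^2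
        - 384 * a * c^3 + 64 * b^3 * c - 576 * b^2 * c^2 + 864 * b * c^3 - 184 * c^4, 64 * a *
        c^3 + 96 * b^2 * c^2 - 384 * b * c^3 + 216 * c^4, 64 * b * c^3 - 96 * c^4, 16 * c^4]"], goal_cases)
  case 1
  show ?case unfolding tr_def tr1_def tr2_def horner.simps by algebra
next
  case 2
  show ?case by (simp add: tr_power4_mom_def field_simps)
qed

definition tr1_power2_tr_power2_mom :: "real \<Rightarrow> real \<Rightarrow> real \<Rightarrow> real" where
  "tr1_power2_tr_power2_mom a b c =
    29/77 * a^4 + 19/770 * a^3 * b - 53/1001 * a^3 * c + 1879/10010 * a^2 * b^2 + 135/2002 *
      a^2 * b * c + 29/2145 * a^2 * c^2 + 527/10010 * a * b^3 + 764/15015 * a * b^2 * c +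
      227/10010 * a * b * c^2 + 31/7735 * a * c^3 + 17/2730 * b^4 + 51/5005 * b^3 * c +
      183/24310 * b^2 * c^2 + 236/85085 * b * c^3 + 668/1616615 * c^4"

lemma tr1_power2_tr_power2_has_integral:
  "((\<lambda>t. tr1 a b c t ^ 2 * tr a b c t ^ 2) has_integral tr1_power2_tr_power2_mom a b c) {0..1}"
proof (rule has_integral_eq_horner[where cs =
      "[a^2 * b^2, - 12 * a^3 * b + 4 * a^2 * b * c + 2 * a * b^3, 36 * a^4 + 12 * a^3 * b - 24
        * a^3 * c - 48 * a^2 * b^2 + 4 * a^2 * c^2 + 10 * a * b^2 * c + b^4, - 72 * a^4 + 252 *
        a^3 * b + 24 * a^3 * c + 44 * a^2 * b^2 - 156 * a^2 * b * c - 60 * a * b^3 + 16 * a * b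
        * c^2 + 6 * b^3 * c, - 180 * a^4 - 468 * a^3 * b + 360 * a^3 * c + 594 * a^2 * b^2 +
        140 * a^2 * b * c - 120 * a^2 * c^2 + 52 * a * b^3 - 264 * a * b^2 * c + 8 * a * c^3 -
        24 * b^4 + 13 * b^2 * c^2, 576 * a^4 - 972 * a^3 * b - 648 * a^3 * c - 1044 * a^2 * b^2
        + 1620 * a^2 * b * c + 104 * a^2 * c^2 + 576 * a * b^3 + 224 * a * b^2 * c - 372 * a *
        b * c^2 + 20 * b^4 - 132 * b^3 * c + 12 * b * c^3, - 180 * a^4 + 3060 * a^3 * b - 1224
        * a^3 * c - 1920 * a^2 * b^2 - 2772 * a^2 * b * c + 1080 * a^2 * c^2 - 972 * a * b^3 +
        2268 * a * b^2 * c + 308 * a * b * c^2 - 168 * a * c^3 + 198 * b^4 + 108 * b^3 * c -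
        264 * b^2 * c^2 + 4 * c^4, - 936 * a^4 - 972 * a^3 * b + 3816 * a^3 * c + 5940 * a^2 *
        b^2 - 4764 * a^2 * b * c - 1800 * a^2 * c^2 - 1644 * a * b^3 - 3744 * a * b^2 * c +
        2916 * a * b * c^2 + 136 * a * c^3 - 324 * b^4 + 1008 * b^3 * c + 212 * b^2 * c^2 - 228
        * b * c^3, 1332 * a^4 - 4572 * a^3 * b - 1224 * a^3 * c - 1899 * a^2 * b^2 + 14580 *
        a^2 * b * c - 2928 * a^2 * c^2 + 5004 * a * b^3 - 6024 * a * b^2 * c - 4716 * a * b *
        c^2 + 1224 * a * c^3 - 516 * b^4 - 1620 * b^3 * c + 1890 * b^2 * c^2 + 180 * b * c^3 -
        72 * c^4, - 720 * a^4 + 6408 * a^3 * b - 5400 * a^3 * c - 8284 * a^2 * b^2 - 4680 * a^2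
        * b * c + 8856 * a^2 * c^2 - 1602 * a * b^3 + 18144 * a * b^2 * c - 7284 * a * b * c^2
        - 1944 * a * c^3 + 1548 * b^4 - 2484 * b^3 * c - 2988 * b^2 * c^2 + 1548 * b * c^3 + 56
        * c^4, 144 * a^4 - 3408 * a^3 * b + 7488 * a^3 * c + 11448 * a^2 * b^2 - 19420 * a^2 *
        b * c - 2844 * a^2 * c^2 - 6596 * a * b^3 - 5814 * a * b^2 * c + 21708 * a * b * c^2 -
        2904 * a * c^3 - 495 * b^4 + 7380 * b^3 * c - 4440 * b^2 * c^2 - 2412 * b * c^3 + 468 *
        c^4, 672 * a^3 * b - 3936 * a^3 * c - 6000 * a^2 * b^2 + 26568 * a^2 * b * c - 11320 *
        a^2 * c^2 + 9000 * a * b^3 - 23008 * a * b^2 * c - 6948 * a * b * c^2 + 8568 * a * c^3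
        - 1948 * b^4 - 2358 * b^3 * c + 13068 * b^2 * c^2 - 3492 * b * c^3 - 720 * c^4, 768 *
        a^3 * c + 1168 * a^2 * b^2 - 13776 * a^2 * b * c + 15336 * a^2 * c^2 - 4656 * a * b^3 +
        31104 * a * b^2 * c - 26596 * a * b * c^2 - 2736 * a * c^3 + 2628 * b^4 - 8988 * b^3 *
        c - 4167 * b^2 * c^2 + 10188 * b * c^3 - 1020 * c^4, 2656 * a^2 * b * c - 7872 * a^2 *
        c^2 + 896 * a * b^3 - 15936 * a * b^2 * c + 35640 * a * b * c^2 - 10184 * a * c^3 -
        1344 * b^4 + 12024 * b^3 * c - 15460 * b^2 * c^2 - 3240 * b * c^3 + 2952 * c^4, 1504 *
        a^2 * c^2 + 3040 * a * b^2 * c - 18096 * a * b * c^2 + 13536 * a * c^3 + 256 * b^4 -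
        6096 * b^3 * c + 20520 * b^2 * c^2 - 11748 * b * c^3 - 936 * c^4, 3424 * a * b * c^2 -
        6816 * a * c^3 + 1152 * b^3 * c - 10320 * b^2 * c^2 + 15480 * b * c^3 - 3328 * c^4,
        1280 * a * c^3 + 1936 * b^2 * c^2 - 7728 * b * c^3 + 4356 * c^4, 1440 * b * c^3 - 2160
        * c^4, 400 * c^4]"], goal_cases)
  case 1
  show ?case unfolding tr_def tr1_def tr2_def horner.simps by algebra
next
  case 2
  show ?case by (simp add: tr1_power2_tr_power2_mom_def field_simps)
qed

definition tr1_mom :: "real \<Rightarrow> real \<Rightarrow> real \<Rightarrow> real" where
  "tr1_mom a b c =
    - a"

lemma tr1_has_integral:
  "((\<lambda>t. tr1 a b c t) has_integral tr1_mom a b c) {0..1}"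
proof (rule has_integral_eq_horner[where cs =
      "[b, - 6 * a + 2 * c, 6 * a - 9 * b, 8 * b - 12 * c, 10 * c]"], goal_cases)
  case 1
  show ?case unfolding tr_def tr1_def tr2_def horner.simps by algebra
next
  case 2
  show ?case by (simp add: tr1_mom_def field_simps)
qed

text \<open>The integrand is the derivative of one third of the cube of \<open>tr\<close>, which
  falls from a^3/3 to 0; hence b and c drop out.\<close>

definition tr1_tr_power2_mom :: "real \<Rightarrow> real \<Rightarrow> real \<Rightarrow> real" where
  "tr1_tr_power2_mom a b c =
    - 1/3 * a^3"

lemma tr1_tr_power2_has_integral:
  "((\<lambda>t. tr1 a b c t * tr a b c t ^ 2) has_integral tr1_tr_power2_mom a b c) {0..1}"
proof (rule has_integral_eq_horner[where cs =
      "[a^2 * b, - 6 * a^3 + 2 * a^2 * c + 2 * a * b^2, 6 * a^3 - 27 * a^2 * b + 6 * a * b * c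
        + b^3, 36 * a^3 + 24 * a^2 * b - 36 * a^2 * c - 36 * a * b^2 + 4 * a * c^2 + 4 * b^2 *
        c, - 60 * a^3 + 135 * a^2 * b + 30 * a^2 * c + 30 * a * b^2 - 90 * a * b * c - 15 * b^3
        + 5 * b * c^2, - 30 * a^3 - 216 * a^2 * b + 162 * a^2 * c + 162 * a * b^2 + 72 * a * b
        * c - 54 * a * c^2 + 12 * b^3 - 54 * b^2 * c + 2 * c^3, 126 * a^3 - 105 * a^2 * b - 252
        * a^2 * c - 252 * a * b^2 + 378 * a * b * c + 42 * a * c^2 + 63 * b^3 + 42 * b^2 * c -
        63 * b * c^2, - 96 * a^3 + 432 * a^2 * b - 120 * a^2 * c - 120 * a * b^2 - 576 * a * b
        * c + 216 * a * c^2 - 96 * b^3 + 216 * b^2 * c + 48 * b * c^2 - 24 * c^3, 24 * a^3 -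
        324 * a^2 * b + 486 * a^2 * c + 486 * a * b^2 - 270 * a * b * c - 324 * a * c^2 - 45 *
        b^3 - 324 * b^2 * c + 243 * b * c^2 + 18 * c^3, 80 * a^2 * b - 360 * a^2 * c - 360 * a
        * b^2 + 1080 * a * b * c - 150 * a * c^2 + 180 * b^3 - 150 * b^2 * c - 360 * b * c^2 +
        90 * c^3, 88 * a^2 * c + 88 * a * b^2 - 792 * a * b * c + 594 * a * c^2 - 132 * b^3 +
        594 * b^2 * c - 165 * b * c^2 - 132 * c^3, 192 * a * b * c - 432 * a * c^2 + 32 * b^3 -
        432 * b^2 * c + 648 * b * c^2 - 60 * c^3, 104 * a * c^2 + 104 * b^2 * c - 468 * b * c^2
        + 234 * c^3, 112 * b * c^2 - 168 * c^3, 40 * c^3]"], goal_cases)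
  case 1
  show ?case unfolding tr_def tr1_def tr2_def horner.simps by algebra
next
  case 2
  show ?case by (simp add: tr1_tr_power2_mom_def field_simps)
qed

text \<open>The cut-off is the case a = 1, b = c = 0. Its first and third powers, and its product
  with the squared derivative, occur for the cut-off alone, so they are computed only in this
  case.\<close>

lemma tr_100_has_integral:
  "((\<lambda>t. tr 1 0 0 t) has_integral 1/2) {0..1}"
proof (rule has_integral_eq_horner[where cs =
      "[1, 0, - 3, 2]"], goal_cases)
  case 1
  show ?case unfolding tr_def tr1_def tr2_def horner.simps by algebra
next
  case 2
  show ?case by (simp add: field_simps)
qed

lemma tr_100_power3_has_integral:
  "((\<lambda>t. tr 1 0 0 t ^ 3) has_integral 43/140) {0..1}"
proof (rule has_integral_eq_horner[where cs =
      "[1, 0, - 9, 6, 27, - 36, - 15, 54, - 36, 8]"], goal_cases)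
  case 1
  show ?case unfolding tr_def tr1_def tr2_def horner.simps by algebra
next
  case 2
  show ?case by (simp add: field_simps)
qed

lemma tr_100_tr1_100_power2_has_integral:
  "((\<lambda>t. tr 1 0 0 t * tr1 1 0 0 t ^ 2) has_integral 3/5) {0..1}"
proof (rule has_integral_eq_horner[where cs =
      "[0, 0, 36, - 72, - 72, 288, - 252, 72]"], goal_cases)
  case 1
  show ?case unfolding tr_def tr1_def tr2_def horner.simps by algebra
next
  case 2
  show ?case by (simp add: field_simps)
qed

section \<open>Integrals of separated functions over the domain\<close>

text \<open>Measurability and boundedness are bundled with the gauge integral so that products of
  two such functions are Lebesgue integrable on rectangles, while the value comes from calculus on
  the line.\<close>

definition has_moment :: "real \<Rightarrow> (real \<Rightarrow> real) \<Rightarrow> real \<Rightarrow> bool" where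
  "has_moment L f I \<longleftrightarrow>
     f \<in> borel_measurable borel \<and> (\<exists>M. \<forall>x. \<bar>f x\<bar> \<le> M) \<and> (f has_integral I) {-L..L}"

lemma has_moment_const:
  assumes "L > 0"
  shows "has_moment L (\<lambda>_. c) (2 * L * c)"
  using assms has_integral_const_real[of c "-L" L] by (auto simp: has_moment_def)

lemma has_moment_profile:
  assumes f: "\<And>x. f x = profile m p q r x" and "0 < m" "1 + m \<le> L"
    and c: "continuous_on UNIV p" "continuous_on UNIV q" "continuous_on UNIV r"
    and int: "(p has_integral P) {0..1}" "(q has_integral Q) {0..1}" "(r has_integral R) {-1..1}"
    and I: "m * P + m * Q + R = I"
  shows "has_moment L f I"
proof -
  have "f = profile m p q r"
    using f by (rule ext)
  then show ?thesis
    unfolding has_moment_def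
    using profile_measurable[OF c] profile_bounded[OF \<open>0 < m\<close> c]
      profile_has_integral[OF \<open>0 < m\<close> \<open>1 + m \<le> L\<close> int] I by simp
qed

lemma integrable_indicator_bounded:
  fixes f :: "'a::euclidean_space \<Rightarrow> real"
  assumes "f \<in> borel_measurable borel" "\<And>x. \<bar>f x\<bar> \<le> M" "S \<in> sets borel" "bounded S"
  shows "integrable lborel (\<lambda>x. indicat_real S x * f x)"
proof (rule integrableI_bounded_set[where A = S and B = M])
  show "emeasure lborel S < \<infinity>"
    by (rule emeasure_bounded_finite[OF assms(4)])
  show "(\<lambda>x. indicat_real S x * f x) \<in> borel_measurable lborel"
    using assms(1,3) by measurable
qed (use assms(2,3) in auto)

lemma has_moment_lborel:
  assumes "has_moment L f I"
  shows "(LINT x|lborel. indicat_real {-L<..<L} x * f x) = I"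
proof -
  obtain M where M: "\<And>x. \<bar>f x\<bar> \<le> M"
    using assms by (auto simp: has_moment_def)
  have f: "f \<in> borel_measurable borel" "(f has_integral I) {-L..L}"
    using assms by (auto simp: has_moment_def)
  have "integrable lborel (\<lambda>x. indicat_real {-L<..<L} x * f x)"
    by (rule integrable_indicator_bounded[OF f(1) M]) auto
  then have "((\<lambda>x. indicat_real {-L<..<L} x * f x) has_integral
      (LINT x|lborel. indicat_real {-L<..<L} x * f x)) UNIV"
    by (rule has_integral_integral_lborel)
  moreover have "((\<lambda>x. indicat_real {-L<..<L} x * f x) has_integral I) UNIV"
  proof -
    have "(f has_integral I) {-L<..<L}"
      using f(2) by (simp add: has_integral_Icc_iff_Ioo)
    then have "((\<lambda>x. if x \<in> {-L<..<L} then f x else 0) has_integral I) UNIV"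
      by (simp only: has_integral_restrict_UNIV)
    moreover have "(\<lambda>x. if x \<in> {-L<..<L} then f x else 0) = (\<lambda>x. indicat_real {-L<..<L} x * f x)"
      by (auto simp: indicator_def)
    ultimately show ?thesis
      by simp
  qed
  ultimately show ?thesis
    by (rule has_integral_unique)
qed

text \<open>The indicator of the rectangle factorises as well, so Fubini's theorem splits the
  integral into the two moments.\<close>

lemma has_bochner_integral_product:
  assumes a: "has_moment R a A" and b: "has_moment h b B"
  shows "has_bochner_integral lborel (\<lambda>z. indicat_real (QR h R) z * (a (fst z) * b (snd z))) (A * B)"
proof -
  let ?F = "\<lambda>z. indicat_real (QR h R) z * (a (fst z) * b (snd z))"
  obtain M N where M: "\<And>x. \<bar>a x\<bar> \<le> M" and N: "\<And>x. \<bar>b x\<bar> \<le> N"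
    using a b by (auto simp: has_moment_def)
  have "M \<ge> 0"
    using M[of 0] by simp
  have ab: "\<bar>a x * b y\<bar> \<le> M * N" for x y
    unfolding abs_mult using M N \<open>M \<ge> 0\<close> by (intro mult_mono) auto
  have m: "a \<in> borel_measurable borel" "b \<in> borel_measurable borel"
    using a b by (auto simp: has_moment_def)
  note [measurable] = m[THEN measurable_fst_borel[where 'b=real]]
    m[THEN measurable_snd_borel[where 'a=real]]
  have Q: "open (QR h R)" "bounded (QR h R)"
    unfolding QR_def by (auto intro!: open_Times bounded_Times)
  have F: "integrable lborel ?F"
    by (rule integrable_indicator_bounded[where M = "M * N"]) (use ab Q in \<open>auto intro: borel_open\<close>)
  have ind: "?F (x, y) = (indicat_real {-R<..<R} x * a x) * (indicat_real {-h<..<h} y * b y)" for x y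
    by (simp add: QR_def indicator_times)
  have split: "case_prod (\<lambda>x y. ?F (x, y)) = ?F"
    by (rule ext) (simp add: split_beta)
  have "integrable (lborel \<Otimes>\<^sub>M lborel) (case_prod (\<lambda>x y. ?F (x, y)))"
    using F by (simp only: split lborel_prod)
  from lborel_pair.integral_fst[OF this]
  have "(LINT z|lborel. ?F z) = (LINT x|lborel. LINT y|lborel. ?F (x, y))"
    by (simp only: split lborel_prod)
  also have "\<dots> = A * B"
    unfolding ind using has_moment_lborel[OF a] has_moment_lborel[OF b] by simp
  finally show ?thesis
    using F by (simp add: has_bochner_integral_iff)
qed

lemma open_Omega: "open (Omega h R)"
proof -
  have "open (QR h R)"
    unfolding QR_def by (intro open_Times) auto
  then show ?thesis
    unfolding Omega_def by (intro open_Diff) auto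
qed

lemma bounded_Omega: "bounded (Omega h R)"
proof (rule bounded_subset)
  show "bounded (QR h R)"
    unfolding QR_def by (auto intro!: bounded_Times)
qed (auto simp: Omega_def)

text \<open>A function that vanishes on the closed disk does not see the hole, so its integral over
  the domain is that over the rectangle.\<close>

lemma has_bochner_integral_Omega:
  fixes F :: "real \<times> real \<Rightarrow> real"
  assumes F: "F \<in> borel_measurable borel" and zero: "\<And>z. norm z \<le> 1 \<Longrightarrow> F z = 0"
    and int: "has_bochner_integral lborel (\<lambda>z. indicat_real (QR h R) z * F z) I"
  shows "has_bochner_integral (lebesgue_on (Omega h R)) F I"
proof -
  have sets: "Omega h R \<in> sets borel"
    using open_Omega by (rule borel_open)
  have eq: "indicat_real (Omega h R) z * F z = indicat_real (QR h R) z * F z" for z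
    using zero[of z] by (cases "norm z \<le> 1") (auto simp: Omega_def indicator_def dist_norm)
  have "integrable lborel (\<lambda>z. indicat_real (Omega h R) z * F z)"
    "(LINT z|lborel. indicat_real (Omega h R) z * F z) = I"
    using int unfolding eq by (auto simp: has_bochner_integral_iff)
  moreover have "(\<lambda>z. indicat_real (Omega h R) z * F z) \<in> borel_measurable lborel"
    using F sets by measurable
  ultimately have "has_bochner_integral lebesgue (\<lambda>z. indicat_real (Omega h R) z * F z) I"
    by (simp add: has_bochner_integral_iff integrable_completion integral_completion)
  then show ?thesis
    using sets by (subst has_bochner_integral_restrict_space) auto
qed

section \<open>The cut-off and the stream profile\<close>

lemma continuous_on_tr:
  "continuous_on S (tr a b c)" "continuous_on S (tr1 a b c)" "continuous_on S (tr2 a b c)"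
  unfolding tr_def[abs_def] tr1_def[abs_def] tr2_def[abs_def] by (intro continuous_intros)+

text \<open>These are the junction conditions. With b = 0 the cut-off leaves the central interval
  with slope 0; with b = m the stream profile leaves it with slope b/m = 1, that of y + s. Both
  arrive at 0 with slope 0, so both are continuously differentiable.\<close>

lemma tr_endpoints: "tr a b c 0 = a" "tr a b c 1 = 0" "tr1 a b c 0 = b" "tr1 a b c 1 = 0"
  by (simp_all add: tr_def tr1_def)

definition chi :: "real \<Rightarrow> real \<Rightarrow> real" where
  "chi m = profile m (tr 1 0 0) (tr 1 0 0) (\<lambda>_. 1)"

definition chi1 :: "real \<Rightarrow> real \<Rightarrow> real" where
  "chi1 m = profile m (\<lambda>t. tr1 1 0 0 t / m) (\<lambda>t. - tr1 1 0 0 t / m) (\<lambda>_. 0)"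

definition chi2 :: "real \<Rightarrow> real \<Rightarrow> real" where
  "chi2 m = profile m (\<lambda>t. tr2 1 0 0 t / m^2) (\<lambda>t. tr2 1 0 0 t / m^2) (\<lambda>_. 0)"

text \<open>For y < 0 the quadratic factor -(1 + m t + c t^2) + s equals -((1 - s) + m t + c t^2).
  Reflection therefore turns s into -s and changes the sign.\<close>

definition str :: "real \<Rightarrow> real \<Rightarrow> real \<Rightarrow> real \<Rightarrow> real" where
  "str m c s = profile m (tr (1 + s) m c) (\<lambda>t. - tr (1 - s) m c t) (\<lambda>y. y + s)"

definition str1 :: "real \<Rightarrow> real \<Rightarrow> real \<Rightarrow> real \<Rightarrow> real" where
  "str1 m c s = profile m (\<lambda>t. tr1 (1 + s) m c t / m) (\<lambda>t. tr1 (1 - s) m c t / m) (\<lambda>_. 1)"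

definition str2 :: "real \<Rightarrow> real \<Rightarrow> real \<Rightarrow> real \<Rightarrow> real" where
  "str2 m c s = profile m (\<lambda>t. tr2 (1 + s) m c t / m^2) (\<lambda>t. - tr2 (1 - s) m c t / m^2) (\<lambda>_. 0)"

lemma piecewise_derivative_chi:
  assumes "m > 0"
  shows "piecewise_derivative (chi m) (chi1 m)"
  unfolding chi_def chi1_def
  by (rule profile_piecewise_derivative[OF assms])
    (simp_all add: tr_endpoints tr_derivative continuous_on_tr)

lemma piecewise_derivative_chi1:
  assumes "m > 0"
  shows "piecewise_derivative (chi1 m) (chi2 m)"
proof -
  have "piecewise_derivative (profile m (\<lambda>t. tr1 1 0 0 t / m) (\<lambda>t. - tr1 1 0 0 t / m) (\<lambda>_. 0))
    (profile m (\<lambda>t. (tr2 1 0 0 t / m) / m) (\<lambda>t. - (- tr2 1 0 0 t / m) / m) (\<lambda>_. 0))"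
    by (rule profile_piecewise_derivative[OF assms])
      (use assms in \<open>auto simp: tr_endpoints intro!: DERIV_cdivide DERIV_minus tr1_derivative
        continuous_intros continuous_on_tr\<close>)
  then show ?thesis
    by (simp add: chi1_def chi2_def power2_eq_square)
qed

lemma piecewise_derivative_str:
  assumes "m > 0"
  shows "piecewise_derivative (str m c s) (str1 m c s)"
proof -
  have "piecewise_derivative (profile m (tr (1 + s) m c) (\<lambda>t. - tr (1 - s) m c t) (\<lambda>y. y + s))
    (profile m (\<lambda>t. tr1 (1 + s) m c t / m) (\<lambda>t. - (- tr1 (1 - s) m c t) / m) (\<lambda>_. 1))"
    by (rule profile_piecewise_derivative[OF assms])
      (auto simp: tr_endpoints DERIV_cong[OF DERIV_add[OF DERIV_ident DERIV_const]]
        intro!: DERIV_minus tr_derivative continuous_intros continuous_on_tr)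
  then show ?thesis
    by (simp add: str_def str1_def)
qed

lemma piecewise_derivative_str1:
  assumes "m > 0"
  shows "piecewise_derivative (str1 m c s) (str2 m c s)"
proof -
  have "piecewise_derivative (profile m (\<lambda>t. tr1 (1 + s) m c t / m) (\<lambda>t. tr1 (1 - s) m c t / m) (\<lambda>_. 1))
    (profile m (\<lambda>t. (tr2 (1 + s) m c t / m) / m) (\<lambda>t. - (tr2 (1 - s) m c t / m) / m) (\<lambda>_. 0))"
    by (rule profile_piecewise_derivative[OF assms])
      (use assms in \<open>auto simp: tr_endpoints intro!: DERIV_cdivide tr1_derivative continuous_intros
        continuous_on_tr\<close>)
  then show ?thesis
    by (simp add: str1_def str2_def power2_eq_square)
qed

section \<open>Moments of the cut-off and of the stream profile\<close>

lemma has_integral_const_unit: "((\<lambda>_::real. c) has_integral 2 * c) {-1..1}" for c :: real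
  using has_integral_const_real[of c "-1" 1] by simp

lemma has_integral_shift_power:
  fixes s :: real
  shows "((\<lambda>y. (y + s) ^ n) has_integral ((1 + s) ^ Suc n - (s - 1) ^ Suc n) / real (Suc n)) {-1..1}"
proof -
  have "((\<lambda>y. (y + s) ^ n) has_integral
      (1 + s) ^ Suc n / real (Suc n) - (-1 + s) ^ Suc n / real (Suc n)) {-1..1}"
  proof (rule fundamental_theorem_of_calculus)
    fix y :: real
    have "((\<lambda>y. y + s) has_real_derivative 1) (at y within {-1..1})"
      by (auto intro!: derivative_eq_intros)
    from DERIV_cdivide[OF DERIV_power[OF this, of "Suc n"], of "real (Suc n)"]
    show "((\<lambda>y. (y + s) ^ Suc n / real (Suc n)) has_vector_derivative (y + s) ^ n) (at y within {-1..1})"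
      by (simp add: has_real_derivative_iff_has_vector_derivative del: power_Suc of_nat_Suc)
  qed simp
  then show ?thesis
    by (simp add: diff_divide_distrib del: power_Suc of_nat_Suc)
qed

context
  fixes m L :: real
  assumes mL: "0 < m" "1 + m \<le> L"
begin

text \<open>The half-length L is kept general because the factors in x are integrated up to R and
  those in y up to h.\<close>

lemma chi_moments:
  "has_moment L (chi m) (2 + m)"
  "has_moment L (\<lambda>x. chi m x ^ 2) (2 + 26/35 * m)"
  "has_moment L (\<lambda>x. chi m x ^ 3) (2 + 43/70 * m)"
  "has_moment L (\<lambda>x. chi m x ^ 4) (2 + 382/715 * m)"
proof -
  have tr: "((\<lambda>t. tr 1 0 0 t ^ 2) has_integral 13/35) {0..1}"
    "((\<lambda>t. tr 1 0 0 t ^ 4) has_integral 191/715) {0..1}"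
    using tr_power2_has_integral[of 1 0 0] tr_power4_has_integral[of 1 0 0]
    by (simp_all add: tr_power2_mom_def tr_power4_mom_def)
  have one: "((\<lambda>_::real. 1 ^ n) has_integral (2::real)) {-1..1}" for n
    using has_integral_const_unit[of 1] by simp
  show "has_moment L (chi m) (2 + m)"
    by (rule has_moment_profile[OF _ mL _ _ _ tr_100_has_integral tr_100_has_integral one[of 1]])
      (auto simp: chi_def intro!: continuous_intros continuous_on_tr)
  show "has_moment L (\<lambda>x. chi m x ^ 2) (2 + 26/35 * m)"
    by (rule has_moment_profile[OF _ mL _ _ _ tr(1) tr(1) one[of 2]])
      (auto simp: chi_def profile_power intro!: continuous_intros continuous_on_tr)
  show "has_moment L (\<lambda>x. chi m x ^ 3) (2 + 43/70 * m)"
    by (rule has_moment_profile[OF _ mL _ _ _ tr_100_power3_has_integral tr_100_power3_has_integral one[of 3]])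
      (auto simp: chi_def profile_power intro!: continuous_intros continuous_on_tr)
  show "has_moment L (\<lambda>x. chi m x ^ 4) (2 + 382/715 * m)"
    by (rule has_moment_profile[OF _ mL _ _ _ tr(2) tr(2) one[of 4]])
      (auto simp: chi_def profile_power intro!: continuous_intros continuous_on_tr)
qed

text \<open>Each derivative costs a factor 1/m and the length of a transition layer gives back one
  m. The first derivative enters only in even powers, so its opposite sign on the left does not
  matter and both layers contribute equally.\<close>

lemma chi_derivative_moments:
  "has_moment L (\<lambda>x. chi1 m x ^ 2) (12/5 / m)"
  "has_moment L (\<lambda>x. chi1 m x ^ 4) (144/35 / m^3)"
  "has_moment L (\<lambda>x. chi m x * chi1 m x ^ 2) (6/5 / m)"
  "has_moment L (\<lambda>x. chi m x ^ 2 * chi1 m x ^ 2) (58/77 / m)"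
  "has_moment L (\<lambda>x. chi2 m x ^ 2) (24 / m^3)"
proof -
  note cont = continuous_intros continuous_on_tr
  have zero: "((\<lambda>_::real. 0) has_integral (0::real)) {-1..1}"
    by simp
  have "((\<lambda>t. tr1 1 0 0 t ^ 2) has_integral 6/5) {0..1}"
    "((\<lambda>t. tr1 1 0 0 t ^ 4) has_integral 72/35) {0..1}"
    "((\<lambda>t. tr2 1 0 0 t ^ 2) has_integral 12) {0..1}"
    "((\<lambda>t. tr 1 0 0 t ^ 2 * tr1 1 0 0 t ^ 2) has_integral 29/77) {0..1}"
    using tr1_power2_has_integral[of 1 0 0] tr1_power4_has_integral[of 1 0 0]
      tr2_power2_has_integral[of 1 0 0] tr1_power2_tr_power2_has_integral[of 1 0 0]
    by (simp_all add: tr1_power2_mom_def tr1_power4_mom_def tr2_power2_mom_def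
        tr1_power2_tr_power2_mom_def mult.commute)
  from has_integral_divide[OF this(1), of "m^2"] has_integral_divide[OF this(2), of "m^4"]
    has_integral_divide[OF this(3), of "(m^2)^2"] has_integral_divide[OF this(4), of "m^2"]
    has_integral_divide[OF tr_100_tr1_100_power2_has_integral, of "m^2"]
  have int: "((\<lambda>t. tr1 1 0 0 t ^ 2 / m^2) has_integral 6/5 / m^2) {0..1}"
    "((\<lambda>t. tr1 1 0 0 t ^ 4 / m^4) has_integral 72/35 / m^4) {0..1}"
    "((\<lambda>t. tr2 1 0 0 t ^ 2 / (m^2)^2) has_integral 12 / (m^2)^2) {0..1}"
    "((\<lambda>t. tr 1 0 0 t ^ 2 * tr1 1 0 0 t ^ 2 / m^2) has_integral 29/77 / m^2) {0..1}"
    "((\<lambda>t. tr 1 0 0 t * tr1 1 0 0 t ^ 2 / m^2) has_integral 3/5 / m^2) {0..1}"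
    by simp_all
  have val: "m * (6/5 / m^2) + m * (6/5 / m^2) + 0 = 12/5 / m"
    "m * (72/35 / m^4) + m * (72/35 / m^4) + 0 = 144/35 / m^3"
    "m * (3/5 / m^2) + m * (3/5 / m^2) + 0 = 6/5 / m"
    "m * (29/77 / m^2) + m * (29/77 / m^2) + 0 = 58/77 / m"
    "m * (12 / (m^2)^2) + m * (12 / (m^2)^2) + 0 = 24 / m^3"
    using mL(1) by (simp_all add: field_simps eval_nat_numeral)
  show "has_moment L (\<lambda>x. chi1 m x ^ 2) (12/5 / m)"
    by (rule has_moment_profile[OF _ mL _ _ _ int(1) int(1) zero val(1)])
      (use mL in \<open>auto simp: chi_def chi1_def chi2_def profile_power profile_mult power_divide
        intro!: cont\<close>)
  show "has_moment L (\<lambda>x. chi1 m x ^ 4) (144/35 / m^3)"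
    by (rule has_moment_profile[OF _ mL _ _ _ int(2) int(2) zero val(2)])
      (use mL in \<open>auto simp: chi_def chi1_def chi2_def profile_power profile_mult power_divide
        intro!: cont\<close>)
  show "has_moment L (\<lambda>x. chi m x * chi1 m x ^ 2) (6/5 / m)"
    by (rule has_moment_profile[OF _ mL _ _ _ int(5) int(5) zero val(3)])
      (use mL in \<open>auto simp: chi_def chi1_def chi2_def profile_power profile_mult power_divide
        intro!: cont\<close>)
  show "has_moment L (\<lambda>x. chi m x ^ 2 * chi1 m x ^ 2) (58/77 / m)"
    by (rule has_moment_profile[OF _ mL _ _ _ int(4) int(4) zero val(4)])
      (use mL in \<open>auto simp: chi_def chi1_def chi2_def profile_power profile_mult power_divide
        intro!: cont\<close>)
  show "has_moment L (\<lambda>x. chi2 m x ^ 2) (24 / m^3)"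
    by (rule has_moment_profile[OF _ mL _ _ _ int(3) int(3) zero val(5)])
      (use mL in \<open>auto simp: chi_def chi1_def chi2_def profile_power profile_mult power_divide
        intro!: cont\<close>)
qed

lemma str_moments:
  "has_moment L (\<lambda>y. str m c s y ^ 2)
    (m * tr_power2_mom (1 + s) m c + m * tr_power2_mom (1 - s) m c + (2/3 + 2 * s^2))"
  "has_moment L (\<lambda>y. str m c s y ^ 4)
    (m * tr_power4_mom (1 + s) m c + m * tr_power4_mom (1 - s) m c + (2/5 + 4 * s^2 + 2 * s^4))"
proof -
  have shift: "((\<lambda>y. (y + s) ^ 2) has_integral 2/3 + 2 * s^2) {-1..1}"
    "((\<lambda>y. (y + s) ^ 4) has_integral 2/5 + 4 * s^2 + 2 * s^4) {-1..1}"
    using has_integral_shift_power[of s 2] has_integral_shift_power[of s 4]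
    by (simp_all add: field_simps eval_nat_numeral)
  show "has_moment L (\<lambda>y. str m c s y ^ 2)
    (m * tr_power2_mom (1 + s) m c + m * tr_power2_mom (1 - s) m c + (2/3 + 2 * s^2))"
    by (rule has_moment_profile[OF _ mL _ _ _ tr_power2_has_integral tr_power2_has_integral shift(1)])
      (auto simp: str_def profile_power intro!: continuous_intros continuous_on_tr)
  show "has_moment L (\<lambda>y. str m c s y ^ 4)
    (m * tr_power4_mom (1 + s) m c + m * tr_power4_mom (1 - s) m c + (2/5 + 4 * s^2 + 2 * s^4))"
    by (rule has_moment_profile[OF _ mL _ _ _ tr_power4_has_integral tr_power4_has_integral shift(2)])
      (auto simp: str_def profile_power intro!: continuous_intros continuous_on_tr)
qed

text \<open>The two zero moments express that k' and k' k^2 are the derivatives of k and k^3/3,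
  which vanish at both ends.\<close>

lemma str_derivative_moments:
  "has_moment L (str1 m c s) 0"
  "has_moment L (\<lambda>y. str1 m c s y ^ 2)
    ((tr1_power2_mom (1 + s) m c + tr1_power2_mom (1 - s) m c) / m + 2)"
  "has_moment L (\<lambda>y. str1 m c s y ^ 3)
    ((tr1_power3_mom (1 + s) m c + tr1_power3_mom (1 - s) m c) / m^2 + 2)"
  "has_moment L (\<lambda>y. str1 m c s y ^ 4)
    ((tr1_power4_mom (1 + s) m c + tr1_power4_mom (1 - s) m c) / m^3 + 2)"
  "has_moment L (\<lambda>y. str1 m c s y * str m c s y ^ 2) 0"
  "has_moment L (\<lambda>y. str1 m c s y ^ 2 * str m c s y ^ 2)
    ((tr1_power2_tr_power2_mom (1 + s) m c + tr1_power2_tr_power2_mom (1 - s) m c) / m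
      + (2/3 + 2 * s^2))"
  "has_moment L (\<lambda>y. str2 m c s y ^ 2)
    ((tr2_power2_mom (1 + s) m c + tr2_power2_mom (1 - s) m c) / m^3)"
proof -
  note cont = continuous_intros continuous_on_tr
  have shift: "((\<lambda>y. 1 ^ n * (y + s) ^ 2) has_integral 2/3 + 2 * s^2) {-1..1}" for n
    using has_integral_shift_power[of s 2] by (simp add: field_simps eval_nat_numeral)
  have one: "((\<lambda>_::real. 1 ^ n) has_integral (2::real)) {-1..1}" for n
    using has_integral_const_unit[of 1] by simp
  have zero: "((\<lambda>_::real. 0) has_integral (0::real)) {-1..1}"
    by simp
  have D1: "((\<lambda>t. tr1 a m c t / m) has_integral tr1_mom a m c / m) {0..1}" for a
    by (rule has_integral_divide[OF tr1_has_integral])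
  have D: "((\<lambda>t. tr1 a m c t ^ 2 / m^2) has_integral tr1_power2_mom a m c / m^2) {0..1}"
    "((\<lambda>t. tr1 a m c t ^ 3 / m^3) has_integral tr1_power3_mom a m c / m^3) {0..1}"
    "((\<lambda>t. tr1 a m c t ^ 4 / m^4) has_integral tr1_power4_mom a m c / m^4) {0..1}"
    "((\<lambda>t. tr2 a m c t ^ 2 / (m^2)^2) has_integral tr2_power2_mom a m c / (m^2)^2) {0..1}"
    "((\<lambda>t. tr1 a m c t * tr a m c t ^ 2 / m) has_integral tr1_tr_power2_mom a m c / m) {0..1}"
    "((\<lambda>t. tr1 a m c t ^ 2 * tr a m c t ^ 2 / m^2) has_integral
      tr1_power2_tr_power2_mom a m c / m^2) {0..1}" for a
    by (intro has_integral_divide tr1_power2_has_integral tr1_power3_has_integral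
        tr1_power4_has_integral tr2_power2_has_integral tr1_tr_power2_has_integral
        tr1_power2_tr_power2_has_integral)+
  have "m * (tr1_mom (1 + s) m c / m) + m * (tr1_mom (1 - s) m c / m) + 2 = 0"
    using mL(1) by (simp add: tr1_mom_def)
  then show "has_moment L (str1 m c s) 0"
    by (intro has_moment_profile[OF _ mL _ _ _ D1 D1 one[of 1]])
      (use mL in \<open>auto simp: str1_def intro!: cont\<close>)
  have "m * (tr1_power2_mom (1 + s) m c / m^2) + m * (tr1_power2_mom (1 - s) m c / m^2) + 2
      = (tr1_power2_mom (1 + s) m c + tr1_power2_mom (1 - s) m c) / m + 2"
    using mL(1) by (simp add: field_simps power2_eq_square)
  then show "has_moment L (\<lambda>y. str1 m c s y ^ 2)
      ((tr1_power2_mom (1 + s) m c + tr1_power2_mom (1 - s) m c) / m + 2)"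
    by (intro has_moment_profile[OF _ mL _ _ _ D(1) D(1) one[of 2]])
      (use mL in \<open>auto simp: str1_def profile_power power_divide intro!: cont\<close>)
  have "m * (tr1_power3_mom (1 + s) m c / m^3) + m * (tr1_power3_mom (1 - s) m c / m^3) + 2
      = (tr1_power3_mom (1 + s) m c + tr1_power3_mom (1 - s) m c) / m^2 + 2"
    using mL(1) by (simp add: field_simps eval_nat_numeral)
  then show "has_moment L (\<lambda>y. str1 m c s y ^ 3)
      ((tr1_power3_mom (1 + s) m c + tr1_power3_mom (1 - s) m c) / m^2 + 2)"
    by (intro has_moment_profile[OF _ mL _ _ _ D(2) D(2) one[of 3]])
      (use mL in \<open>auto simp: str1_def profile_power power_divide intro!: cont\<close>)
  have "m * (tr1_power4_mom (1 + s) m c / m^4) + m * (tr1_power4_mom (1 - s) m c / m^4) + 2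
      = (tr1_power4_mom (1 + s) m c + tr1_power4_mom (1 - s) m c) / m^3 + 2"
    using mL(1) by (simp add: field_simps eval_nat_numeral)
  then show "has_moment L (\<lambda>y. str1 m c s y ^ 4)
      ((tr1_power4_mom (1 + s) m c + tr1_power4_mom (1 - s) m c) / m^3 + 2)"
    by (intro has_moment_profile[OF _ mL _ _ _ D(3) D(3) one[of 4]])
      (use mL in \<open>auto simp: str1_def profile_power power_divide intro!: cont\<close>)
  have "m * (tr1_tr_power2_mom (1 + s) m c / m) + m * (tr1_tr_power2_mom (1 - s) m c / m)
      + (2/3 + 2 * s^2) = 0"
    using mL(1) by (simp add: tr1_tr_power2_mom_def field_simps eval_nat_numeral)
  then show "has_moment L (\<lambda>y. str1 m c s y * str m c s y ^ 2) 0"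
    by (intro has_moment_profile[OF _ mL _ _ _ D(5) D(5) shift[of 1]])
      (use mL in \<open>auto simp: str_def str1_def profile_power profile_mult intro!: cont\<close>)
  have "m * (tr1_power2_tr_power2_mom (1 + s) m c / m^2)
      + m * (tr1_power2_tr_power2_mom (1 - s) m c / m^2) + (2/3 + 2 * s^2)
      = (tr1_power2_tr_power2_mom (1 + s) m c + tr1_power2_tr_power2_mom (1 - s) m c) / m
        + (2/3 + 2 * s^2)"
    using mL(1) by (simp add: field_simps power2_eq_square)
  then show "has_moment L (\<lambda>y. str1 m c s y ^ 2 * str m c s y ^ 2)
      ((tr1_power2_tr_power2_mom (1 + s) m c + tr1_power2_tr_power2_mom (1 - s) m c) / m
        + (2/3 + 2 * s^2))"
    by (intro has_moment_profile[OF _ mL _ _ _ D(6) D(6) shift[of 2]])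
      (use mL in \<open>auto simp: str_def str1_def profile_power profile_mult power_divide intro!: cont\<close>)
  have "m * (tr2_power2_mom (1 + s) m c / (m^2)^2) + m * (tr2_power2_mom (1 - s) m c / (m^2)^2) + 0
      = (tr2_power2_mom (1 + s) m c + tr2_power2_mom (1 - s) m c) / m^3"
    using mL(1) by (simp add: field_simps eval_nat_numeral)
  then show "has_moment L (\<lambda>y. str2 m c s y ^ 2)
      ((tr2_power2_mom (1 + s) m c + tr2_power2_mom (1 - s) m c) / m^3)"
    by (intro has_moment_profile[OF _ mL _ _ _ D(4) D(4) zero])
      (use mL in \<open>auto simp: str2_def profile_power power_divide intro!: cont\<close>)
qed

end

section \<open>The vector field\<close>

text \<open>In both energies each summand is a moment of the cut-off in \<open>x\<close> times a moment of the stream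
  profile in \<open>y\<close>.\<close>

definition grad_energy :: "real \<Rightarrow> real \<Rightarrow> real \<Rightarrow> real" where
  "grad_energy m c s =
    2 * (12/5 / m * ((tr1_power2_mom (1 + s) m c + tr1_power2_mom (1 - s) m c) / m + 2))
    + (2 + 26/35 * m) * ((tr2_power2_mom (1 + s) m c + tr2_power2_mom (1 - s) m c) / m^3)
    + 24 / m^3 * (m * tr_power2_mom (1 + s) m c + m * tr_power2_mom (1 - s) m c + (2/3 + 2 * s^2))"

definition quartic_energy :: "real \<Rightarrow> real \<Rightarrow> real \<Rightarrow> real" where
  "quartic_energy m c s =
    6 * ((2 + 26/35 * m) * ((tr1_power2_mom (1 + s) m c + tr1_power2_mom (1 - s) m c) / m + 2))
    - 4 * ((2 + 43/70 * m) * ((tr1_power3_mom (1 + s) m c + tr1_power3_mom (1 - s) m c) / m^2 + 2))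
    + (2 + 382/715 * m) * ((tr1_power4_mom (1 + s) m c + tr1_power4_mom (1 - s) m c) / m^3 + 2)
    + 2 * (12/5 / m * (m * tr_power2_mom (1 + s) m c + m * tr_power2_mom (1 - s) m c + (2/3 + 2 * s^2)))
    + 2 * (58/77 / m * ((tr1_power2_tr_power2_mom (1 + s) m c + tr1_power2_tr_power2_mom (1 - s) m c) / m
        + (2/3 + 2 * s^2)))
    + 144/35 / m^3 * (m * tr_power4_mom (1 + s) m c + m * tr_power4_mom (1 - s) m c
        + (2/5 + 4 * s^2 + 2 * s^4))"

lemma piecewise_derivative_scale:
  "piecewise_derivative a a' \<Longrightarrow> piecewise_derivative (\<lambda>x. a x * d) (\<lambda>x. a' x * d)"
  using piecewise_derivative_affine[of a a' 0 d] by simp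

section \<open>Traces on the two boundary curves\<close>

lemma frontier_QR:
  assumes "0 < h" "0 < R" "(x, y) \<in> frontier (QR h R)"
  shows "\<bar>x\<bar> \<le> R" "\<bar>y\<bar> \<le> h" "\<bar>x\<bar> = R \<or> \<bar>y\<bar> = h"
proof -
  have "open (QR h R)"
    unfolding QR_def by (intro open_Times) auto
  then have "frontier (QR h R) = {-R..R} \<times> {-h..h} - {-R<..<R} \<times> {-h<..<h}"
    using assms(1,2) unfolding frontier_def by (simp add: interior_open QR_def closure_Times)
  then show "\<bar>x\<bar> \<le> R" "\<bar>y\<bar> \<le> h" "\<bar>x\<bar> = R \<or> \<bar>y\<bar> = h"
    using assms(3) by auto
qed

lemma has_trace_product_rect_path:
  assumes a: "piecewise_derivative a a'" and b: "piecewise_derivative b b'" and "0 < h" "0 < R"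
    and "\<And>x y. \<bar>x\<bar> = R \<or> \<bar>y\<bar> = h \<Longrightarrow> c + a x * b y = d"
  shows "has_trace (Omega h R) (arclength_measure (rect_path h R)) (\<lambda>z. c + a (fst z) * b (snd z)) (\<lambda>_. d)"
proof -
  obtain C where C: "AE t in lebesgue_on {0..1}. norm (vector_derivative (rect_path h R) (at t)) \<le> C"
    using rect_path_speed by blast
  note arc = arclength_measure_of_bounded_speed[OF continuous_on_rect_path C]
  have image: "rect_path h R ` {0..1} = frontier (QR h R)"
    using path_image_rect_path[OF assms(3,4)] by (simp add: path_image_def)
  have "AE z in arclength_measure (rect_path h R). norm z \<le> R + h \<and> c + a (fst z) * b (snd z) = d"
    using arc(3)
  proof eventually_elim
    case (elim z)
    then have "(fst z, snd z) \<in> frontier (QR h R)"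
      using image by simp
    note fr = frontier_QR[OF assms(3,4) this]
    show ?case
      using norm_Pair_le[of "fst z" "snd z"] fr(1,2) assms(5)[OF fr(3)] by simp
  qed
  from has_trace_product[OF open_Omega bounded_Omega a b arc(1,2) this] show ?thesis .
qed

lemma has_trace_product_circle_path:
  assumes a: "piecewise_derivative a a'" and b: "piecewise_derivative b b'"
    and "\<And>x y. \<bar>x\<bar> \<le> 1 \<Longrightarrow> \<bar>y\<bar> \<le> 1 \<Longrightarrow> c + a x * b y = d"
  shows "has_trace (Omega h R) (arclength_measure circle_path) (\<lambda>z. c + a (fst z) * b (snd z)) (\<lambda>_. d)"
proof -
  obtain C where C: "AE t in lebesgue_on {0..1}. norm (vector_derivative circle_path (at t)) \<le> C"
    using circle_path_speed by blast
  note arc = arclength_measure_of_bounded_speed[OF continuous_on_circle_path C]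
  have image: "circle_path ` {0..1} = sphere 0 1"
    using path_image_circle_path by (simp add: path_image_def)
  have "AE z in arclength_measure circle_path. norm z \<le> 1 \<and> c + a (fst z) * b (snd z) = d"
    using arc(3)
  proof eventually_elim
    case (elim z)
    then have "norm z = 1"
      unfolding image by simp
    then show ?case
      using norm_fst_le[of "fst z" "snd z"] norm_snd_le[of "snd z" "fst z"]
        assms(3)[of "fst z" "snd z"] by simp
  qed
  from has_trace_product[OF open_Omega bounded_Omega a b arc(1,2) this] show ?thesis .
qed

text \<open>The fourth power of the length of the field for U = 1, with x, y for \<chi>, \<chi>' and
  k, l for k', k. After integration the constant gives the area 4Rh, and the two terms that are
  linear in k' vanish; this is why neither kind appears in \<open>quartic_energy\<close>.\<close>

lemma quartic_expansion:
  fixes x y k l :: real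
  shows "((1 - x * k)^2 + (y * l)^2)^2 = 1 + (-4) * (x * k) + 6 * (x^2 * k^2) + (-4) * (x^3 * k^3)
    + x^4 * k^4 + 2 * (y^2 * l^2) + (-4) * ((x * y^2) * (k * l^2))
    + 2 * ((x^2 * y^2) * (k^2 * l^2)) + y^4 * l^4"
  by algebra

text \<open>Divergence, traces and regularity hold for all c and s. The norms are left as functions
  of the parameters, so that their choice becomes a problem in real variables.\<close>

lemma field_exists:
  fixes m c s U h R :: real
  assumes m: "m > 0" "h = 1 + m" and R: "R > h" and U: "U > 0"
  shows "\<exists>\<Psi> G1 G2 :: real \<times> real \<Rightarrow> real \<times> real.
    has_H1_gradients (Omega h R) \<Psi> G1 G2 \<and>
    (AE x in lebesgue_on (Omega h R). fst (G1 x) + snd (G2 x) = 0) \<and>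
    has_trace_field (Omega h R) (arclength_measure (rect_path h R)) \<Psi> (\<lambda>_. (U, 0)) \<and>
    has_trace_field (Omega h R) (arclength_measure circle_path) \<Psi> (\<lambda>_. (0, 0)) \<and>
    sqrt ((Lp_norm 2 (lebesgue_on (Omega h R)) G1)\<^sup>2 +
          (Lp_norm 2 (lebesgue_on (Omega h R)) G2)\<^sup>2) = sqrt (grad_energy m c s) * U \<and>
    \<Psi> \<in> Lp 4 (lebesgue_on (Omega h R)) \<and>
    Lp_norm 4 (lebesgue_on (Omega h R)) \<Psi> = root 4 (4 * R * h + quartic_energy m c s) * U"
proof -
  let ?M = "lebesgue_on (Omega h R)"
  define X X1 X2 K K1 K2 where "X = chi m" and "X1 = chi1 m" and "X2 = chi2 m"
    and "K = str m c s" and "K1 = str1 m c s" and "K2 = str2 m c s"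
  note defs = X_def X1_def X2_def K_def K1_def K2_def
  \<comment> \<open>The field is U (1 - \<chi> k', \<chi>' k). The factor U and the sign are
    absorbed into one factor of each product.\<close>
  define a1 b1 a2 b1' a2' where "a1 = X" and "b1 = (\<lambda>y. K1 y * (-U))" and "a2 = (\<lambda>x. X1 x * U)"
    and "b1' = (\<lambda>y. K2 y * (-U))" and "a2' = (\<lambda>x. X2 x * U)"
  note abs = a1_def b1_def a2_def b1'_def a2'_def
  have pw: "piecewise_derivative a1 X1" "piecewise_derivative b1 b1'"
    "piecewise_derivative a2 a2'" "piecewise_derivative K K1"
    unfolding defs abs
    by (intro piecewise_derivative_scale piecewise_derivative_chi piecewise_derivative_chi1
        piecewise_derivative_str piecewise_derivative_str1 m(1))+
  have hR: "0 < h" "0 < R"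
    using m R by auto
  \<comment> \<open>The case \<bar>y\<bar> \<le> 1 comes first in \<open>profile\<close>, so the
    second derivatives, which jump at 1 and -1, take the value 0 there. The gradients thus vanish on
    the whole closed disk.\<close>
  have inner: "X x = 1" "X1 x = 0" "X2 x = 0" "K1 x = 1" "K2 x = 0" if "\<bar>x\<bar> \<le> 1" for x
    using that by (simp_all add: defs chi_def chi1_def chi2_def str1_def str2_def profile_def)
  have outer: "X x = 0" "X1 x = 0" "K x = 0" "K1 x = 0" if "\<bar>x\<bar> \<ge> 1 + m" for x
    using that m(1) by (auto simp: defs chi_def chi1_def str_def str1_def profile_def)
  define \<Psi> where "\<Psi> z = (U + a1 (fst z) * b1 (snd z), 0 + a2 (fst z) * K (snd z))" for z
  define G1 where "G1 z = (X1 (fst z) * b1 (snd z), a1 (fst z) * b1' (snd z))" for z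
  define G2 where "G2 z = (a2' (fst z) * K (snd z), a2 (fst z) * K1 (snd z))" for z
  note meas = piecewise_derivative_measurable[OF pw(1)] piecewise_derivative_measurable[OF pw(2)]
    piecewise_derivative_measurable[OF pw(3)] piecewise_derivative_measurable[OF pw(4)]
  note [measurable] = meas[THEN measurable_fst_borel[where 'b=real]]
    meas[THEN measurable_snd_borel[where 'a=real]]
  have \<Psi>_meas: "\<Psi> \<in> borel_measurable borel"
    unfolding \<Psi>_def by (intro borel_measurable_Pair) measurable
  have G_meas: "G1 \<in> borel_measurable borel" "G2 \<in> borel_measurable borel"
    unfolding G1_def G2_def by (intro borel_measurable_Pair; measurable)+
  have ball: "\<bar>fst z\<bar> \<le> 1" "\<bar>snd z\<bar> \<le> 1" if "norm z \<le> 1" for z :: "real \<times> real"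
    using that norm_fst_le[of "fst z" "snd z"] norm_snd_le[of "snd z" "fst z"] by auto
  have zero: "\<Psi> z = 0" "G1 z = 0" "G2 z = 0" if "norm z \<le> 1" for z
    using inner[OF ball(1)[OF that]] inner[OF ball(2)[OF that]]
    by (simp_all add: \<Psi>_def G1_def G2_def abs zero_prod_def)
  have "1 + m \<le> R"
    using m R by simp
  note cm = chi_moments[OF m(1) this, folded defs] chi_derivative_moments[OF m(1) this, folded defs]
  have "1 + m \<le> h"
    using m by simp
  note sm = str_moments[OF m(1) this, of c s, folded defs]
    str_derivative_moments[OF m(1) this, of c s, folded defs]
  note one = has_moment_const[OF hR(2), of 1] has_moment_const[OF hR(1), of 1]
  let ?I = "indicat_real (QR h R)"
  let ?Y2 = "(tr1_power2_mom (1 + s) m c + tr1_power2_mom (1 - s) m c) / m + 2"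
  let ?YY = "(tr2_power2_mom (1 + s) m c + tr2_power2_mom (1 - s) m c) / m^3"
  let ?Z2 = "m * tr_power2_mom (1 + s) m c + m * tr_power2_mom (1 - s) m c + (2/3 + 2 * s^2)"
  have "has_bochner_integral lborel
    (\<lambda>z. U^2 * (?I z * (X1 (fst z)^2 * K1 (snd z)^2) + ?I z * (X (fst z)^2 * K2 (snd z)^2)))
    (U^2 * (12/5 / m * ?Y2 + (2 + 26/35 * m) * ?YY))"
    by (intro has_bochner_integral_mult_right has_bochner_integral_add
        has_bochner_integral_product cm sm)
  moreover have "(\<lambda>z. U^2 * (?I z * (X1 (fst z)^2 * K1 (snd z)^2) + ?I z * (X (fst z)^2 * K2 (snd z)^2)))
      = (\<lambda>z. ?I z * norm (G1 z)^2)"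
    by (rule ext) (simp add: G1_def abs norm_Pair algebra_simps power_mult_distrib)
  ultimately have G1: "has_bochner_integral ?M (\<lambda>z. norm (G1 z)^2)
      (U^2 * (12/5 / m * ?Y2 + (2 + 26/35 * m) * ?YY))"
    using G_meas zero by (intro has_bochner_integral_Omega) auto
  have "has_bochner_integral lborel
    (\<lambda>z. U^2 * (?I z * (X2 (fst z)^2 * K (snd z)^2) + ?I z * (X1 (fst z)^2 * K1 (snd z)^2)))
    (U^2 * (24 / m^3 * ?Z2 + 12/5 / m * ?Y2))"
    by (intro has_bochner_integral_mult_right has_bochner_integral_add
        has_bochner_integral_product cm sm)
  moreover have "(\<lambda>z. U^2 * (?I z * (X2 (fst z)^2 * K (snd z)^2) + ?I z * (X1 (fst z)^2 * K1 (snd z)^2)))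
      = (\<lambda>z. ?I z * norm (G2 z)^2)"
    by (rule ext) (simp add: G2_def abs norm_Pair algebra_simps power_mult_distrib)
  ultimately have G2: "has_bochner_integral ?M (\<lambda>z. norm (G2 z)^2)
      (U^2 * (24 / m^3 * ?Z2 + 12/5 / m * ?Y2))"
    using G_meas zero by (intro has_bochner_integral_Omega) auto
  let ?Y3 = "(tr1_power3_mom (1 + s) m c + tr1_power3_mom (1 - s) m c) / m^2 + 2"
  let ?Y4 = "(tr1_power4_mom (1 + s) m c + tr1_power4_mom (1 - s) m c) / m^3 + 2"
  let ?YZ = "(tr1_power2_tr_power2_mom (1 + s) m c + tr1_power2_tr_power2_mom (1 - s) m c) / m
      + (2/3 + 2 * s^2)"
  let ?Z4 = "m * tr_power4_mom (1 + s) m c + m * tr_power4_mom (1 - s) m c + (2/5 + 4 * s^2 + 2 * s^4)"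
  let ?F = "\<lambda>z. U^4 * (?I z * (1 * 1) + (-4) * (?I z * (X (fst z) * K1 (snd z)))
      + 6 * (?I z * (X (fst z)^2 * K1 (snd z)^2)) + (-4) * (?I z * (X (fst z)^3 * K1 (snd z)^3))
      + ?I z * (X (fst z)^4 * K1 (snd z)^4) + 2 * (?I z * (X1 (fst z)^2 * K (snd z)^2))
      + (-4) * (?I z * ((X (fst z) * X1 (fst z)^2) * (K1 (snd z) * K (snd z)^2)))
      + 2 * (?I z * ((X (fst z)^2 * X1 (fst z)^2) * (K1 (snd z)^2 * K (snd z)^2)))
      + ?I z * (X1 (fst z)^4 * K (snd z)^4))"
  have "has_bochner_integral lborel ?F
    (U^4 * ((2 * R * 1) * (2 * h * 1) + (-4) * ((2 + m) * 0) + 6 * ((2 + 26/35 * m) * ?Y2)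
      + (-4) * ((2 + 43/70 * m) * ?Y3) + (2 + 382/715 * m) * ?Y4 + 2 * (12/5 / m * ?Z2)
      + (-4) * (6/5 / m * 0) + 2 * (58/77 / m * ?YZ) + 144/35 / m^3 * ?Z4))"
    by (intro has_bochner_integral_mult_right has_bochner_integral_add
        has_bochner_integral_product cm sm one)
  moreover have "?F = (\<lambda>z. ?I z * norm (\<Psi> z)^4)"
  proof
    fix z
    have "norm (\<Psi> z)^2 = (U + a1 (fst z) * b1 (snd z))^2 + (a2 (fst z) * K (snd z))^2"
      unfolding \<Psi>_def norm_Pair by simp
    then have "norm (\<Psi> z)^4 = ((U + a1 (fst z) * b1 (snd z))^2 + (a2 (fst z) * K (snd z))^2)^2"
      using power_mult[of "norm (\<Psi> z)" 2 2] by simp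
    also have "\<dots> = U^4 * ((1 - X (fst z) * K1 (snd z))^2 + (X1 (fst z) * K (snd z))^2)^2"
      unfolding abs by algebra
    finally have norm: "norm (\<Psi> z)^4 = \<dots>" .
    show "?F z = ?I z * norm (\<Psi> z)^4"
      unfolding norm quartic_expansion by algebra
  qed
  moreover have "U^4 * ((2 * R * 1) * (2 * h * 1) + (-4) * ((2 + m) * 0) + 6 * ((2 + 26/35 * m) * ?Y2)
      + (-4) * ((2 + 43/70 * m) * ?Y3) + (2 + 382/715 * m) * ?Y4 + 2 * (12/5 / m * ?Z2)
      + (-4) * (6/5 / m * 0) + 2 * (58/77 / m * ?YZ) + 144/35 / m^3 * ?Z4)
      = U^4 * (4 * R * h + quartic_energy m c s)"
    unfolding quartic_energy_def by simp
  ultimately have int: "has_bochner_integral lborel (\<lambda>z. ?I z * norm (\<Psi> z)^4)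
      (U^4 * (4 * R * h + quartic_energy m c s))"
    by (simp only:)
  have \<Psi>4: "has_bochner_integral ?M (\<lambda>z. norm (\<Psi> z)^4) (U^4 * (4 * R * h + quartic_energy m c s))"
    by (rule has_bochner_integral_Omega[OF _ _ int]) (use \<Psi>_meas zero in auto)
  show ?thesis
  proof (intro exI conjI)
    show "has_H1_gradients (Omega h R) \<Psi> G1 G2"
      using has_H1_gradient_product[OF open_Omega bounded_Omega pw(1,2), of h R U]
        has_H1_gradient_product[OF open_Omega bounded_Omega pw(3,4), of h R 0]
      by (simp only: has_H1_gradients_def \<Psi>_def G1_def[abs_def] G2_def[abs_def] fst_conv snd_conv)
    show "AE z in ?M. fst (G1 z) + snd (G2 z) = 0"
      by (intro AE_I2) (simp add: G1_def G2_def abs)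
    have "U + a1 x * b1 y = U" "0 + a2 x * K y = 0" if "\<bar>x\<bar> = R \<or> \<bar>y\<bar> = h" for x y
      using that outer[of x] outer[of y] m R by (auto simp: abs)
    then show "has_trace_field (Omega h R) (arclength_measure (rect_path h R)) \<Psi> (\<lambda>_. (U, 0))"
      using has_trace_product_rect_path[OF pw(1,2) hR, of U U]
        has_trace_product_rect_path[OF pw(3,4) hR, of 0 0]
      by (simp only: has_trace_field_def \<Psi>_def fst_conv snd_conv)
    have "U + a1 x * b1 y = 0" "0 + a2 x * K y = 0" if "\<bar>x\<bar> \<le> 1" "\<bar>y\<bar> \<le> 1" for x y
      using inner[OF that(1)] inner[OF that(2)] by (auto simp: abs)
    then show "has_trace_field (Omega h R) (arclength_measure circle_path) \<Psi> (\<lambda>_. (0, 0))"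
      using has_trace_product_circle_path[OF pw(1,2), of U 0]
        has_trace_product_circle_path[OF pw(3,4), of 0 0]
      by (simp only: has_trace_field_def \<Psi>_def fst_conv snd_conv)
    have sq: "(Lp_norm 2 ?M f)^2 = I" if "has_bochner_integral ?M (\<lambda>z. norm (f z)^2) I"
      for f :: "real \<times> real \<Rightarrow> real \<times> real" and I
    proof -
      have "(LINT z|?M. norm (f z)^2) = I"
        using that by (rule has_bochner_integral_integral_eq)
      moreover have "(LINT z|?M. norm (f z)^2) \<ge> 0"
        by (rule integral_nonneg_AE) simp
      ultimately show ?thesis
        by (simp add: Lp_norm_def sqrt_def[symmetric])
    qed
    \<comment> \<open>The diagonal entries of the gradient are opposite, since the divergence is 0.
      Their equal squares produce the factor 2 in \<open>grad_energy\<close>.\<close>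
    have "(Lp_norm 2 ?M G1)^2 + (Lp_norm 2 ?M G2)^2 = grad_energy m c s * U^2"
      unfolding sq[OF G1] sq[OF G2] grad_energy_def by (simp add: algebra_simps)
    then show "sqrt ((Lp_norm 2 ?M G1)\<^sup>2 + (Lp_norm 2 ?M G2)\<^sup>2) = sqrt (grad_energy m c s) * U"
      using U by (simp add: real_sqrt_mult)
    show "\<Psi> \<in> Lp 4 ?M"
      using \<Psi>4 borel_measurable_lebesgue_on[OF \<Psi>_meas] by (simp add: Lp_def has_bochner_integral_iff)
    show "Lp_norm 4 ?M \<Psi> = root 4 (4 * R * h + quartic_energy m c s) * U"
      using U unfolding Lp_norm_def has_bochner_integral_integral_eq[OF \<Psi>4]
      by (simp add: real_root_mult real_root_power_cancel)
  qed
qed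

section \<open>Choice of the parameters\<close>

text \<open>The moments involved are quadratic forms in (a, b, c), and s enters only through a = 1 +
  s and a = 1 - s. The terms linear in s cancel in the sum, and those in s^2 come from a^2 and the
  shifted central piece, so their coefficient is free of \<theta>.\<close>

lemma grad_energy_eq:
  fixes m \<theta> s :: real
  assumes "m > 0"
  shows "grad_energy m (- (\<theta> * m)) s = B1 (1 + m)
    - ((2096/75 * \<theta> - 528/35 * \<theta>^2) / m + 2316/175 * \<theta> - 271144/40425 * \<theta>^2)
    + (8256/175 / m^2 + 96 / m^3) * s^2"
  using assms
  unfolding grad_energy_def B1_def tr1_power2_mom_def tr2_power2_mom_def tr_power2_mom_def
  by (simp add: divide_simps) algebra

text \<open>The subtracted bracket is the shortfall of the symmetric field; all its coefficients are
  positive.\<close>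

lemma quartic_energy_start:
  fixes m R :: real
  assumes "m > 0"
  shows "4 * R * (1 + m) + quartic_energy m 0 0 = B2 (1 + m) R
    - (7228/13475 * m^2 + 10292/2695 * m + 1712/175 + 48/5 / m)"
  using assms
  unfolding quartic_energy_def B2_def tr1_power2_mom_def tr1_power3_mom_def tr1_power4_mom_def
    tr_power2_mom_def tr_power4_mom_def tr1_power2_tr_power2_mom_def
  by (simp add: divide_simps) algebra

text \<open>The case \<theta> = 1 with s still free. The part without s is negative for large m, so
  the lower estimate has to use the term in s^2.\<close>

lemma quartic_energy_end:
  fixes m s R :: real
  assumes "m > 0"
  shows "4 * R * (1 + m) + quartic_energy m (- m) s = B2 (1 + m) R
    + (- 57270783142/24273474225 * m^2 - 87566128536/8091158075 * m - 21203676124/1277551275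
       - 19932664/1926925 / m + 576/385 / m^2)
    + (2223938272/116141025 + 167181188/1926925 / m + 239081952/1926925 / m^2 + 2304/35 / m^3) * s^2
    + (10657832/1926925 / m^2 + 576/35 / m^3) * s^4"
proof -
  \<comment> \<open>In the sums over 1 + s and 1 - s the odd powers of s cancel; collapsing them
    before clearing denominators keeps the final identity small.\<close>
  have mom:
    "tr1_power2_mom (1 + s) m (- m) + tr1_power2_mom (1 - s) m (- m) =
      106/315 * m^2 + 18/35 * m + 12/5 * s^2 + 12/5"
    "tr1_power3_mom (1 + s) m (- m) + tr1_power3_mom (1 - s) m (- m) =
      141/1001 * m^3 - 8/11 * m^2 - 48/35 * m * s^2 - 48/35 * m - 324/35 * s^2 - 108/35"
    "tr1_power4_mom (1 + s) m (- m) + tr1_power4_mom (1 - s) m (- m) =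
      2738/17017 * m^4 - 6/143 * m^3 + 1572/1001 * m^2 * s^2 + 1572/1001 * m^2 + 648/77 * m * s^2 + 216/77 * m + 144/35 * s^4 + 864/35 * s^2 + 144/35"
    "tr_power2_mom (1 + s) m (- m) + tr_power2_mom (1 - s) m (- m) =
      29/1386 * m^2 + 2/9 * m + 26/35 * s^2 + 26/35"
    "tr_power4_mom (1 + s) m (- m) + tr_power4_mom (1 - s) m (- m) =
      1111/2645370 * m^4 + 1226/146965 * m^3 + 5662/85085 * m^2 * s^2 + 5662/85085 * m^2 + 4/5 * m * s^2 + 4/15 * m + 382/715 * s^4 + 2292/715 * s^2 + 382/715"
    "tr1_power2_tr_power2_mom (1 + s) m (- m) + tr1_power2_tr_power2_mom (1 - s) m (- m) =
      11684/4849845 * m^4 + 10432/255255 * m^3 + 574/2145 * m^2 * s^2 + 574/2145 * m^2 + 333/715 * m * s^2 + 111/715 * m + 58/77 * s^4 + 348/77 * s^2 + 58/77"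
    unfolding tr1_power2_mom_def tr1_power3_mom_def tr1_power4_mom_def tr_power2_mom_def
      tr_power4_mom_def tr1_power2_tr_power2_mom_def
    by algebra+
  show ?thesis
    using assms unfolding quartic_energy_def B2_def distrib_left[of m, symmetric] mom
    by (simp add: divide_simps) algebra
qed

lemma excess_polynomial_pos:
  fixes m :: real
  assumes "m > 0"
  shows "0 < 1219641359903744/89205017776875 * m^5 + 3898020934866704/51645010291875 * m^4
    + 2608918028038144/25160389629375 * m^3 - 4170624608896/74523824375 * m^2
    - 730800384/9634625 * m + 55296/385" (is "0 < ?p")
proof -
  \<comment> \<open>All coefficients rounded down to integers, with the positive term in m^5
    dropped.\<close>
  define l where "l = 75 * m^4 + 103 * m^3 - 56 * m^2 - 76 * m + 143"
  have "l > 0"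
  proof (cases "m \<ge> 1")
    case True
    \<comment> \<open>Replacing m and m^2 by m^3 leaves 75 m^4 - 29 m^3 + 143, where m^3 \<le> m^4.
      In the other case 143 - 132 m remains, which is positive because m < 1.\<close>
    have "m \<le> m^3" "m^2 \<le> m^3" "m^3 \<le> m^4"
      using True self_le_power[of m 3] power_increasing[of 2 3 m] power_increasing[of 3 4 m] by simp_all
    then show ?thesis
      using True unfolding l_def by linarith
  next
    case False
    have "m^2 \<le> m" "0 \<le> m^3" "0 \<le> m^4"
      using False assms by (simp_all add: power2_eq_square mult_left_le_one_le)
    then show ?thesis
      using False unfolding l_def by linarith
  qed
  moreover have "0 \<le> m" "0 \<le> m^2" "0 \<le> m^3" "0 \<le> m^4" "0 \<le> m^5"
    using assms by simp_all
  ultimately show ?thesis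
    unfolding l_def by linarith
qed

text \<open>The hypothesis is the gradient constraint at \<theta> = 1. Multiplying by the positive
  coefficient of s^2 in it eliminates s^2 and leaves a rational function of m, whose numerator is
  the quintic above; the term in s^4 is nonnegative and can be discarded.\<close>

lemma excess_nonneg:
  fixes m s :: real
  assumes "m > 0"
    and s: "(8256/175 / m^2 + 96 / m^3) * s^2 = 6752/525 / m + 263852/40425"
  shows "0 \<le> (- 57270783142/24273474225 * m^2 - 87566128536/8091158075 * m - 21203676124/1277551275
       - 19932664/1926925 / m + 576/385 / m^2)
    + (2223938272/116141025 + 167181188/1926925 / m + 239081952/1926925 / m^2 + 2304/35 / m^3) * s^2
    + (10657832/1926925 / m^2 + 576/35 / m^3) * s^4" (is "0 \<le> ?A + ?B * s^2 + ?E * s^4")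
proof -
  let ?C = "8256/175 / m^2 + 96 / m^3"
  have "?C * (?A + ?B * s^2) = ?C * ?A + ?B * (6752/525 / m + 263852/40425)"
    unfolding s[symmetric] by algebra
  also have "\<dots> = (1219641359903744/89205017776875 * m^5 + 3898020934866704/51645010291875 * m^4
    + 2608918028038144/25160389629375 * m^3 - 4170624608896/74523824375 * m^2
    - 730800384/9634625 * m + 55296/385) / m^5"
    using assms(1) by (simp add: divide_simps) algebra
  also have "\<dots> > 0"
    using excess_polynomial_pos[OF assms(1)] assms(1) by (intro divide_pos_pos) simp_all
  finally have "?C * (?A + ?B * s^2) > 0" .
  moreover have "?C > 0"
    using assms(1) by (intro add_pos_pos divide_pos_pos) simp_all
  ultimately have "?A + ?B * s^2 > 0"
    using zero_less_mult_pos by blast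
  moreover have "?E * s^4 \<ge> 0"
    using assms(1) by (intro mult_nonneg_nonneg add_nonneg_nonneg divide_nonneg_nonneg) simp_all
  ultimately show ?thesis
    by linarith
qed

text \<open>For each \<open>\<theta>\<close> the asymmetry \<open>s\<close> restores the value of the gradient energy that \<open>c = -\<theta>m\<close>
  lowers; the quartic energy then passes through its target between \<open>\<theta> = 0\<close> and \<open>\<theta> = 1\<close>.\<close>

lemma parameters_exist:
  fixes m R :: real
  assumes "m > 0"
  shows "\<exists>c s. grad_energy m c s = B1 (1 + m) \<and> 4 * R * (1 + m) + quartic_energy m c s = B2 (1 + m) R"
proof -
  \<comment> \<open>D(\<theta>) is the gradient energy lost by c = -\<theta> m, and C s^2 is the
    energy gained by the asymmetry. Equating them defines s(\<theta>).\<close>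
  define C where "C = 8256/175 / m^2 + 96 / m^3"
  define D where "D \<theta> = (2096/75 * \<theta> - 528/35 * \<theta>^2) / m + 2316/175 * \<theta> - 271144/40425 * \<theta>^2"
    for \<theta> :: real
  define s where "s \<theta> = sqrt (D \<theta> / C)" for \<theta>
  have C: "C > 0"
    unfolding C_def using assms by (intro add_pos_pos divide_pos_pos) simp_all
  \<comment> \<open>As \<theta>^2 \<le> \<theta> on [0, 1], it suffices that each linear coefficient
    exceeds the quadratic one.\<close>
  have D: "D \<theta> \<ge> 0" if "0 \<le> \<theta>" "\<theta> \<le> 1" for \<theta>
  proof -
    have "\<theta>^2 \<le> \<theta>"
      using that by (simp add: power2_eq_square mult_left_le_one_le)
    then have "0 \<le> 2096/75 * \<theta> - 528/35 * \<theta>^2" "0 \<le> 2316/175 * \<theta> - 271144/40425 * \<theta>^2"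
      using that(1) by linarith+
    then show ?thesis
      using assms unfolding D_def by (simp add: add_nonneg_nonneg add.assoc flip: add_diff_eq)
  qed
  have s: "C * (s \<theta>)^2 = D \<theta>" if "0 \<le> \<theta>" "\<theta> \<le> 1" for \<theta>
    using C D[OF that] by (simp add: s_def)
  define f where "f \<theta> = 4 * R * (1 + m) + quartic_energy m (- (\<theta> * m)) (s \<theta>)" for \<theta>
  have "f 0 \<le> B2 (1 + m) R"
  proof -
    have "s 0 = 0"
      by (simp add: s_def D_def)
    moreover have "0 \<le> 7228/13475 * m^2 + 10292/2695 * m + 1712/175 + 48/5 / m"
      using assms by (intro add_nonneg_nonneg mult_nonneg_nonneg divide_nonneg_nonneg) simp_all
    ultimately show ?thesis
      using quartic_energy_start[OF assms, of R] by (simp add: f_def)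
  qed
  moreover have "B2 (1 + m) R \<le> f 1"
  proof -
    have "(8256/175 / m^2 + 96 / m^3) * (s 1)^2 = 6752/525 / m + 263852/40425"
      using s[of 1] unfolding C_def D_def by simp
    from excess_nonneg[OF assms this] show ?thesis
      using quartic_energy_end[OF assms, of R "s 1"] unfolding f_def by simp
  qed
  moreover have "continuous_on {0..1} f"
  proof -
    have "continuous_on {0..1} s"
      unfolding s_def D_def using assms C by (intro continuous_intros) auto
    then show ?thesis
      unfolding f_def quartic_energy_def tr1_power2_mom_def tr1_power3_mom_def tr1_power4_mom_def
        tr_power2_mom_def tr_power4_mom_def tr1_power2_tr_power2_mom_def
      using assms by (intro continuous_intros) auto
  qed
  ultimately obtain \<theta> where \<theta>: "0 \<le> \<theta>" "\<theta> \<le> 1" "f \<theta> = B2 (1 + m) R"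
    using IVT'[of f 0 "B2 (1 + m) R" 1] by auto
  show ?thesis
  proof (intro exI conjI)
    show "grad_energy m (- (\<theta> * m)) (s \<theta>) = B1 (1 + m)"
      using grad_energy_eq[OF assms, of \<theta> "s \<theta>"] s[OF \<theta>(1,2)] unfolding C_def D_def by linarith
    show "4 * R * (1 + m) + quartic_energy m (- (\<theta> * m)) (s \<theta>) = B2 (1 + m) R"
      using \<theta>(3) by (simp add: f_def)
  qed
qed

theorem theorem4p2:
  fixes h U :: real
  assumes "h > 1" and "U > 0"
  shows "\<forall>R>h. \<exists>\<Psi> G1 G2 :: real \<times> real \<Rightarrow> real \<times> real.
    has_H1_gradients (Omega h R) \<Psi> G1 G2 \<and>
    (AE x in lebesgue_on (Omega h R). fst (G1 x) + snd (G2 x) = 0) \<and>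
    has_trace_field (Omega h R) (arclength_measure (rect_path h R)) \<Psi> (\<lambda>_. (U, 0)) \<and>
    has_trace_field (Omega h R) (arclength_measure circle_path) \<Psi> (\<lambda>_. (0, 0)) \<and>
    sqrt ((Lp_norm 2 (lebesgue_on (Omega h R)) G1)\<^sup>2 +
          (Lp_norm 2 (lebesgue_on (Omega h R)) G2)\<^sup>2) = sqrt (B1 h) * U \<and>
    \<Psi> \<in> Lp 4 (lebesgue_on (Omega h R)) \<and>
    Lp_norm 4 (lebesgue_on (Omega h R)) \<Psi> = root 4 (B2 h R) * U"
proof (intro allI impI)
  fix R :: real
  assume "R > h"
  define m where "m = h - 1"
  have m: "m > 0" "h = 1 + m"
    using assms by (simp_all add: m_def)
  obtain c s where c: "grad_energy m c s = B1 h" "4 * R * h + quartic_energy m c s = B2 h R"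
    using parameters_exist[OF m(1), of R] m(2) by auto
  show "\<exists>\<Psi> G1 G2 :: real \<times> real \<Rightarrow> real \<times> real.
    has_H1_gradients (Omega h R) \<Psi> G1 G2 \<and>
    (AE x in lebesgue_on (Omega h R). fst (G1 x) + snd (G2 x) = 0) \<and>
    has_trace_field (Omega h R) (arclength_measure (rect_path h R)) \<Psi> (\<lambda>_. (U, 0)) \<and>
    has_trace_field (Omega h R) (arclength_measure circle_path) \<Psi> (\<lambda>_. (0, 0)) \<and>
    sqrt ((Lp_norm 2 (lebesgue_on (Omega h R)) G1)\<^sup>2 +
          (Lp_norm 2 (lebesgue_on (Omega h R)) G2)\<^sup>2) = sqrt (B1 h) * U \<and>
    \<Psi> \<in> Lp 4 (lebesgue_on (Omega h R)) \<and>
    Lp_norm 4 (lebesgue_on (Omega h R)) \<Psi> = root 4 (B2 h R) * U"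
    using field_exists[OF m \<open>R > h\<close> \<open>U > 0\<close>, of c s] unfolding c .
qed



end
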